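(* Let $R=R(X_\ell,S)$ be a simply laced extended affine root system of type $X_\ell$ and nullity $\nu$ with Heisenberg-like group $\mathcal H$. Let $A=(a_{i,j})_{1\le i,j\le\ell}$ be the Cartan matrix of type $X_\ell$, $a_{i,j}=(\alpha_i,\alpha_j)$, for $1\le r<s\le\nu$ let $n(r,s)=\min\{n\in\mathbb N=\{1,2,\dots\}:c_{r,s}^n\in F(S)\}$, and let $m=\mathrm{ind}(S)$. (a) If $$( * )\qquad F(S)\text{ is generated by the elements } c_{r,s}^{\,n(r,s)},\quad 1\le r<s\le\nu,$$ then $\mathcal H$ is isomorphic to the group $\widehat{\mathcal H}$ defined by generators $y_{i,r}$ ($1\le i\le\ell$, $1\le r\le\nu$), $z_{r,s}$ ($1\le r<s\le\nu$) and the relations (for all admissible indices) $$[z_{r,s},z_{r',s'}]=1,\quad [y_{i,r},z_{r',s'}]=1,\quad [y_{i,r},y_{j,r}]=1,\quad [y_{i,r},y_{j,s}]=z_{r,s}^{\,a_{i,j}n(r,s)^{-1}}\ (r<s).$$ (b) If $\ell>1$, then $( * )$ is automatically satisfied and $n(r,s)=1$ for all $r,s$. (c) If $\ell=1$ and $\nu\le3$, then $( * )$ is automatically satisfied and the integers $n(r,s)$ are given, depending on $m$, as follows: for $\nu=0$ ($m=0$) and $\nu=1$ ($m=1$) there are none; for $\nu=2$: $n(1,2)=2$ if $m=2$, and $n(1,2)=1$ if $m=3$; for $\nu=3$: $(n(1,2),n(1,3),n(2,3))=(2,2,2)$ if $m=3$, $(2,2,1)$ if $m=4$, $(2,1,1)$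 if $m=5$, $(1,1,1)$ if $m=6$ or $m=7$.
   Context: Commutators: $[x,y]=x^{-1}y^{-1}xy$. Extended affine root systems. Let $V$ be a nontrivial finite-dimensional real vector space with a positive semidefinite symmetric bilinear form $(\cdot,\cdot)$ with radical $V^0$; for nonisotropic $\alpha$ put $\alpha^\vee=2\alpha/(\alpha,\alpha)$, and for $A\subseteq V$ let $A^\times=\{\alpha\in A:(\alpha,\alpha)\neq0\}$. A subset $R\subseteq V$ is an extended affine root system if: $0\in R$; $-R=R$; $R$ spans $V$; $\alpha\in R^\times\Rightarrow 2\alpha\notin R$; $R$ is discrete; for $\alpha\in R^\times,\beta\in R$ there are integers $d,u\ge0$ such that, for $n\in\mathbb Z$, $\beta+n\alpha\in R\iff -d\le n\le u$, and $(\beta,\alpha^\vee)=d-u$; $R$ is not a union of two nonempty mutually orthogonal subsets $R_1,R_2$; for each isotropic $\sigma\in R$ there is $\alpha\in R^\times$ with $\alpha+\sigma\in R$. Nullity: $\nu=\dim V^0$; rank: $\ell=\dim V/V^0$; the type is that of the image of $R$ in $V/V^0$, an irreducible finite root system (with $0$ included). $R$ is simply laced if its type $X_\ell$ is $A_\ell$, $D_\ell$, $E_6$, $E_7$ or $E_8$. A semilattice in $V^0$ is a discrete spanning subset $S$ with $0\in S$ and $S\pm2S\subseteq S$; it is a lattice if $S\pm S\subseteq S$. By known structure theory, for $R$ simply laced one can fix a complement $\dot V$ of $V^0$ in $V$ such that $\dot R=\{\dot\alpha\in\dot V:\dot\alpha+\sigma\in R\text{ for some }\sigma\in V^0\}$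 is a finite root system of type $X_\ell$ (with $0$) in $\dot V$ and $R=R(X_\ell,S)=(S+S)\cup(\dot R+S)$ with $S$ a semilattice in $V^0$; if $\ell>1$, $S$ is a lattice. Fix a fundamental system $\alpha_1,\dots,\alpha_\ell$ of $\dot R$, with $(\alpha_i,\alpha_i)=2$, and a $\mathbb Z$-basis $B=\{\sigma_1,\dots,\sigma_\nu\}\subseteq S$ of the lattice $\Lambda$ generated by $S$. Supporting class: for $\sigma\in\Lambda$ let $\mathrm{supp}(\sigma)\subseteq\{1,\dots,\nu\}$ be the set of $r$ for which the coefficient of $\sigma_r$ in $\sigma$ is odd, and $\mathrm{supp}(S)=\{\mathrm{supp}(\sigma):\sigma\in S\}$. Then $S=\biguplus_{J\in\mathrm{supp}(S)}(\sum_{r\in J}\sigma_r+2\Lambda)$, and the index is $\mathrm{ind}(S)=|\mathrm{supp}(S)|-1$. Groups: $\tilde V=V\oplus(V^0)^*$, with the form extended from $V$ by $(\dot V,(V^0)^* )=((V^0)^*,(V^0)^* )=0$ and $(\sigma_r,\lambda_s)=\delta_{r,s}$, where $\lambda_1,\dots,\lambda_\nu$ is a basis of $(V^0)^*$. For $\alpha\in V^\times$, $w_\alpha(u)=u-(u,\alpha^\vee)\alpha$ ($u\in\tilde V$). The Heisenberg-like group is $\mathcal H=\langle w_{\alpha+\sigma}w_\alpha:\alpha\in R^\times,\sigma\in V^0,\alpha+\sigma\in R\rangle\le GL(\tilde V)$. For $\alpha\in V,\sigma\in V^0$ put $T_\alpha^\sigma(u)=u-(\sigma,u)\alpha+(\alpha,u)\sigma-\frac{(\alpha,\alpha)}2(\sigma,u)\sigma$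 and $c_{r,s}=T_{\sigma_r}^{\sigma_s}$. The $c_{r,s}$ ($r<s$) freely generate a free abelian group $C$. For $J\subseteq\{1,\dots,\nu\}$ put $z_J=\prod_{r,s\in J,\,r<s}c_{r,s}$ if $J\in\mathrm{supp}(S)$ (empty product $=1$); $z_J=c_{r,s}^2$ if $J=\{r,s\}\notin\mathrm{supp}(S)$, $r<s$; and $z_J=1$ otherwise. Put $F(S)=\langle z_J:J\subseteq\{1,\dots,\nu\}\rangle\le C$. It is known that $n(r,s)$ divides every $a_{i,j}$. Background on semilattices of rank $\nu\le3$: semilattices $S,S'$ in $V^0$ are similar if $\psi(S)=S'+\sigma'$ for some $\psi\in GL(V^0)$ and $\sigma'\in S'$. Up to similarity, the semilattices of rank $\le3$ have the following supporting classes, according to $m=\mathrm{ind}(S)$. $\nu=0$: $\{\emptyset\}$ ($m=0$). $\nu=1$: $\{\emptyset,\{1\}\}$ ($m=1$). $\nu=2$: $\{\emptyset,\{1\},\{2\}\}$ ($m=2$); $\{\emptyset,\{1\},\{2\},\{1,2\}\}$ ($m=3$). $\nu=3$: $\{\emptyset,\{1\},\{2\},\{3\}\}$ ($m=3$); this together with $\{2,3\}$ ($m=4$); together with $\{1,3\},\{2,3\}$ ($m=5$); together with $\{1,2\},\{1,3\},\{2,3\}$ ($m=6$); all subsets of $\{1,2,3\}$ ($m=7$).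
   Formalization: In (c), ( * ) and the table are claimed when supp(S) is the listed class for (ν,m), and every R is shown to admit such S (up to similarity) and basis; for an arbitrary basis (c) is false (ν=3, m=4, extra class {1,2,3}). Irreducibility is imposed on R^×. *)

theory Defs
  imports
    "HOL-Analysis.Analysis"
    "HOL-Algebra.Bij"
    "HOL-Algebra.Generated_Groups"
    "HOL-Algebra.FiniteProduct"
    "HOL-Computational_Algebra.Group_Closure"
begin

section \<open>Extended affine root systems\<close>

text \<open>The space $V$ is a type of class \<^class>\<open>euclidean_space\<close>; the inner product of that class is
  used only for the (canonical) topology, and the form of the theory is the separate
  parameter \<open>form\<close>.\<close>

definition psd_form :: "('v::euclidean_space \<Rightarrow> 'v \<Rightarrow> real) \<Rightarrow> bool" where
  "psd_form form \<longleftrightarrow>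
     bilinear form \<and> (\<forall>x y. form x y = form y x) \<and> (\<forall>x. 0 \<le> form x x)"

definition form_radical :: "('v::euclidean_space \<Rightarrow> 'v \<Rightarrow> real) \<Rightarrow> 'v set" where
  "form_radical form = {v. \<forall>w. form v w = 0}"

definition nullity :: "('v::euclidean_space \<Rightarrow> 'v \<Rightarrow> real) \<Rightarrow> nat" where
  "nullity form = dim (form_radical form)"

definition form_rank :: "('v::euclidean_space \<Rightarrow> 'v \<Rightarrow> real) \<Rightarrow> nat" where
  "form_rank form = DIM('v) - nullity form"

definition coroot :: "('v::euclidean_space \<Rightarrow> 'v \<Rightarrow> real) \<Rightarrow> 'v \<Rightarrow> 'v" where
  "coroot form \<alpha> = (2 / form \<alpha> \<alpha>) *\<^sub>R \<alpha>"

definition nonisotropic :: "('v::euclidean_space \<Rightarrow> 'v \<Rightarrow> real) \<Rightarrow> 'v set \<Rightarrow> 'v set" where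
  "nonisotropic form A = {\<alpha> \<in> A. form \<alpha> \<alpha> \<noteq> 0}"

text \<open>In the irreducibility axiom the decomposition is one of the set of nonisotropic elements:
  every isotropic element, in particular $0$, is orthogonal to everything, so $R$ itself always is
  the union of $\{0\}$ and $R$.\<close>

definition extended_affine_root_system ::
    "('v::euclidean_space \<Rightarrow> 'v \<Rightarrow> real) \<Rightarrow> 'v set \<Rightarrow> bool" where
  "extended_affine_root_system form R \<longleftrightarrow>
     psd_form form \<and>
     0 \<in> R \<and>
     uminus ` R = R \<and>
     span R = UNIV \<and>
     (\<forall>\<alpha> \<in> nonisotropic form R. 2 *\<^sub>R \<alpha> \<notin> R) \<and>
     discrete R \<and>
     (\<forall>\<alpha> \<in> nonisotropic form R. \<forall>\<beta> \<in> R. \<exists>d u :: nat.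
        (\<forall>n::int. \<beta> + of_int n *\<^sub>R \<alpha> \<in> R \<longleftrightarrow> - int d \<le> n \<and> n \<le> int u) \<and>
        form \<beta> (coroot form \<alpha>) = real d - real u) \<and>
     \<not> (\<exists>R1 R2. R1 \<noteq> {} \<and> R2 \<noteq> {} \<and> nonisotropic form R = R1 \<union> R2 \<and>
          (\<forall>\<alpha> \<in> R1. \<forall>\<beta> \<in> R2. form \<alpha> \<beta> = 0)) \<and>
     (\<forall>\<sigma> \<in> R. form \<sigma> \<sigma> = 0 \<longrightarrow> (\<exists>\<alpha> \<in> nonisotropic form R. \<alpha> + \<sigma> \<in> R))"


section \<open>Finite root systems of simply laced type\<close>

text \<open>Finite root systems contain $0$; $W$ is the ambient space.\<close>

definition finite_root_system ::
    "('v::euclidean_space \<Rightarrow> 'v \<Rightarrow> real) \<Rightarrow> 'v set \<Rightarrow> 'v set \<Rightarrow> bool" where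
  "finite_root_system form W \<Phi> \<longleftrightarrow>
     subspace W \<and> (\<forall>x \<in> W. x \<noteq> 0 \<longrightarrow> 0 < form x x) \<and>
     finite \<Phi> \<and> 0 \<in> \<Phi> \<and> span \<Phi> = W \<and>
     (\<forall>\<alpha> \<in> \<Phi> - {0}. \<forall>\<beta> \<in> \<Phi>.
        form \<beta> (coroot form \<alpha>) \<in> \<int> \<and> \<beta> - form \<beta> (coroot form \<alpha>) *\<^sub>R \<alpha> \<in> \<Phi>) \<and>
     (\<forall>\<alpha> \<in> \<Phi> - {0}. \<forall>t. t *\<^sub>R \<alpha> \<in> \<Phi> \<longrightarrow> t \<in> {-1, 0, 1})"

definition fundamental_system :: "'v::euclidean_space set \<Rightarrow> nat \<Rightarrow> (nat \<Rightarrow> 'v) \<Rightarrow> bool" where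
  "fundamental_system \<Phi> l \<alpha> \<longleftrightarrow>
     (\<forall>i \<in> {1..l}. \<alpha> i \<in> \<Phi>) \<and> inj_on \<alpha> {1..l} \<and> independent (\<alpha> ` {1..l}) \<and>
     (\<forall>\<beta> \<in> \<Phi>. \<exists>k :: nat \<Rightarrow> nat.
        \<beta> = (\<Sum>i=1..l. real (k i) *\<^sub>R \<alpha> i) \<or> \<beta> = - (\<Sum>i=1..l. real (k i) *\<^sub>R \<alpha> i))"

datatype ade_type = Type_A nat | Type_D nat | Type_E nat

fun type_rank :: "ade_type \<Rightarrow> nat" where
  "type_rank (Type_A l) = l"
| "type_rank (Type_D l) = l"
| "type_rank (Type_E l) = l"

fun valid_type :: "ade_type \<Rightarrow> bool" where
  "valid_type (Type_A l) \<longleftrightarrow> 1 \<le> l"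
| "valid_type (Type_D l) \<longleftrightarrow> 4 \<le> l"
| "valid_type (Type_E l) \<longleftrightarrow> l \<in> {6, 7, 8}"

text \<open>Dynkin diagrams in Bourbaki's numbering; each edge is listed once, smaller vertex first.\<close>

fun dynkin_edges :: "ade_type \<Rightarrow> (nat \<times> nat) set" where
  "dynkin_edges (Type_A l) = {(i, i + 1) | i. 1 \<le> i \<and> i < l}"
| "dynkin_edges (Type_D l) = {(i, i + 1) | i. 1 \<le> i \<and> i < l - 1} \<union> {(l - 2, l)}"
| "dynkin_edges (Type_E l) = {(1, 3), (2, 4)} \<union> {(i, i + 1) | i. 3 \<le> i \<and> i < l}"

definition cartan_matrix :: "ade_type \<Rightarrow> nat \<Rightarrow> nat \<Rightarrow> int" where
  "cartan_matrix X i j =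
     (if i = j then 2
      else if (i, j) \<in> dynkin_edges X \<or> (j, i) \<in> dynkin_edges X then -1 else 0)"

definition root_system_of_type ::
    "('v::euclidean_space \<Rightarrow> 'v \<Rightarrow> real) \<Rightarrow> 'v set \<Rightarrow> 'v set \<Rightarrow> ade_type \<Rightarrow> bool" where
  "root_system_of_type form W \<Phi> X \<longleftrightarrow>
     finite_root_system form W \<Phi> \<and> valid_type X \<and>
     (\<exists>\<beta>. fundamental_system \<Phi> (type_rank X) \<beta> \<and>
        (\<forall>i \<in> {1..type_rank X}. \<forall>j \<in> {1..type_rank X}.
           form (\<beta> i) (coroot form (\<beta> j)) = of_int (cartan_matrix X i j)))"


section \<open>Semilattices and the description of simply laced extended affine root systems\<close>

definition semilattice_in :: "'v::euclidean_space set \<Rightarrow> 'v set \<Rightarrow> bool" where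
  "semilattice_in V0 S \<longleftrightarrow>
     S \<subseteq> V0 \<and> discrete S \<and> span S = V0 \<and> 0 \<in> S \<and>
     (\<forall>s \<in> S. \<forall>t \<in> S. s + 2 *\<^sub>R t \<in> S \<and> s - 2 *\<^sub>R t \<in> S)"

definition lattice_in :: "'v::euclidean_space set \<Rightarrow> 'v set \<Rightarrow> bool" where
  "lattice_in V0 S \<longleftrightarrow>
     semilattice_in V0 S \<and> (\<forall>s \<in> S. \<forall>t \<in> S. s + t \<in> S \<and> s - t \<in> S)"

definition z_basis :: "nat \<Rightarrow> (nat \<Rightarrow> 'v::euclidean_space) \<Rightarrow> 'v set \<Rightarrow> bool" where
  "z_basis \<nu> \<sigma> L \<longleftrightarrow>
     L = {(\<Sum>r=1..\<nu>. of_int (k r) *\<^sub>R \<sigma> r) | k :: nat \<Rightarrow> int. True} \<and>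
     (\<forall>k :: nat \<Rightarrow> int. (\<Sum>r=1..\<nu>. of_int (k r) *\<^sub>R \<sigma> r) = 0 \<longrightarrow> (\<forall>r \<in> {1..\<nu>}. k r = 0))"

definition complement_of :: "'v::euclidean_space set \<Rightarrow> 'v set \<Rightarrow> bool" where
  "complement_of V0 Vd \<longleftrightarrow> subspace Vd \<and> Vd \<inter> V0 = {0} \<and> Vd + V0 = UNIV"

text \<open>The image of $R$ in $V/V^0$, transported to the complement \<open>Vd\<close> of $V^0$.\<close>

definition finite_part ::
    "('v::euclidean_space \<Rightarrow> 'v \<Rightarrow> real) \<Rightarrow> 'v set \<Rightarrow> 'v set \<Rightarrow> 'v set" where
  "finite_part form Vd R = {\<alpha> \<in> Vd. \<exists>\<sigma> \<in> form_radical form. \<alpha> + \<sigma> \<in> R}"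

text \<open>$R = R(X_\ell,S)$ together with the choices made for it: the complement \<open>Vd\<close>, the semilattice
  \<open>S\<close>, the fundamental system $\alpha_1,\dots,\alpha_\ell$ and the basis
  $\sigma_1,\dots,\sigma_\nu$ of the lattice generated by \<open>S\<close>. Families are indexed from $1$.\<close>

definition simply_laced_ears ::
    "('v::euclidean_space \<Rightarrow> 'v \<Rightarrow> real) \<Rightarrow> 'v set \<Rightarrow> ade_type \<Rightarrow> 'v set \<Rightarrow> 'v set \<Rightarrow>
     (nat \<Rightarrow> 'v) \<Rightarrow> (nat \<Rightarrow> 'v) \<Rightarrow> bool" where
  "simply_laced_ears form R X Vd S \<alpha> \<sigma> \<longleftrightarrow>
     extended_affine_root_system form R \<and>
     complement_of (form_radical form) Vd \<and>
     root_system_of_type form Vd (finite_part form Vd R) X \<and>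
     semilattice_in (form_radical form) S \<and>
     (type_rank X > 1 \<longrightarrow> lattice_in (form_radical form) S) \<and>
     R = (S + S) \<union> (finite_part form Vd R + S) \<and>
     fundamental_system (finite_part form Vd R) (type_rank X) \<alpha> \<and>
     (\<forall>i \<in> {1..type_rank X}. form (\<alpha> i) (\<alpha> i) = 2) \<and>
     (\<forall>r \<in> {1..nullity form}. \<sigma> r \<in> S) \<and>
     z_basis (nullity form) \<sigma> (group_closure S)"


section \<open>Supporting class and index\<close>

definition coords :: "nat \<Rightarrow> (nat \<Rightarrow> 'v::euclidean_space) \<Rightarrow> 'v \<Rightarrow> nat \<Rightarrow> int" where
  "coords \<nu> \<sigma> x =
     (THE k. (\<forall>r. r \<notin> {1..\<nu>} \<longrightarrow> k r = 0) \<and> x = (\<Sum>r=1..\<nu>. of_int (k r) *\<^sub>R \<sigma> r))"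

definition supp :: "nat \<Rightarrow> (nat \<Rightarrow> 'v::euclidean_space) \<Rightarrow> 'v \<Rightarrow> nat set" where
  "supp \<nu> \<sigma> x = {r \<in> {1..\<nu>}. odd (coords \<nu> \<sigma> x r)}"

definition supp_class :: "nat \<Rightarrow> (nat \<Rightarrow> 'v::euclidean_space) \<Rightarrow> 'v set \<Rightarrow> nat set set" where
  "supp_class \<nu> \<sigma> S = supp \<nu> \<sigma> ` S"

definition ind :: "nat \<Rightarrow> (nat \<Rightarrow> 'v::euclidean_space) \<Rightarrow> 'v set \<Rightarrow> nat" where
  "ind \<nu> \<sigma> S = card (supp_class \<nu> \<sigma> S) - 1"


section \<open>The Heisenberg-like group\<close>

text \<open>\<^const>\<open>BijGroup\<close> consists of the extensional bijections of \<open>W\<close>, with product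
  $g \otimes f = g \circ f$.\<close>

definition GL :: "'u::real_vector set \<Rightarrow> ('u \<Rightarrow> 'u) monoid" where
  "GL W = (BijGroup W)\<lparr>carrier :=
     {f \<in> Bij W. (\<forall>x \<in> W. \<forall>y \<in> W. f (x + y) = f x + f y) \<and>
                 (\<forall>x \<in> W. \<forall>a. f (a *\<^sub>R x) = a *\<^sub>R f x)}\<rparr>"

text \<open>The dual space of $V^0$ is realised as the space of those functionals on $V$ that vanish on the
  complement \<open>Vd\<close>, that is, each functional on $V^0$ is extended by $0$ on \<open>Vd\<close>. A vector
  $\alpha$ of $V$ becomes \<open>(\<alpha>, 0)\<close>.\<close>

type_synonym 'v hyper = "'v \<times> ('v \<Rightarrow>\<^sub>L real)"

definition hyper_space :: "'v::euclidean_space set \<Rightarrow> 'v hyper set" where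
  "hyper_space Vd = {(v, \<phi>). \<forall>x \<in> Vd. blinfun_apply \<phi> x = 0}"

text \<open>For $\phi$ vanishing on \<open>Vd\<close>, $\phi(v)$ is the value of $\phi$ at the $V^0$-component of $v$. So \<open>Vd\<close> and
  $(V^0)^*$ are orthogonal, $(V^0)^*$ is totally isotropic, and $V^0$ and $(V^0)^*$ are paired
  by evaluation; in particular $(\sigma_r,\lambda_s)=\delta_{r,s}$ for the basis $\lambda$ of
  $(V^0)^*$ dual to $\sigma$.\<close>

definition hyper_form ::
    "('v::euclidean_space \<Rightarrow> 'v \<Rightarrow> real) \<Rightarrow> 'v hyper \<Rightarrow> 'v hyper \<Rightarrow> real" where
  "hyper_form form x y =
     form (fst x) (fst y) + blinfun_apply (snd x) (fst y) + blinfun_apply (snd y) (fst x)"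

definition refl_w ::
    "('v::euclidean_space \<Rightarrow> 'v \<Rightarrow> real) \<Rightarrow> 'v set \<Rightarrow> 'v \<Rightarrow> 'v hyper \<Rightarrow> 'v hyper" where
  "refl_w form Vd \<alpha> =
     (\<lambda>u \<in> hyper_space Vd. u - hyper_form form u (coroot form \<alpha>, 0) *\<^sub>R (\<alpha>, 0))"

definition heisenberg_group ::
    "('v::euclidean_space \<Rightarrow> 'v \<Rightarrow> real) \<Rightarrow> 'v set \<Rightarrow> 'v set \<Rightarrow> ('v hyper \<Rightarrow> 'v hyper) monoid" where
  "heisenberg_group form Vd R =
     subgroup_generated (GL (hyper_space Vd))
       {refl_w form Vd (\<alpha> + \<sigma>) \<otimes>\<^bsub>GL (hyper_space Vd)\<^esub> refl_w form Vd \<alpha> | \<alpha> \<sigma>.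
          \<alpha> \<in> nonisotropic form R \<and> \<sigma> \<in> form_radical form \<and> \<alpha> + \<sigma> \<in> R}"

definition T_map ::
    "('v::euclidean_space \<Rightarrow> 'v \<Rightarrow> real) \<Rightarrow> 'v set \<Rightarrow> 'v \<Rightarrow> 'v \<Rightarrow> 'v hyper \<Rightarrow> 'v hyper" where
  "T_map form Vd \<alpha> \<sigma> =
     (\<lambda>u \<in> hyper_space Vd.
        u - hyper_form form (\<sigma>, 0) u *\<^sub>R (\<alpha>, 0)
          + hyper_form form (\<alpha>, 0) u *\<^sub>R (\<sigma>, 0)
          - (form \<alpha> \<alpha> / 2 * hyper_form form (\<sigma>, 0) u) *\<^sub>R (\<sigma>, 0))"

definition c_elt ::
    "('v::euclidean_space \<Rightarrow> 'v \<Rightarrow> real) \<Rightarrow> 'v set \<Rightarrow> (nat \<Rightarrow> 'v) \<Rightarrow> nat \<Rightarrow> nat \<Rightarrow> 'v hyper \<Rightarrow> 'v hyper"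
  where
  "c_elt form Vd \<sigma> r s = T_map form Vd (\<sigma> r) (\<sigma> s)"

definition C_group ::
    "('v::euclidean_space \<Rightarrow> 'v \<Rightarrow> real) \<Rightarrow> 'v set \<Rightarrow> (nat \<Rightarrow> 'v) \<Rightarrow> ('v hyper \<Rightarrow> 'v hyper) monoid"
  where
  "C_group form Vd \<sigma> =
     subgroup_generated (GL (hyper_space Vd))
       {c_elt form Vd \<sigma> r s | r s. 1 \<le> r \<and> r < s \<and> s \<le> nullity form}"

definition z_elt ::
    "('v::euclidean_space \<Rightarrow> 'v \<Rightarrow> real) \<Rightarrow> 'v set \<Rightarrow> 'v set \<Rightarrow> (nat \<Rightarrow> 'v) \<Rightarrow> nat set \<Rightarrow>
     'v hyper \<Rightarrow> 'v hyper" where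
  "z_elt form Vd S \<sigma> J =
     (if J \<in> supp_class (nullity form) \<sigma> S
      then finprod (C_group form Vd \<sigma>) (\<lambda>(r, s). c_elt form Vd \<sigma> r s)
             {(r, s). r \<in> J \<and> s \<in> J \<and> r < s}
      else if card J = 2
      then c_elt form Vd \<sigma> (Min J) (Max J) [^]\<^bsub>C_group form Vd \<sigma>\<^esub> (2::nat)
      else \<one>\<^bsub>C_group form Vd \<sigma>\<^esub>)"

definition F_group ::
    "('v::euclidean_space \<Rightarrow> 'v \<Rightarrow> real) \<Rightarrow> 'v set \<Rightarrow> 'v set \<Rightarrow> (nat \<Rightarrow> 'v) \<Rightarrow>
     ('v hyper \<Rightarrow> 'v hyper) set" where
  "F_group form Vd S \<sigma> =
     generate (C_group form Vd \<sigma>) {z_elt form Vd S \<sigma> J | J. J \<subseteq> {1..nullity form}}"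

definition n_exp ::
    "('v::euclidean_space \<Rightarrow> 'v \<Rightarrow> real) \<Rightarrow> 'v set \<Rightarrow> 'v set \<Rightarrow> (nat \<Rightarrow> 'v) \<Rightarrow> nat \<Rightarrow> nat \<Rightarrow> nat"
  where
  "n_exp form Vd S \<sigma> r s =
     (LEAST n. 1 \<le> n \<and> c_elt form Vd \<sigma> r s [^]\<^bsub>C_group form Vd \<sigma>\<^esub> (n::nat) \<in> F_group form Vd S \<sigma>)"

definition F_generated_by_powers ::
    "('v::euclidean_space \<Rightarrow> 'v \<Rightarrow> real) \<Rightarrow> 'v set \<Rightarrow> 'v set \<Rightarrow> (nat \<Rightarrow> 'v) \<Rightarrow> bool" where
  "F_generated_by_powers form Vd S \<sigma> \<longleftrightarrow>
     F_group form Vd S \<sigma> =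
       generate (C_group form Vd \<sigma>)
         {c_elt form Vd \<sigma> r s [^]\<^bsub>C_group form Vd \<sigma>\<^esub> n_exp form Vd S \<sigma> r s | r s.
            1 \<le> r \<and> r < s \<and> s \<le> nullity form}"


section \<open>Groups given by generators and relations\<close>

text \<open>The letter \<open>(x, True)\<close> stands for the generator \<open>x\<close>, and \<open>(x, False)\<close> for its inverse. A
  relation is a pair of words.\<close>

type_synonym 'g word = "('g \<times> bool) list"

inductive_set presentation_cong ::
    "'g set \<Rightarrow> ('g word \<times> 'g word) set \<Rightarrow> ('g word \<times> 'g word) set"
  for X :: "'g set" and Rel :: "('g word \<times> 'g word) set" where
  cong_refl: "w \<in> lists (X \<times> UNIV) \<Longrightarrow> (w, w) \<in> presentation_cong X Rel"
| cong_sym: "(v, w) \<in> presentation_cong X Rel \<Longrightarrow> (w, v) \<in> presentation_cong X Rel"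
| cong_trans: "\<lbrakk>(u, v) \<in> presentation_cong X Rel; (v, w) \<in> presentation_cong X Rel\<rbrakk>
    \<Longrightarrow> (u, w) \<in> presentation_cong X Rel"
| cong_cancel: "\<lbrakk>u \<in> lists (X \<times> UNIV); v \<in> lists (X \<times> UNIV); x \<in> X\<rbrakk>
    \<Longrightarrow> (u @ [(x, b), (x, \<not> b)] @ v, u @ v) \<in> presentation_cong X Rel"
| cong_rel: "\<lbrakk>u \<in> lists (X \<times> UNIV); v \<in> lists (X \<times> UNIV); (p, q) \<in> Rel;
      p \<in> lists (X \<times> UNIV); q \<in> lists (X \<times> UNIV)\<rbrakk>
    \<Longrightarrow> (u @ p @ v, u @ q @ v) \<in> presentation_cong X Rel"

definition presented_group ::
    "'g set \<Rightarrow> ('g word \<times> 'g word) set \<Rightarrow> 'g word set monoid" where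
  "presented_group X Rel =
     \<lparr>carrier = lists (X \<times> UNIV) // presentation_cong X Rel,
      mult = \<lambda>A B. \<Union>a \<in> A. \<Union>b \<in> B. presentation_cong X Rel `` {a @ b},
      one = presentation_cong X Rel `` {[]}\<rparr>"

lemma presentation_cong_words:
  assumes "(v, w) \<in> presentation_cong X Rel"
  shows "v \<in> lists (X \<times> UNIV) \<and> w \<in> lists (X \<times> UNIV)"
  using assms by induction auto

lemma equiv_presentation_cong: "equiv (lists (X \<times> UNIV)) (presentation_cong X Rel)"
proof (rule equivI)
  show "presentation_cong X Rel \<subseteq> lists (X \<times> UNIV) \<times> lists (X \<times> UNIV)"
    using presentation_cong_words by fast
  show "refl_on (lists (X \<times> UNIV)) (presentation_cong X Rel)"
    by (rule refl_onI) (simp add: cong_refl)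
  show "sym (presentation_cong X Rel)"
    by (rule symI) (rule cong_sym)
  show "trans (presentation_cong X Rel)"
    by (rule transI) (rule cong_trans)
qed

lemma presentation_cong_context:
  assumes "(v, w) \<in> presentation_cong X Rel"
    and "a \<in> lists (X \<times> UNIV)" "b \<in> lists (X \<times> UNIV)"
  shows "(a @ v @ b, a @ w @ b) \<in> presentation_cong X Rel"
  using assms
proof induction
  case (cong_refl w)
  then show ?case by (intro presentation_cong.cong_refl) auto
next
  case (cong_sym v w)
  then show ?case by (blast intro: presentation_cong.cong_sym)
next
  case (cong_trans u v w)
  then show ?case by (blast intro: presentation_cong.cong_trans)
next
  case (cong_cancel u v x c)
  then show ?case
    using presentation_cong.cong_cancel[of "a @ u" X "v @ b" x c Rel] by simp
next
  case (cong_rel u v p q)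
  then show ?case
    using presentation_cong.cong_rel[of "a @ u" X "v @ b" p q Rel] by simp
qed

lemma presentation_cong_append:
  assumes "(v, v') \<in> presentation_cong X Rel" "(w, w') \<in> presentation_cong X Rel"
  shows "(v @ w, v' @ w') \<in> presentation_cong X Rel"
proof -
  have "(v @ w, v' @ w) \<in> presentation_cong X Rel"
    using presentation_cong_context[OF assms(1), of "[]" w] presentation_cong_words[OF assms(2)]
    by simp
  moreover have "(v' @ w, v' @ w') \<in> presentation_cong X Rel"
    using presentation_cong_context[OF assms(2), of v' "[]"] presentation_cong_words[OF assms(1)]
    by simp
  ultimately show ?thesis by (rule cong_trans)
qed

lemma presented_group_mult:
  assumes "v \<in> lists (X \<times> UNIV)" "w \<in> lists (X \<times> UNIV)"
  shows "presentation_cong X Rel `` {v} \<otimes>\<^bsub>presented_group X Rel\<^esub> presentation_cong X Rel `` {w}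
     = presentation_cong X Rel `` {v @ w}"
proof -
  have "congruent2 (presentation_cong X Rel) (presentation_cong X Rel)
      (\<lambda>a b. presentation_cong X Rel `` {a @ b})"
    by (intro congruent2I' equiv_class_eq[OF equiv_presentation_cong] presentation_cong_append)
  from UN_equiv_class2[OF equiv_presentation_cong equiv_presentation_cong this assms]
  show ?thesis by (simp add: presented_group_def)
qed

lemma presentation_cong_inverse:
  assumes "w \<in> lists (X \<times> UNIV)"
  shows "(map (\<lambda>(x, b). (x, \<not> b)) (rev w) @ w, []) \<in> presentation_cong X Rel"
  using assms
proof (induction rule: lists.induct)
  case Nil
  then show ?case by (simp add: cong_refl)
next
  case (Cons p w)
  obtain x b where p: "p = (x, b)" by force
  let ?w' = "map (\<lambda>(x, b). (x, \<not> b)) (rev w)"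
  have w: "x \<in> X" "w \<in> lists (X \<times> UNIV)" using Cons.hyps p by auto
  then have w': "?w' \<in> lists (X \<times> UNIV)" by (fastforce simp: in_lists_conv_set)
  have "(?w' @ [(x, \<not> b), (x, \<not> \<not> b)] @ w, ?w' @ w) \<in> presentation_cong X Rel"
    using w w' by (intro cong_cancel)
  then have "(map (\<lambda>(x, b). (x, \<not> b)) (rev (p # w)) @ p # w, ?w' @ w) \<in> presentation_cong X Rel"
    using p by simp
  moreover have "(?w' @ w, []) \<in> presentation_cong X Rel"
    by (rule Cons.IH)
  ultimately show ?case by (rule cong_trans)
qed

lemma group_presented_group: "group (presented_group X Rel)"
proof (rule groupI)
  let ?G = "presented_group X Rel"
  let ?c = "\<lambda>w. presentation_cong X Rel `` {w}"
  have car: "carrier ?G = ?c ` lists (X \<times> UNIV)"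
    by (auto simp: presented_group_def quotient_def)
  have one: "\<one>\<^bsub>?G\<^esub> = ?c []" by (simp add: presented_group_def)
  show "x \<otimes>\<^bsub>?G\<^esub> y \<in> carrier ?G" if xy: "x \<in> carrier ?G" "y \<in> carrier ?G" for x y
  proof -
    obtain v w where v: "v \<in> lists (X \<times> UNIV)" "x = ?c v"
      and w: "w \<in> lists (X \<times> UNIV)" "y = ?c w"
      using xy unfolding car by blast
    show ?thesis
      unfolding car v(2) w(2) presented_group_mult[OF v(1) w(1)]
      using v(1) w(1) by (intro imageI) simp
  qed
  show "\<one>\<^bsub>?G\<^esub> \<in> carrier ?G" unfolding car one by (intro imageI) simp
  show "x \<otimes>\<^bsub>?G\<^esub> y \<otimes>\<^bsub>?G\<^esub> z = x \<otimes>\<^bsub>?G\<^esub> (y \<otimes>\<^bsub>?G\<^esub> z)"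
    if "x \<in> carrier ?G" "y \<in> carrier ?G" "z \<in> carrier ?G" for x y z
    using that unfolding car by (elim imageE) (simp add: presented_group_mult del: in_lists_conv_set)
  show "\<one>\<^bsub>?G\<^esub> \<otimes>\<^bsub>?G\<^esub> x = x" if "x \<in> carrier ?G" for x
    using that unfolding car one by (elim imageE) (simp add: presented_group_mult del: in_lists_conv_set)
  show "\<exists>y \<in> carrier ?G. y \<otimes>\<^bsub>?G\<^esub> x = \<one>\<^bsub>?G\<^esub>" if x: "x \<in> carrier ?G" for x
  proof -
    obtain w where w: "w \<in> lists (X \<times> UNIV)" "x = ?c w" using x unfolding car by blast
    let ?w' = "map (\<lambda>(x, b). (x, \<not> b)) (rev w)"
    have w': "?w' \<in> lists (X \<times> UNIV)" using w(1) by (fastforce simp: in_lists_conv_set)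
    have "?c (?w' @ w) = ?c []"
      by (rule equiv_class_eq[OF equiv_presentation_cong presentation_cong_inverse[OF w(1)]])
    then have "?c ?w' \<otimes>\<^bsub>?G\<^esub> x = \<one>\<^bsub>?G\<^esub>"
      unfolding w(2) one presented_group_mult[OF w' w(1)] .
    then show ?thesis using w' unfolding car by blast
  qed
qed

text \<open>$[x,y]=x^{-1}y^{-1}xy$\<close>

definition comm_word :: "'g \<Rightarrow> 'g \<Rightarrow> 'g word" where
  "comm_word x y = [(x, False), (y, False), (x, True), (y, True)]"

definition power_word :: "'g \<Rightarrow> int \<Rightarrow> 'g word" where
  "power_word x k = replicate (nat \<bar>k\<bar>) (x, 0 \<le> k)"

datatype heis_gen = Y nat nat | Z nat nat

definition heis_gens :: "nat \<Rightarrow> nat \<Rightarrow> heis_gen set" where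
  "heis_gens l \<nu> =
     {Y i r | i r. i \<in> {1..l} \<and> r \<in> {1..\<nu>}} \<union> {Z r s | r s. 1 \<le> r \<and> r < s \<and> s \<le> \<nu>}"

text \<open>In the last family \<open>k\<close> is the exponent $a_{i,j}n(r,s)^{-1}$, an integer because $n(r,s)$ divides
  $a_{i,j}$.\<close>

definition heis_rels ::
    "nat \<Rightarrow> nat \<Rightarrow> (nat \<Rightarrow> nat \<Rightarrow> real) \<Rightarrow> (nat \<Rightarrow> nat \<Rightarrow> nat) \<Rightarrow> (heis_gen word \<times> heis_gen word) set"
  where
  "heis_rels l \<nu> a n =
     {(comm_word (Z r s) (Z r' s'), []) | r s r' s'.
        1 \<le> r \<and> r < s \<and> s \<le> \<nu> \<and> 1 \<le> r' \<and> r' < s' \<and> s' \<le> \<nu>} \<union>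
     {(comm_word (Y i r) (Z r' s'), []) | i r r' s'.
        i \<in> {1..l} \<and> r \<in> {1..\<nu>} \<and> 1 \<le> r' \<and> r' < s' \<and> s' \<le> \<nu>} \<union>
     {(comm_word (Y i r) (Y j r), []) | i j r.
        i \<in> {1..l} \<and> j \<in> {1..l} \<and> r \<in> {1..\<nu>}} \<union>
     {(comm_word (Y i r) (Y j s), power_word (Z r s) k) | i j r s k.
        i \<in> {1..l} \<and> j \<in> {1..l} \<and> 1 \<le> r \<and> r < s \<and> s \<le> \<nu> \<and>
        real_of_int k = a i j / real (n r s)}"

definition heis_hat ::
    "nat \<Rightarrow> nat \<Rightarrow> (nat \<Rightarrow> nat \<Rightarrow> real) \<Rightarrow> (nat \<Rightarrow> nat \<Rightarrow> nat) \<Rightarrow> heis_gen word set monoid" where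
  "heis_hat l \<nu> a n = presented_group (heis_gens l \<nu>) (heis_rels l \<nu> a n)"


section \<open>Semilattices of rank at most three\<close>

definition similar_semilattices :: "'v::euclidean_space set \<Rightarrow> 'v set \<Rightarrow> 'v set \<Rightarrow> bool" where
  "similar_semilattices V0 S S' \<longleftrightarrow>
     (\<exists>\<psi> \<in> carrier (GL V0). \<exists>\<sigma>' \<in> S'. \<psi> ` S = (\<lambda>x. x + \<sigma>') ` S')"

text \<open>\<open>standard_supp \<nu> m J\<close>: \<open>J\<close> is the supporting class chosen to represent the similarity
  class of semilattices of rank \<open>\<nu>\<close> and index \<open>m\<close>.\<close>

inductive standard_supp :: "nat \<Rightarrow> nat \<Rightarrow> nat set set \<Rightarrow> bool" where
  "standard_supp 0 0 {{}}"
| "standard_supp 1 1 {{}, {1}}"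
| "standard_supp 2 2 {{}, {1}, {2}}"
| "standard_supp 2 3 {{}, {1}, {2}, {1, 2}}"
| "standard_supp 3 3 {{}, {1}, {2}, {3}}"
| "standard_supp 3 4 {{}, {1}, {2}, {3}, {2, 3}}"
| "standard_supp 3 5 {{}, {1}, {2}, {3}, {1, 3}, {2, 3}}"
| "standard_supp 3 6 {{}, {1}, {2}, {3}, {1, 2}, {1, 3}, {2, 3}}"
| "standard_supp 3 7 (Pow {1, 2, 3})"

end

theory Submission
  imports Defs
begin

text \<open>The idea is to describe the Heisenberg-like group by integer coordinates in which everything can be
  read off.

  Every root of the finite part has norm \<open>2\<close>, so the product of the reflections in \<open>\<beta> + q\<close> and \<open>\<beta>\<close> is the
  transvection \<open>T_map \<beta> q\<close>, and each generator of the group is a quotient of two transvections with the same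
  root (\<open>refl_product_coords\<close>, \<open>reflection_product_quotient\<close>). All these maps belong to a unipotent group
  whose elements are given by a matrix \<open>x\<close>, the coefficients of vectors of the root lattice attached to
  \<open>\<sigma>\<^sub>1, \<dots>, \<sigma>\<^sub>\<nu>\<close>, and central entries \<open>m (r, s)\<close>, \<open>r < s\<close>. In these coordinates multiplication is addition
  twisted by a bilinear cocycle built from the Cartan matrix, and \<open>heis_map\<close> is a faithful action of the
  coordinate group (\<open>heis_map_hom\<close>, \<open>heis_map_kernel\<close>). The element \<open>c_elt r s\<close> has the single entry \<open>- 1\<close>, and
  the transvection of the root \<open>\<Sum> k\<^sub>i \<alpha>\<^sub>i\<close> by \<open>\<Sum> q\<^sub>r \<sigma>\<^sub>r\<close> has \<open>x = (k\<^sub>i q\<^sub>r)\<close> and \<open>m = (q\<^sub>r q\<^sub>s)\<close>.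

  The group \<open>F(S)\<close> always lies in the Heisenberg-like group: for \<open>J\<close> in the supporting class \<open>z_elt J\<close> is, up to inversion, the quotient
  of a transvection by a product of simpler ones taken in increasing order, and the squares of the \<open>c_elt r s\<close>
  are commutators (\<open>F_subset_heisenberg\<close>). Suppose that \<open>F(S)\<close> is generated by the powers
  \<open>c_elt r s ^ n r s\<close>. Then the central entries of the transvections are divisible by \<open>n\<close>: always
  \<open>n r s\<close> divides \<open>2\<close>, and if \<open>q\<^sub>r q\<^sub>s\<close> is odd, then \<open>r\<close> and \<open>s\<close> belong to a common member of the supporting
  class, and \<open>n r s = 1\<close>. So the group consists
  of all \<open>(x, m)\<close> with \<open>m\<close> divisible by \<open>n\<close>. The presented group maps onto the same set of coordinates, and
  injectively, since its relations allow every element to be collected into a normal form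
  (\<open>heis_hat_coordinates\<close>). This yields the isomorphism (\<open>heisenberg_presentation\<close>).

  If the supporting class contains with a set all two-element subsets of it, then \<open>F(S)\<close> is generated by
  \<open>c_elt r s\<close> for the pairs in the class and by \<open>c_elt r s ^ 2\<close> for the others (\<open>pair_closed_F\<close>). Lattices and
  the representatives of the semilattices of rank at most three have this property, which settles the values
  of \<open>n\<close>. In rank one a translation of the semilattice is absorbed by another choice of the complement of
  the radical (\<open>shifted_ears\<close>), so that affine changes of coordinates modulo \<open>2\<close> bring every supporting class
  of rank at most three to its representative (\<open>standardizable\<close>).\<close>

section \<open>Presented groups\<close>

definition word_eval :: "('a, 'b) monoid_scheme \<Rightarrow> ('g \<Rightarrow> 'a) \<Rightarrow> 'g word \<Rightarrow> 'a" where
  "word_eval K f w = foldr (\<lambda>(x, b) g. (if b then f x else inv\<^bsub>K\<^esub> f x) \<otimes>\<^bsub>K\<^esub> g) w \<one>\<^bsub>K\<^esub>"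

lemma word_eval_Nil [simp]: "word_eval K f [] = \<one>\<^bsub>K\<^esub>"
  by (simp add: word_eval_def)

lemma word_eval_Cons [simp]:
  "word_eval K f ((x, b) # w) = (if b then f x else inv\<^bsub>K\<^esub> f x) \<otimes>\<^bsub>K\<^esub> word_eval K f w"
  by (simp add: word_eval_def)

definition generator_class :: "'g set \<Rightarrow> ('g word \<times> 'g word) set \<Rightarrow> 'g \<Rightarrow> 'g word set" where
  "generator_class X Rel x = presentation_cong X Rel `` {[(x, True)]}"

context group
begin

lemma word_eval_closed:
  assumes "f \<in> X \<rightarrow> carrier G" "w \<in> lists (X \<times> UNIV)"
  shows "word_eval G f w \<in> carrier G"
  using assms(2)
  by (induction w rule: lists.induct) (use assms(1) in \<open>auto simp: Pi_def\<close>)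

lemma word_eval_append:
  assumes f: "f \<in> X \<rightarrow> carrier G" and v: "v \<in> lists (X \<times> UNIV)" and w: "w \<in> lists (X \<times> UNIV)"
  shows "word_eval G f (v @ w) = word_eval G f v \<otimes> word_eval G f w"
  using v
proof (induction v rule: lists.induct)
  case Nil
  then show ?case using word_eval_closed[OF f w] by simp
next
  case (Cons p v)
  obtain x b where p: "p = (x, b)" by force
  have "word_eval G f v \<in> carrier G" by (rule word_eval_closed[OF f Cons.hyps(2)])
  moreover have "f x \<in> carrier G" using p Cons.hyps f by auto
  ultimately show ?case
    using Cons.IH word_eval_closed[OF f w] p by (simp add: m_assoc)
qed

lemma word_eval_cong:
  assumes f: "f \<in> X \<rightarrow> carrier G"
    and rel: "\<And>p q. \<lbrakk>(p, q) \<in> Rel; p \<in> lists (X \<times> UNIV); q \<in> lists (X \<times> UNIV)\<rbrakk>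
      \<Longrightarrow> word_eval G f p = word_eval G f q"
    and "(v, w) \<in> presentation_cong X Rel"
  shows "word_eval G f v = word_eval G f w"
  using assms(3)
proof induction
  case (cong_cancel u v x b)
  have x: "[(x, b), (x, \<not> b)] \<in> lists (X \<times> UNIV)" "f x \<in> carrier G" using cong_cancel f by auto
  have "word_eval G f [(x, b), (x, \<not> b)] = \<one>" using x(2) by (cases b) simp_all
  then show ?case
    using cong_cancel x word_eval_closed[OF f]
    by (simp only: word_eval_append[OF f] append_in_lists_conv l_one)
next
  case (cong_rel u v p q)
  then show ?case
    by (simp only: word_eval_append[OF f] append_in_lists_conv rel)
qed auto

text \<open>Von Dyck's theorem. The homomorphism sends the class of a word to the value of the word; this is
  well defined because each elementary step of \<^const>\<open>presentation_cong\<close> preserves values.\<close>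

lemma presented_group_universal:
  assumes f: "f \<in> X \<rightarrow> carrier G"
    and rel: "\<And>p q. \<lbrakk>(p, q) \<in> Rel; p \<in> lists (X \<times> UNIV); q \<in> lists (X \<times> UNIV)\<rbrakk>
      \<Longrightarrow> word_eval G f p = word_eval G f q"
  obtains \<phi> where "\<phi> \<in> hom (presented_group X Rel) G"
    and "\<And>x. x \<in> X \<Longrightarrow> \<phi> (generator_class X Rel x) = f x"
proof -
  define \<phi> where "\<phi> A = word_eval G f (SOME w. w \<in> A)" for A
  let ?c = "\<lambda>w. presentation_cong X Rel `` {w}"
  have \<phi>: "\<phi> (?c w) = word_eval G f w" if w: "w \<in> lists (X \<times> UNIV)" for w
  proof -
    have "w \<in> ?c w" using w by (simp add: cong_refl del: in_lists_conv_set)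
    then have "(SOME v. v \<in> ?c w) \<in> ?c w" by (rule someI)
    then have "(w, SOME v. v \<in> ?c w) \<in> presentation_cong X Rel" by simp
    then show ?thesis unfolding \<phi>_def using word_eval_cong[OF f rel] by metis
  qed
  have car: "carrier (presented_group X Rel) = ?c ` lists (X \<times> UNIV)"
    by (auto simp: presented_group_def quotient_def)
  have "\<phi> \<in> hom (presented_group X Rel) G"
  proof (rule homI)
    show "\<phi> x \<in> carrier G" if "x \<in> carrier (presented_group X Rel)" for x
      using that unfolding car by (elim imageE) (simp add: \<phi> word_eval_closed[OF f] del: in_lists_conv_set)
    show "\<phi> (x \<otimes>\<^bsub>presented_group X Rel\<^esub> y) = \<phi> x \<otimes> \<phi> y"
      if xy: "x \<in> carrier (presented_group X Rel)" "y \<in> carrier (presented_group X Rel)" for x y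
    proof -
      obtain v w where v: "v \<in> lists (X \<times> UNIV)" "x = ?c v" and w: "w \<in> lists (X \<times> UNIV)" "y = ?c w"
        using xy unfolding car by blast
      have "v @ w \<in> lists (X \<times> UNIV)" using v w by simp
      then show ?thesis
        unfolding v(2) w(2) presented_group_mult[OF v(1) w(1)]
        by (simp only: \<phi> v(1) w(1) word_eval_append[OF f])
    qed
  qed
  moreover have "\<phi> (generator_class X Rel x) = f x" if "x \<in> X" for x
  proof -
    have "[(x, True)] \<in> lists (X \<times> UNIV)" using that by simp
    from \<phi>[OF this] show ?thesis
      using f that unfolding generator_class_def by (simp add: Pi_def)
  qed
  ultimately show ?thesis by (rule that)
qed

end

lemma generator_class_closed:
  "generator_class X Rel \<in> X \<rightarrow> carrier (presented_group X Rel)"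
  by (auto simp: generator_class_def presented_group_def intro!: quotientI)

lemma inv_generator_class:
  assumes "x \<in> X"
  shows "inv\<^bsub>presented_group X Rel\<^esub> generator_class X Rel x = presentation_cong X Rel `` {[(x, False)]}"
proof -
  interpret P: group "presented_group X Rel" by (rule group_presented_group)
  let ?c = "\<lambda>w. presentation_cong X Rel `` {w}"
  have w: "[(x, True)] \<in> lists (X \<times> UNIV)" "[(x, False)] \<in> lists (X \<times> UNIV)" using assms by auto
  have "([] @ [(x, False), (x, \<not> False)] @ [], [] @ []) \<in> presentation_cong X Rel"
    by (rule cong_cancel) (use assms in auto)
  then have "?c [(x, False), (x, True)] = ?c []"
    by (intro equiv_class_eq[OF equiv_presentation_cong]) simp
  then have "?c [(x, False)] \<otimes>\<^bsub>presented_group X Rel\<^esub> generator_class X Rel x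
      = \<one>\<^bsub>presented_group X Rel\<^esub>"
    using presented_group_mult[OF w(2) w(1)]
    by (simp add: generator_class_def) (simp add: presented_group_def)
  moreover have "?c [(x, False)] \<in> carrier (presented_group X Rel)"
    using w(2) by (auto simp: presented_group_def intro!: quotientI)
  ultimately show ?thesis
    using generator_class_closed[of X Rel] assms by (intro P.inv_equality) auto
qed

lemma word_eval_generator_class:
  assumes "w \<in> lists (X \<times> UNIV)"
  shows "word_eval (presented_group X Rel) (generator_class X Rel) w = presentation_cong X Rel `` {w}"
  using assms
proof (induction w rule: lists.induct)
  case Nil
  then show ?case by (simp add: presented_group_def)
next
  case (Cons p w)
  obtain x b where p: "p = (x, b)" by force
  have x: "x \<in> X" "[(x, b)] \<in> lists (X \<times> UNIV)" using Cons.hyps p by auto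
  have "word_eval (presented_group X Rel) (generator_class X Rel) (p # w)
     = presentation_cong X Rel `` {[(x, b)]} \<otimes>\<^bsub>presented_group X Rel\<^esub> presentation_cong X Rel `` {w}"
    unfolding p word_eval_Cons Cons.IH inv_generator_class[OF x(1)]
    by (simp add: generator_class_def)
  also have "\<dots> = presentation_cong X Rel `` {p # w}"
    using presented_group_mult[OF x(2) Cons.hyps(2)] p by simp
  finally show ?case .
qed

lemma presented_group_generated:
  "carrier (presented_group X Rel)
     = generate (presented_group X Rel) (generator_class X Rel ` X)"
proof
  let ?P = "presented_group X Rel"
  interpret P: group ?P by (rule group_presented_group)
  have "word_eval ?P (generator_class X Rel) w \<in> generate ?P (generator_class X Rel ` X)"
    if "w \<in> lists (X \<times> UNIV)" for w
    using that
  proof (induction w rule: lists.induct)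
    case Nil
    then show ?case by (simp add: generate.one)
  next
    case (Cons p w)
    obtain x b where p: "p = (x, b)" by force
    have "generator_class X Rel x \<in> generator_class X Rel ` X" using Cons.hyps p by auto
    then have "(if b then generator_class X Rel x else inv\<^bsub>?P\<^esub> generator_class X Rel x)
        \<in> generate ?P (generator_class X Rel ` X)"
      by (auto intro: generate.incl generate.inv)
    then show ?case unfolding p word_eval_Cons using Cons.IH by (rule generate.eng)
  qed
  then show "carrier ?P \<subseteq> generate ?P (generator_class X Rel ` X)"
    using word_eval_generator_class[of _ X Rel]
    by (auto simp: presented_group_def quotient_def simp del: in_lists_conv_set)
  show "generate ?P (generator_class X Rel ` X) \<subseteq> carrier ?P"
    using generator_class_closed[of X Rel] by (intro P.generate_incl) auto
qed

lemma presented_group_relation: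
  assumes "(p, q) \<in> Rel" "p \<in> lists (X \<times> UNIV)" "q \<in> lists (X \<times> UNIV)"
  shows "word_eval (presented_group X Rel) (generator_class X Rel) p
     = word_eval (presented_group X Rel) (generator_class X Rel) q"
proof -
  have "([] @ p @ [], [] @ q @ []) \<in> presentation_cong X Rel"
    by (rule cong_rel) (use assms in auto)
  then have "(p, q) \<in> presentation_cong X Rel" by simp
  then show ?thesis
    using equiv_class_eq[OF equiv_presentation_cong] word_eval_generator_class assms(2,3) by metis
qed

context group
begin

lemma word_eval_comm_word:
  assumes "f x \<in> carrier G" "f y \<in> carrier G"
  shows "word_eval G f (comm_word x y) = inv (f x) \<otimes> inv (f y) \<otimes> f x \<otimes> f y"
  using assms by (simp add: comm_word_def m_assoc)

lemma word_eval_power_word: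
  assumes x: "f x \<in> carrier G"
  shows "word_eval G f (power_word x k) = f x [^] k"
proof -
  have *: "word_eval G f (replicate N (x, b)) = (if b then f x else inv f x) [^] N" for N :: nat and b
  proof (induction N)
    case (Suc N)
    have "word_eval G f (replicate (Suc N) (x, b)) = (if b then f x else inv f x) \<otimes> (if b then f x else inv f x) [^] N"
      using Suc by simp
    also have "\<dots> = (if b then f x else inv f x) [^] Suc N"
      by (rule nat_pow_Suc2[symmetric]) (use x in auto)
    finally show ?case .
  qed simp
  show ?thesis
  proof (cases "0 \<le> k")
    case True
    then have "power_word x k = replicate (nat k) (x, True)" by (simp add: power_word_def)
    then show ?thesis using *[of "nat k" True] True unfolding int_pow_def2 by simp
  next
    case False
    then have "power_word x k = replicate (nat (- k)) (x, False)" by (simp add: power_word_def)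
    then show ?thesis using *[of "nat (- k)" False] False x nat_pow_inv[OF x]
      unfolding int_pow_def2 by simp
  qed
qed

lemma mult_inv_cancel:
  assumes "c \<in> carrier G" "x \<in> carrier G"
  shows "c \<otimes> (inv c \<otimes> x) = x" "inv c \<otimes> (c \<otimes> x) = x"
  using assms by (simp_all add: m_assoc[symmetric])

lemma commutator_eq_oneD:
  assumes "x \<in> carrier G" "y \<in> carrier G" "inv x \<otimes> inv y \<otimes> x \<otimes> y = \<one>"
  shows "x \<otimes> y = y \<otimes> x"
proof -
  have "x \<otimes> y = (y \<otimes> x) \<otimes> (inv x \<otimes> inv y \<otimes> x \<otimes> y)"
    using assms(1,2) by (simp add: m_assoc mult_inv_cancel)
  then show ?thesis using assms by simp
qed

section \<open>Central extensions of abelian groups\<close>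

lemma commutes_with_generate:
  assumes "S \<subseteq> carrier G" "g \<in> carrier G" "\<And>h. h \<in> S \<Longrightarrow> g \<otimes> h = h \<otimes> g"
    and "h \<in> generate G S"
  shows "g \<otimes> h = h \<otimes> g"
  using assms(4)
proof (induction rule: generate.induct)
  case (inv h)
  then have h: "h \<in> carrier G" "g \<otimes> h = h \<otimes> g" using assms by blast+
  have "inv h \<otimes> (g \<otimes> h) \<otimes> inv h = inv h \<otimes> (h \<otimes> g) \<otimes> inv h" using h by simp
  then show ?case using h(1) assms(2) by (simp add: m_assoc mult_inv_cancel)
next
  case (eng h1 h2)
  then have h: "h1 \<in> carrier G" "h2 \<in> carrier G" using generate_in_carrier[OF assms(1)] by auto
  have "g \<otimes> (h1 \<otimes> h2) = (h1 \<otimes> g) \<otimes> h2"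
    unfolding eng.IH(1)[symmetric] using h assms(2) by (simp add: m_assoc)
  also have "\<dots> = (h1 \<otimes> h2) \<otimes> g"
    using eng.IH(2) h assms(2) by (simp add: m_assoc)
  finally show ?case .
qed (use assms in auto)

text \<open>Injectivity criterion for maps out of a presented group. Modulo \<open>N\<close> the elements \<open>y a\<close> commute, so that they can be collected one after the
  other: every element of the group generated by them and \<open>N\<close> is \<open>y a [^] k \<otimes> g\<close> with \<open>g\<close> not
  involving \<open>y a\<close>. The function \<open>f a\<close> detects the exponent \<open>k\<close>, so that elements on which all
  these functions vanish lose one generator after the other.\<close>

lemma collecting:
  assumes "finite A"
    and N: "N \<lhd> G"
    and y: "y \<in> A \<rightarrow> carrier G"
    and comm: "\<And>a b. \<lbrakk>a \<in> A; b \<in> A\<rbrakk> \<Longrightarrow> inv (y a) \<otimes> inv (y b) \<otimes> y a \<otimes> y b \<in> N"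
    and f_mult: "\<And>a g h. \<lbrakk>a \<in> A; g \<in> generate G (y ` A \<union> N); h \<in> generate G (y ` A \<union> N)\<rbrakk>
      \<Longrightarrow> f a (g \<otimes> h) = f a g + (f a h :: int)"
    and f_y: "\<And>a b. \<lbrakk>a \<in> A; b \<in> A\<rbrakk> \<Longrightarrow> f a (y b) = 0 \<longleftrightarrow> a \<noteq> b"
    and f_Z: "\<And>a z. \<lbrakk>a \<in> A; z \<in> N\<rbrakk> \<Longrightarrow> f a z = 0"
    and g: "g \<in> generate G (y ` A \<union> N)" "\<And>a. a \<in> A \<Longrightarrow> f a g = 0"
  shows "g \<in> N"
proof -
  interpret N: normal N G by (rule N)
  have subA: "y ` B \<union> N \<subseteq> carrier G" if "B \<subseteq> A" for B using that y N.subset by auto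
  define U where "U B = generate G (y ` B \<union> N)" for B
  have sgU: "subgroup (U B) G" if "B \<subseteq> A" for B
    unfolding U_def by (rule generate_is_subgroup[OF subA[OF that]])
  have UA: "U B \<subseteq> U A" if "B \<subseteq> A" for B
    unfolding U_def using that by (intro mono_generate) auto
  have ZU: "N \<subseteq> U B" for B unfolding U_def by (auto intro: generate.incl)
  have f1: "f a \<one> = 0" if "a \<in> A" for a using f_Z[OF that] by simp
  have finv: "f a (inv g) = - f a g" if "a \<in> A" "g \<in> U A" for a g
  proof -
    have gi: "inv g \<in> U A" by (rule subgroup.m_inv_closed[OF sgU that(2)]) simp
    have "g \<in> carrier G" using subgroup.subset[OF sgU[of A]] that(2) by auto
    then have "f a (inv g \<otimes> g) = 0" using f1[OF that(1)] by simp
    then show ?thesis using f_mult[OF that(1), of "inv g" g] gi that(2) unfolding U_def by simp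
  qed
  have main: "g \<in> N" if "B \<subseteq> A" "g \<in> U B" "\<And>a. a \<in> B \<Longrightarrow> f a g = 0" for B g
    using finite_subset[OF that(1) assms(1)] that
  proof (induction B arbitrary: g rule: finite_induct)
    case empty
    have "generate G N = N" by (rule generateI[OF N.subgroup_axioms, symmetric]) auto
    then show ?case using empty by (simp add: U_def)
  next
    case (insert a B)
    then have a: "a \<in> A" "y a \<in> carrier G" "B \<subseteq> A" and B: "B \<subseteq> A" using y by auto
    interpret U: subgroup "U B" G by (rule sgU[OF B])
    \<comment> \<open>conjugation by \<open>y a\<close> changes the other generators by elements of \<open>N\<close> only\<close>
    have conj_generator: "inv c \<otimes> h \<otimes> c \<in> U B"
      if h: "h \<in> y ` B \<union> N" and c: "c = y a \<or> c = inv (y a)" for h c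
    proof (cases "h \<in> N")
      case True
      then have "inv c \<otimes> h \<otimes> c \<in> N" using N.inv_op_closed1 a c by auto
      then show ?thesis using ZU by auto
    next
      case False
      then obtain b where b: "b \<in> B" "h = y b" using h by auto
      have bc: "b \<in> A" "y b \<in> carrier G" using b B y by auto
      have hU: "y b \<in> U B" unfolding U_def using b by (auto intro: generate.incl)
      have cc: "c \<in> carrier G" using c a by auto
      have "inv (y b) \<otimes> (inv c \<otimes> y b \<otimes> c) \<in> N"
      proof (cases "c = y a")
        case True
        have "inv (y b) \<otimes> inv (y a) \<otimes> y b \<otimes> y a \<in> N" by (rule comm[OF bc(1) a(1)])
        then show ?thesis using True bc a by (simp add: m_assoc)
      next
        case False
        then have ca: "c = inv (y a)" using c by blast
        have "inv c \<otimes> (inv (y a) \<otimes> inv (y b) \<otimes> y a \<otimes> y b) \<otimes> c \<in> N"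
          by (rule N.inv_op_closed1[OF cc comm[OF a(1) bc(1)]])
        moreover have "inv c \<otimes> (inv (y a) \<otimes> inv (y b) \<otimes> y a \<otimes> y b) \<otimes> c
            = inv (y b) \<otimes> (inv c \<otimes> y b \<otimes> c)"
          using ca a(2) bc(2) by (simp add: m_assoc[symmetric])
        ultimately show ?thesis by simp
      qed
      then have "y b \<otimes> (inv (y b) \<otimes> (inv c \<otimes> y b \<otimes> c)) \<in> U B"
        using hU ZU by blast
      then show ?thesis using b bc cc by (simp add: m_assoc[symmetric])
    qed
    have conj: "inv c \<otimes> h \<otimes> c \<in> U B" if h: "h \<in> U B" and c: "c = y a \<or> c = inv (y a)" for h c
      using h unfolding U_def[of B]
    proof (induction h rule: generate.induct)
      case one
      then show ?case using a c generate.one[of G] by auto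
    next
      case (incl h)
      then show ?case using conj_generator[OF _ c] unfolding U_def by auto
    next
      case (inv h)
      have hc: "h \<in> carrier G" "c \<in> carrier G" using inv subA[OF B] c a by auto
      have "inv c \<otimes> inv h \<otimes> c = inv (inv c \<otimes> h \<otimes> c)"
        using hc by (simp add: inv_mult_group m_assoc)
      then show ?case using U.m_inv_closed[OF conj_generator[OF inv c]] unfolding U_def by simp
    next
      case (eng h1 h2)
      have cc: "c \<in> carrier G" using c a by auto
      have hc: "h1 \<in> carrier G" "h2 \<in> carrier G" using eng U.subset unfolding U_def by auto
      have "inv c \<otimes> (h1 \<otimes> h2) \<otimes> c = (inv c \<otimes> h1 \<otimes> c) \<otimes> (inv c \<otimes> h2 \<otimes> c)"
        using cc hc by (simp add: m_assoc mult_inv_cancel)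
      then show ?case using eng generate.eng by metis
    qed
    have conj_pow: "inv (y a [^] k) \<otimes> h \<otimes> y a [^] k \<in> U B" if h: "h \<in> U B" for k :: int and h
    proof -
      have *: "inv (c [^] j) \<otimes> h \<otimes> c [^] j \<in> U B" if c: "c = y a \<or> c = inv (y a)" for j :: nat and c
      proof (induction j)
        case 0
        then show ?case using h U.mem_carrier by simp
      next
        case (Suc j)
        have hc: "h \<in> carrier G" "c \<in> carrier G" using h U.mem_carrier c a by auto
        have "inv (c [^] Suc j) \<otimes> h \<otimes> c [^] Suc j
            = inv c \<otimes> (inv (c [^] j) \<otimes> h \<otimes> c [^] j) \<otimes> c"
          using hc by (simp add: inv_mult_group m_assoc)
        then show ?case using conj[OF Suc c] by simp
      qed
      show ?thesis
      proof (cases k rule: int_cases2)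
        case (nonneg j)
        then show ?thesis using *[of "y a" j] by (simp only: int_pow_int simp_thms)
      next
        case (nonpos j)
        then have "y a [^] k = inv (y a) [^] j"
          by (simp only: int_pow_neg[OF a(2)] int_pow_int nat_pow_inv[OF a(2)])
        then show ?thesis using *[of "inv (y a)" j] by simp
      qed
    qed
    have ya: "y a \<in> U A" unfolding U_def using a(1) by (auto intro: generate.incl)
    have ypow: "y a [^] k \<in> U A" for k :: int
      using subgroup_int_pow_closed[OF sgU[of A]] ya by auto
    have collected: "\<exists>k::int. \<exists>h \<in> U B. g = y a [^] k \<otimes> h" if "g \<in> U (insert a B)" for g
      using that unfolding U_def[of "insert a B"]
    proof (induction g rule: generate.induct)
      case one
      show ?case using U.one_closed by (intro exI[of _ 0] bexI[of _ \<one>]) auto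
    next
      case (incl h)
      then consider "h = y a" | "h \<in> y ` B \<union> N" by auto
      then show ?case
      proof cases
        case 1
        then show ?thesis using U.one_closed a by (intro exI[of _ 1] bexI[of _ \<one>]) auto
      next
        case 2
        then have "h \<in> U B" unfolding U_def by (rule generate.incl)
        then show ?thesis using U.mem_carrier by (intro exI[of _ 0] bexI[of _ h]) auto
      qed
    next
      case (inv h)
      then consider "h = y a" | "h \<in> y ` B \<union> N" by auto
      then show ?case
      proof cases
        case 1
        then show ?thesis using U.one_closed a by (intro exI[of _ "-1"] bexI[of _ \<one>]) (auto simp: int_pow_neg)
      next
        case 2
        then have "inv h \<in> U B" unfolding U_def by (rule generate.inv)
        then show ?thesis using U.mem_carrier by (intro exI[of _ 0] bexI[of _ "inv h"]) auto
      qed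
    next
      case (eng g1 g2)
      then obtain k1 h1 k2 h2 where g: "h1 \<in> U B" "g1 = y a [^] (k1::int) \<otimes> h1"
          "h2 \<in> U B" "g2 = y a [^] (k2::int) \<otimes> h2" by blast
      have "h1 \<in> carrier G" "h2 \<in> carrier G" using g U.mem_carrier by auto
      then have "g1 \<otimes> g2 = y a [^] (k1 + k2) \<otimes> ((inv (y a [^] k2) \<otimes> h1 \<otimes> y a [^] k2) \<otimes> h2)"
        using g(2,4) a(2) by (simp add: int_pow_mult m_assoc mult_inv_cancel)
      then show ?case using conj_pow[OF g(1)] g(3) U.m_closed by blast
    qed
    obtain k :: int and h where h: "h \<in> U B" "g = y a [^] k \<otimes> h" using collected insert.prems(2) by blast
    have hA: "h \<in> U A" using h UA[OF B] by auto
    have fpow_nat: "f a (y a [^] j) = int j * f a (y a)" for j :: nat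
    proof (induction j)
      case (Suc j)
      have "y a [^] j \<in> U A" using ypow[of "int j"] by (simp add: int_pow_int)
      then show ?case using Suc f_mult[OF a(1), of "y a [^] j" "y a"] ya
        unfolding U_def by (simp add: algebra_simps)
    qed (simp add: f1 a)
    have fpow: "f a (y a [^] k) = k * f a (y a)"
    proof (cases k rule: int_cases2)
      case (nonneg j)
      then show ?thesis using fpow_nat[of j] by (simp only: int_pow_int)
    next
      case (nonpos j)
      have "y a [^] j \<in> U A" using ypow[of "int j"] by (simp only: int_pow_int)
      then have "f a (inv (y a [^] j)) = - (int j * f a (y a))"
        using finv[OF a(1)] fpow_nat by simp
      then show ?thesis using nonpos a(2) by (simp add: int_pow_neg int_pow_int)
    qed
    have f_generator: "f a g = 0" if mem: "g \<in> y ` B \<union> N" for g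
    proof (cases "g \<in> N")
      case True
      then show ?thesis by (rule f_Z[OF a(1)])
    next
      case False
      then obtain b where b: "b \<in> B" "g = y b" using mem by blast
      moreover have "a \<noteq> b" "b \<in> A" using b insert.hyps B by blast+
      ultimately show ?thesis using f_y[OF a(1)] by metis
    qed
    have fh: "f a h = 0"
      using h(1) unfolding U_def
    proof (induction h rule: generate.induct)
      case one
      show ?case by (rule f1[OF a(1)])
    next
      case (incl h)
      then show ?case by (rule f_generator)
    next
      case (inv h)
      then have "h \<in> U B" unfolding U_def by (rule generate.incl)
      then have "h \<in> U A" using UA[OF B] by blast
      then show ?case using finv[OF a(1)] f_generator[OF inv] by simp
    next
      case (eng h1 h2)
      then have "h1 \<in> U A" "h2 \<in> U A" using UA[OF B] unfolding U_def by blast+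
      then show ?case using f_mult[OF a(1), of h1 h2] eng.IH unfolding U_def by simp
    qed
    have "f a g = k * f a (y a) + f a h"
      using f_mult[OF a(1), of "y a [^] k" h] ypow hA h(2) fpow unfolding U_def by simp
    then have "k = 0" using insert.prems(3)[of a] fh f_y[OF a(1) a(1)] by simp
    then have "g = h" using h U.mem_carrier by simp
    then show ?case using insert.IH[OF B, of g] h(1) insert.prems(3) by blast
  qed
  show ?thesis by (rule main[of A]) (use g in \<open>auto simp: U_def\<close>)
qed

end

section \<open>The integral Heisenberg group\<close>

text \<open>The coordinates of an element are an integer matrix \<open>x\<close> (root index, index of the basis of the
  lattice) and central entries \<open>m (r, s)\<close> for \<open>r < s\<close>. In a product, a root part of the left factor at
  the larger index \<open>s\<close> has to pass one of the right factor at the smaller index \<open>r\<close>; the cocycle records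
  the central element that this produces. For \<open>s \<le> r\<close> it is set to \<open>0\<close>, and the group operates on
  functions defined everywhere, so that no support condition has to be carried along.\<close>

definition heis_cocycle ::
    "nat \<Rightarrow> (nat \<Rightarrow> nat \<Rightarrow> int) \<Rightarrow> (nat \<times> nat \<Rightarrow> int) \<Rightarrow> (nat \<times> nat \<Rightarrow> int) \<Rightarrow> nat \<times> nat \<Rightarrow> int" where
  "heis_cocycle l a x y = (\<lambda>(r, s). if r < s then (\<Sum>i=1..l. \<Sum>j=1..l. a i j * x (i, s) * y (j, r)) else 0)"

definition heis_coords ::
    "nat \<Rightarrow> (nat \<Rightarrow> nat \<Rightarrow> int) \<Rightarrow> ((nat \<times> nat \<Rightarrow> int) \<times> (nat \<times> nat \<Rightarrow> int)) monoid" where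
  "heis_coords l a =
     \<lparr>carrier = UNIV,
      mult = \<lambda>g h. (\<lambda>p. fst g p + fst h p, \<lambda>p. snd g p + snd h p + heis_cocycle l a (fst g) (fst h) p),
      one = (\<lambda>_. 0, \<lambda>_. 0)\<rparr>"

definition unit_at :: "'a \<Rightarrow> 'a \<Rightarrow> int" where
  "unit_at a b = (if b = a then 1 else 0)"

text \<open>Induction for integer-valued functions of finite support: one coordinate is split off at a time, and
  its value is a multiple of \<open>c a\<close>.\<close>

lemma integer_combination_induct [consumes 1, case_names zero add minus unit dvd supported]:
  fixes f c :: "'a \<Rightarrow> int"
  assumes "finite A"
    and "Q (\<lambda>_. 0)"
    and add: "\<And>f g. \<lbrakk>Q f; Q g\<rbrakk> \<Longrightarrow> Q (\<lambda>p. f p + g p)"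
    and minus: "\<And>f. Q f \<Longrightarrow> Q (\<lambda>p. - f p)"
    and unit: "\<And>a. a \<in> A \<Longrightarrow> Q (\<lambda>p. c a * unit_at a p)"
    and "\<And>a. a \<in> A \<Longrightarrow> c a dvd f a"
    and "\<And>a. a \<notin> A \<Longrightarrow> f a = 0"
  shows "Q f"
  using assms(1,6,7) unit
proof (induction A arbitrary: f rule: finite_induct)
  case empty
  then have "f = (\<lambda>_. 0)" by auto
  then show ?case using assms(2) by simp
next
  case (insert a A)
  have mult_nat: "Q (\<lambda>p. int j * g p)" if "Q g" for g j
  proof (induction j)
    case (Suc j)
    have "(\<lambda>p. int (Suc j) * g p) = (\<lambda>p. g p + int j * g p)" by (auto simp: algebra_simps)
    then show ?case using add[OF that Suc] by simp
  qed (use assms(2) in simp)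
  have mult: "Q (\<lambda>p. k * g p)" if "Q g" for g k
  proof (cases k rule: int_cases2)
    case (nonneg j)
    then show ?thesis using mult_nat[OF that, of j] by simp
  next
    case (nonpos j)
    then show ?thesis using minus[OF mult_nat[OF that, of j]] by simp
  qed
  obtain k where k: "f a = c a * k" using insert.prems(1)[of a] by blast
  have "Q (\<lambda>p. if p = a then 0 else f p)"
    by (rule insert.IH) (use insert.hyps insert.prems in auto)
  moreover have "Q (\<lambda>p. k * (c a * unit_at a p))"
    by (rule mult) (use insert.prems(3) in simp)
  ultimately have "Q (\<lambda>p. (if p = a then 0 else f p) + k * (c a * unit_at a p))"
    by (rule add)
  also have "(\<lambda>p. (if p = a then 0 else f p) + k * (c a * unit_at a p)) = f"
    using k by (auto simp: unit_at_def)
  finally show ?case .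
qed

lemma heis_cocycle_add_left:
  "heis_cocycle l a (\<lambda>p. x p + y p) z p = heis_cocycle l a x z p + heis_cocycle l a y z p"
  by (simp add: heis_cocycle_def case_prod_unfold algebra_simps sum.distrib)

lemma heis_cocycle_add_right:
  "heis_cocycle l a x (\<lambda>p. y p + z p) p = heis_cocycle l a x y p + heis_cocycle l a x z p"
  by (simp add: heis_cocycle_def case_prod_unfold algebra_simps sum.distrib)

lemma heis_cocycle_zero [simp]:
  "heis_cocycle l a (\<lambda>_. 0) y p = 0" "heis_cocycle l a x (\<lambda>_. 0) p = 0"
  by (simp_all add: heis_cocycle_def case_prod_unfold)

lemma heis_cocycle_minus_left: "heis_cocycle l a (\<lambda>p. - x p) y p = - heis_cocycle l a x y p"
  by (simp add: heis_cocycle_def case_prod_unfold sum_negf)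

lemma heis_cocycle_unit:
  assumes "i \<in> {1..l}" "j \<in> {1..l}"
  shows "heis_cocycle l a (unit_at (i, s)) (unit_at (j, r)) p = (if r < s \<and> p = (r, s) then a i j else 0)"
proof -
  obtain r' s' where p: "p = (r', s')" by force
  have "(\<Sum>i'=1..l. \<Sum>j'=1..l. a i' j' * unit_at (i, s) (i', s') * unit_at (j, r) (j', r'))
      = (\<Sum>i'=1..l. \<Sum>j'=1..l. if i' = i then (if j' = j then (if r' = r \<and> s' = s then a i j else 0) else 0) else 0)"
    by (intro sum.cong) (auto simp: unit_at_def)
  also have "\<dots> = (\<Sum>i'=1..l. if i' = i then (\<Sum>j'=1..l. if j' = j then (if r' = r \<and> s' = s then a i j else 0) else 0) else 0)"
    by (intro sum.cong) auto
  also have "\<dots> = (if r' = r \<and> s' = s then a i j else 0)"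
    using assms by (simp add: sum.delta)
  finally show ?thesis unfolding p heis_cocycle_def by auto
qed

lemma group_heis_coords: "group (heis_coords l a)"
proof (rule groupI)
  let ?G = "heis_coords l a"
  show "x \<otimes>\<^bsub>?G\<^esub> y \<otimes>\<^bsub>?G\<^esub> z = x \<otimes>\<^bsub>?G\<^esub> (y \<otimes>\<^bsub>?G\<^esub> z)" for x y z
    by (simp add: heis_coords_def heis_cocycle_add_left heis_cocycle_add_right algebra_simps)
  show "\<exists>y \<in> carrier ?G. y \<otimes>\<^bsub>?G\<^esub> x = \<one>\<^bsub>?G\<^esub>" for x
    by (rule bexI[of _ "(\<lambda>p. - fst x p, \<lambda>p. heis_cocycle l a (fst x) (fst x) p - snd x p)"])
      (simp_all add: heis_coords_def heis_cocycle_minus_left)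
qed (simp_all add: heis_coords_def)

interpretation heis_coords: group "heis_coords l a" for l a
  by (rule group_heis_coords)

lemma carrier_heis_coords [simp]: "g \<in> carrier (heis_coords l a)"
  by (simp add: heis_coords_def)

lemma heis_coords_mult [simp]:
  "(x, m) \<otimes>\<^bsub>heis_coords l a\<^esub> (y, k) = (\<lambda>p. x p + y p, \<lambda>p. m p + k p + heis_cocycle l a x y p)"
  by (simp add: heis_coords_def)

lemma heis_coords_one: "\<one>\<^bsub>heis_coords l a\<^esub> = (\<lambda>_. 0, \<lambda>_. 0)"
  by (simp add: heis_coords_def)

lemma heis_coords_inv:
  "inv\<^bsub>heis_coords l a\<^esub> (x, m) = (\<lambda>p. - x p, \<lambda>p. heis_cocycle l a x x p - m p)"
  by (rule heis_coords.inv_equality) (simp_all add: heis_cocycle_minus_left heis_coords_one)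

lemma heis_coords_commutator:
  "inv\<^bsub>heis_coords l a\<^esub> (x, m) \<otimes>\<^bsub>heis_coords l a\<^esub> inv\<^bsub>heis_coords l a\<^esub> (y, k)
      \<otimes>\<^bsub>heis_coords l a\<^esub> (x, m) \<otimes>\<^bsub>heis_coords l a\<^esub> (y, k)
    = (\<lambda>_. 0, \<lambda>p. heis_cocycle l a x y p - heis_cocycle l a y x p)"
proof -
  let ?G = "heis_coords l a"
  have c: "heis_cocycle l a (\<lambda>p. - x p) z p = - heis_cocycle l a x z p"
    "heis_cocycle l a x (\<lambda>p. - z p) p = - heis_cocycle l a x z p" for x z p
    by (simp_all add: heis_cocycle_def case_prod_unfold sum_negf)
  have d: "heis_cocycle l a (\<lambda>p. x p - y p) z p = heis_cocycle l a x z p - heis_cocycle l a y z p" for x y z p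
    using heis_cocycle_add_left[of l a x "\<lambda>p. - y p" z p] by (simp add: c)
  show ?thesis
    by (simp add: heis_coords_inv heis_cocycle_add_left d c)
qed

lemma heis_coords_central_pow:
  "(\<lambda>_. 0, m) [^]\<^bsub>heis_coords l a\<^esub> (k :: int) = (\<lambda>_. 0, \<lambda>p. k * m p)"
proof -
  have *: "(\<lambda>_. 0, m) [^]\<^bsub>heis_coords l a\<^esub> j = (\<lambda>_. 0, \<lambda>p. int j * m p)" for j :: nat
    by (induction j) (auto simp: heis_coords_one algebra_simps)
  show ?thesis
  proof (cases k rule: int_cases2)
    case (nonneg j)
    then show ?thesis using *[of j] by (simp only: int_pow_int of_nat_id)
  next
    case (nonpos j)
    then show ?thesis using *[of j]
      by (simp add: heis_coords.int_pow_neg int_pow_int heis_coords_inv)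
  qed
qed

text \<open>The presented group is mapped to coordinates by sending \<open>y\<^sub>i\<^sub>r\<close> to a unit matrix and \<open>z\<^sub>r\<^sub>s\<close> to the
  central element with the single entry \<open>- n r s\<close>; the sign is forced because the commutator of
  \<open>y\<^sub>i\<^sub>r\<close> and \<open>y\<^sub>j\<^sub>s\<close> has as central entry minus the Cartan entry. An element with vanishing coordinates
  is trivial by collecting twice: first the \<open>y\<close>s modulo the central subgroup generated by the \<open>z\<close>s,
  then the \<open>z\<close>s modulo the trivial subgroup.\<close>

lemma heis_hat_coordinates:
  fixes a :: "nat \<Rightarrow> nat \<Rightarrow> real" and a' :: "nat \<Rightarrow> nat \<Rightarrow> int"
  assumes a: "\<And>i j. \<lbrakk>i \<in> {1..l}; j \<in> {1..l}\<rbrakk> \<Longrightarrow> a i j = of_int (a' i j)"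
    and sym: "\<And>i j. \<lbrakk>i \<in> {1..l}; j \<in> {1..l}\<rbrakk> \<Longrightarrow> a' i j = a' j i"
    and n_pos: "\<And>r s. \<lbrakk>1 \<le> r; r < s; s \<le> \<nu>\<rbrakk> \<Longrightarrow> 0 < n r s"
    and n_dvd: "\<And>i j r s. \<lbrakk>i \<in> {1..l}; j \<in> {1..l}; 1 \<le> r; r < s; s \<le> \<nu>\<rbrakk> \<Longrightarrow> int (n r s) dvd a' i j"
  obtains \<phi> where "\<phi> \<in> hom (heis_hat l \<nu> a n) (heis_coords l a')"
    and "\<phi> ` carrier (heis_hat l \<nu> a n) = generate (heis_coords l a')
      ({(unit_at (i, r), \<lambda>_. 0) | i r. i \<in> {1..l} \<and> r \<in> {1..\<nu>}} \<union>
       {(\<lambda>_. 0, \<lambda>p. - int (n r s) * unit_at (r, s) p) | r s. 1 \<le> r \<and> r < s \<and> s \<le> \<nu>})"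
    and "\<forall>g \<in> carrier (heis_hat l \<nu> a n).
        (\<forall>i \<in> {1..l}. \<forall>r \<in> {1..\<nu>}. fst (\<phi> g) (i, r) = 0) \<longrightarrow>
        (\<forall>r s. 1 \<le> r \<and> r < s \<and> s \<le> \<nu> \<longrightarrow> snd (\<phi> g) (r, s) = 0) \<longrightarrow> g = \<one>\<^bsub>heis_hat l \<nu> a n\<^esub>"
proof -
  let ?X = "heis_gens l \<nu>" and ?Rel = "heis_rels l \<nu> a n" and ?K = "heis_coords l a'"
  define H where "H = heis_hat l \<nu> a n"
  have H: "H = presented_group ?X ?Rel" by (simp add: H_def heis_hat_def)
  interpret H: group H unfolding H by (rule group_presented_group)
  define f where "f g = (case g of Y i r \<Rightarrow> (unit_at (i, r), \<lambda>_. 0)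
     | Z r s \<Rightarrow> (\<lambda>_. 0 :: int, \<lambda>p. - int (n r s) * unit_at (r, s) p))" for g
  have rel: "word_eval ?K f p = word_eval ?K f q" if pq: "(p, q) \<in> ?Rel" for p q
  proof -
    have comm: "word_eval ?K f (comm_word x y) = (\<lambda>_. 0, \<lambda>p. heis_cocycle l a' (fst (f x)) (fst (f y)) p
        - heis_cocycle l a' (fst (f y)) (fst (f x)) p)" for x y
      using heis_coords_commutator[of l a' "fst (f x)" "snd (f x)" "fst (f y)" "snd (f y)"]
      by (simp add: heis_coords.word_eval_comm_word)
    consider x y where "p = comm_word x y" "q = []" "fst (f x) = (\<lambda>_. 0) \<or> fst (f y) = (\<lambda>_. 0)"
      | i j r where "p = comm_word (Y i r) (Y j r)" "q = []" "i \<in> {1..l}" "j \<in> {1..l}"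
      | i j r s k where "p = comm_word (Y i r) (Y j s)" "q = power_word (Z r s) k"
          "i \<in> {1..l}" "j \<in> {1..l}" "1 \<le> r" "r < s" "s \<le> \<nu>" "real_of_int k = a i j / real (n r s)"
      using pq unfolding heis_rels_def f_def by fastforce
    then show ?thesis
    proof cases
      case 1
      then show ?thesis by (auto simp: comm heis_coords_one)
    next
      case 2
      then show ?thesis by (simp add: comm f_def heis_cocycle_unit heis_coords_one)
    next
      case 3
      have "real_of_int (k * int (n r s)) = real_of_int (a' i j)"
        using 3 a n_pos[of r s] by (simp add: field_simps)
      then have k: "k * int (n r s) = a' i j" by (simp only: of_int_eq_iff)
      have "word_eval ?K f q = (\<lambda>_. 0, \<lambda>p. k * (- int (n r s) * unit_at (r, s) p))"
        unfolding 3 using heis_coords_central_pow[where l = l and a = a' and k = k and m = "\<lambda>p. - int (n r s) * unit_at (r, s) p"]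
        by (subst heis_coords.word_eval_power_word) (simp_all add: f_def)
      moreover have "word_eval ?K f p = (\<lambda>_. 0, \<lambda>p. - a' i j * unit_at (r, s) p)"
        using 3 sym[of i j] by (auto simp: comm f_def heis_cocycle_unit unit_at_def fun_eq_iff)
      ultimately show ?thesis using k by (simp add: fun_eq_iff)
    qed
  qed
  obtain \<phi> where \<phi>: "\<phi> \<in> hom H ?K" and \<phi>f: "\<And>x. x \<in> ?X \<Longrightarrow> \<phi> (generator_class ?X ?Rel x) = f x"
    unfolding H using heis_coords.presented_group_universal[of f ?X l a' ?Rel] rel by auto
  interpret \<phi>: group_hom H ?K \<phi> using \<phi> by unfold_locales
  let ?g = "generator_class ?X ?Rel"
  have gc: "?g x \<in> carrier H" if "x \<in> ?X" for x
    using generator_class_closed[of ?X ?Rel] that unfolding H by auto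
  have gen: "carrier H = generate H (?g ` ?X)" unfolding H by (rule presented_group_generated)
  define A where "A = {1..l} \<times> {1..\<nu>}"
  define P where "P = {(r, s). 1 \<le> r \<and> r < s \<and> s \<le> \<nu>}"
  define y where "y = (\<lambda>(i, r). ?g (Y i r))"
  define z where "z = (\<lambda>(r, s). ?g (Z r s))"
  have fin: "finite A" "finite P"
  proof -
    have "P \<subseteq> {1..\<nu>} \<times> {1..\<nu>}" unfolding P_def by auto
    then show "finite P" by (rule finite_subset) auto
  qed (simp add: A_def)
  have X: "?X = (\<lambda>(i, r). Y i r) ` A \<union> (\<lambda>(r, s). Z r s) ` P"
    unfolding heis_gens_def A_def P_def by force
  have gX: "?g ` ?X = y ` A \<union> z ` P"
    unfolding X y_def z_def by (simp add: image_Un image_image case_prod_unfold)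
  have YX: "Y i r \<in> ?X" if "(i, r) \<in> A" for i r using that unfolding X by force
  have ZX: "Z r s \<in> ?X" if "(r, s) \<in> P" for r s using that unfolding X by force
  have yc: "y p \<in> carrier H" and \<phi>y: "\<phi> (y p) = (unit_at p, \<lambda>_. 0)" if "p \<in> A" for p
    using gc[OF YX] \<phi>f[OF YX] that by (auto simp: y_def f_def split: prod.splits)
  have zc: "z p \<in> carrier H"
    and \<phi>z: "\<phi> (z p) = (\<lambda>_. 0, \<lambda>q. - int (n (fst p) (snd p)) * unit_at p q)" if "p \<in> P" for p
    using gc[OF ZX] \<phi>f[OF ZX] that by (auto simp: z_def f_def split: prod.splits)
  have words: "comm_word x x' \<in> lists (?X \<times> UNIV)" "power_word x k \<in> lists (?X \<times> UNIV)" "[] \<in> lists (?X \<times> UNIV)"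
    if "x \<in> ?X" "x' \<in> ?X" for x x' k
    using that by (auto simp: comm_word_def power_word_def)
  have comm_rel: "inv\<^bsub>H\<^esub> ?g x \<otimes>\<^bsub>H\<^esub> inv\<^bsub>H\<^esub> ?g x' \<otimes>\<^bsub>H\<^esub> ?g x \<otimes>\<^bsub>H\<^esub> ?g x' = word_eval H ?g w"
    if "x \<in> ?X" "x' \<in> ?X" "(comm_word x x', w) \<in> ?Rel" "w \<in> lists (?X \<times> UNIV)" for x x' w
    using presented_group_relation[OF that(3) words(1)[OF that(1,2)] that(4)]
      H.word_eval_comm_word[of ?g x x'] gc that(1,2) unfolding H by simp
  have z_comm_gen: "?g x \<otimes>\<^bsub>H\<^esub> z p = z p \<otimes>\<^bsub>H\<^esub> ?g x" if x: "x \<in> ?X" and p: "p \<in> P" for x p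
  proof -
    obtain r s where rs: "p = (r, s)" by force
    have Zx: "Z r s \<in> ?X" using p rs ZX by simp
    have "(comm_word x (Z r s), []) \<in> ?Rel"
      using x p unfolding heis_gens_def heis_rels_def P_def rs by fast
    from comm_rel[OF x Zx this] show ?thesis
      using H.commutator_eq_oneD[OF gc[OF x] gc[OF Zx]] by (simp add: z_def rs)
  qed
  have z_comm: "g \<otimes>\<^bsub>H\<^esub> z p = z p \<otimes>\<^bsub>H\<^esub> g" if g: "g \<in> carrier H" and p: "p \<in> P" for g p
  proof -
    have "?g ` ?X \<subseteq> carrier H" using gc by blast
    moreover have "z p \<otimes>\<^bsub>H\<^esub> h = h \<otimes>\<^bsub>H\<^esub> z p" if "h \<in> ?g ` ?X" for h
      using that p by (elim imageE) (simp only: z_comm_gen)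
    moreover have "g \<in> generate H (?g ` ?X)" using g gen by simp
    ultimately show ?thesis using H.commutes_with_generate[OF _ zc[OF p]] by metis
  qed
  define N where "N = generate H (z ` P)"
  have zPc: "z ` P \<subseteq> carrier H" using zc by auto
  have Nsub: "subgroup N H" unfolding N_def by (rule H.generate_is_subgroup[OF zPc])
  have N_comm: "g \<otimes>\<^bsub>H\<^esub> h = h \<otimes>\<^bsub>H\<^esub> g" if g: "g \<in> carrier H" and h: "h \<in> N" for g h
  proof (rule H.commutes_with_generate[OF zPc g])
    show "g \<otimes>\<^bsub>H\<^esub> h = h \<otimes>\<^bsub>H\<^esub> g" if "h \<in> z ` P" for h
      using that by (elim imageE) (simp only: z_comm[OF g])
    show "h \<in> generate H (z ` P)" using h unfolding N_def .
  qed
  have N: "N \<lhd> H"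
  proof -
    have "x \<otimes>\<^bsub>H\<^esub> h \<otimes>\<^bsub>H\<^esub> inv\<^bsub>H\<^esub> x \<in> N" if "x \<in> carrier H" "h \<in> N" for x h
      using that subgroup.mem_carrier[OF Nsub that(2)] N_comm[OF that] by (simp add: H.m_assoc)
    then show ?thesis using Nsub by (simp add: H.normal_inv_iff)
  qed
  have zN: "z p \<in> N" if "p \<in> P" for p unfolding N_def using that by (auto intro: generate.incl)
  have y_comm: "inv\<^bsub>H\<^esub> y p \<otimes>\<^bsub>H\<^esub> inv\<^bsub>H\<^esub> y q \<otimes>\<^bsub>H\<^esub> y p \<otimes>\<^bsub>H\<^esub> y q \<in> N" if pq: "p \<in> A" "q \<in> A" for p q
  proof -
    obtain i r j s where p: "p = (i, r)" and q: "q = (j, s)" by force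
    have Yp: "Y i r \<in> ?X" and Yq: "Y j s \<in> ?X" using pq p q YX by simp_all
    have lt: "inv\<^bsub>H\<^esub> ?g (Y i r) \<otimes>\<^bsub>H\<^esub> inv\<^bsub>H\<^esub> ?g (Y j s) \<otimes>\<^bsub>H\<^esub> ?g (Y i r) \<otimes>\<^bsub>H\<^esub> ?g (Y j s) \<in> N"
      if "r < s" "(i, r) \<in> A" "(j, s) \<in> A" for i j r s
    proof -
      have rs: "1 \<le> r" "r < s" "s \<le> \<nu>" "i \<in> {1..l}" "j \<in> {1..l}" using that by (auto simp: A_def)
      have P: "(r, s) \<in> P" using rs by (auto simp: P_def)
      have YY: "Y i r \<in> ?X" "Y j s \<in> ?X" "Z r s \<in> ?X" using that P YX ZX by simp_all
      obtain k where k: "a' i j = int (n r s) * k" using n_dvd[OF rs(4,5,1,2,3)] by blast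
      have "real_of_int k = a i j / real (n r s)" using a[OF rs(4,5)] k n_pos[OF rs(1,2,3)] by simp
      then have "(comm_word (Y i r) (Y j s), power_word (Z r s) k) \<in> ?Rel"
        using rs unfolding heis_rels_def by blast
      from comm_rel[OF YY(1,2) this words(2)[OF YY(3) YY(3)]]
      have "inv\<^bsub>H\<^esub> ?g (Y i r) \<otimes>\<^bsub>H\<^esub> inv\<^bsub>H\<^esub> ?g (Y j s) \<otimes>\<^bsub>H\<^esub> ?g (Y i r) \<otimes>\<^bsub>H\<^esub> ?g (Y j s) = z (r, s) [^]\<^bsub>H\<^esub> k"
        using H.word_eval_power_word[of ?g "Z r s" k] gc[OF YY(3)] by (simp add: z_def)
      then show ?thesis using H.subgroup_int_pow_closed[OF Nsub zN[OF P]] by simp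
    qed
    consider "r < s" | "r = s" | "s < r" by linarith
    then show ?thesis
    proof cases
      case 1
      then show ?thesis using lt[of r s i j] pq p q by (simp add: y_def)
    next
      case 2
      then have "(comm_word (Y i r) (Y j s), []) \<in> ?Rel"
        using pq p q unfolding heis_rels_def A_def by fastforce
      from comm_rel[OF Yp Yq this words(3)[OF Yp Yq]] show ?thesis
        using subgroup.one_closed[OF Nsub] p q by (simp add: y_def)
    next
      case 3
      then have "inv\<^bsub>H\<^esub> (inv\<^bsub>H\<^esub> ?g (Y j s) \<otimes>\<^bsub>H\<^esub> inv\<^bsub>H\<^esub> ?g (Y i r) \<otimes>\<^bsub>H\<^esub> ?g (Y j s) \<otimes>\<^bsub>H\<^esub> ?g (Y i r)) \<in> N"
        using lt[of s r j i] pq p q subgroup.m_inv_closed[OF Nsub] by simp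
      then show ?thesis using gc[OF Yp] gc[OF Yq] p q
        by (simp add: y_def H.inv_mult_group H.m_assoc)
    qed
  qed
  have fst_\<phi>: "fst (\<phi> (g \<otimes>\<^bsub>H\<^esub> h)) p = fst (\<phi> g) p + fst (\<phi> h) p"
    if "g \<in> carrier H" "h \<in> carrier H" for g h p
    using that by (cases "\<phi> g"; cases "\<phi> h") simp
  have fst_\<phi>_N: "fst (\<phi> h) = (\<lambda>_. 0)" if "h \<in> N" for h
    using that unfolding N_def
  proof (induction rule: generate.induct)
    case one
    then show ?case by (simp add: heis_coords_one)
  next
    case (incl h)
    then show ?case using \<phi>z by auto
  next
    case (inv h)
    then show ?case using \<phi>z zc by (auto simp: heis_coords_inv)
  next
    case (eng h1 h2)
    then have h: "h1 \<in> carrier H" "h2 \<in> carrier H" using Nsub subgroup.subset N_def by blast+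
    show ?case using eng fst_\<phi>[OF h] by (simp add: fun_eq_iff)
  qed
  have gensub: "carrier H = generate H (y ` A \<union> N)"
  proof
    have "generate H (?g ` ?X) \<subseteq> generate H (y ` A \<union> N)"
      unfolding gX using zN by (intro H.mono_generate) auto
    then show "carrier H \<subseteq> generate H (y ` A \<union> N)" using gen by simp
    show "generate H (y ` A \<union> N) \<subseteq> carrier H"
      using yc subgroup.subset[OF Nsub] by (intro H.generate_incl) auto
  qed
  have ker: "g = \<one>\<^bsub>H\<^esub>" if g: "g \<in> carrier H" and gA: "\<And>p. p \<in> A \<Longrightarrow> fst (\<phi> g) p = 0"
    and gP: "\<And>p. p \<in> P \<Longrightarrow> snd (\<phi> g) p = 0" for g
  proof -
    have gN: "g \<in> N"
    proof (rule H.collecting[OF fin(1) N, of y "\<lambda>p g. fst (\<phi> g) p"])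
      show "g \<in> generate H (y ` A \<union> N)" using g gensub by simp
    qed (use yc y_comm fst_\<phi> gensub \<phi>y fst_\<phi>_N gA in \<open>auto simp: unit_at_def\<close>)
    have N1: "generate H (z ` P \<union> {\<one>\<^bsub>H\<^esub>}) \<subseteq> N"
      using zN subgroup.one_closed[OF Nsub] by (intro H.generate_subgroup_incl[OF _ Nsub]) auto
    have "g \<in> {\<one>\<^bsub>H\<^esub>}"
    proof (rule H.collecting[OF fin(2), of "{\<one>\<^bsub>H\<^esub>}" z "\<lambda>p g. snd (\<phi> g) p"])
      show "{\<one>\<^bsub>H\<^esub>} \<lhd> H" by (rule H.one_is_normal)
      show "z \<in> P \<rightarrow> carrier H" using zc by auto
      show "inv\<^bsub>H\<^esub> z p \<otimes>\<^bsub>H\<^esub> inv\<^bsub>H\<^esub> z q \<otimes>\<^bsub>H\<^esub> z p \<otimes>\<^bsub>H\<^esub> z q \<in> {\<one>\<^bsub>H\<^esub>}" if "p \<in> P" "q \<in> P" for p q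
        using that zc[OF that(1)] zc[OF that(2)] z_comm[of "z p" q]
        by (simp add: H.m_assoc H.mult_inv_cancel)
      show "snd (\<phi> (h \<otimes>\<^bsub>H\<^esub> k)) p = snd (\<phi> h) p + snd (\<phi> k) p"
        if "h \<in> generate H (z ` P \<union> {\<one>\<^bsub>H\<^esub>})" "k \<in> generate H (z ` P \<union> {\<one>\<^bsub>H\<^esub>})" for h k p
      proof -
        have hk: "h \<in> N" "k \<in> N" using that N1 by auto
        then have "h \<in> carrier H" "k \<in> carrier H" using subgroup.mem_carrier[OF Nsub] by auto
        then show ?thesis using fst_\<phi>_N[OF hk(1)] fst_\<phi>_N[OF hk(2)]
          by (cases "\<phi> h"; cases "\<phi> k") simp
      qed
      show "snd (\<phi> (z q)) p = 0 \<longleftrightarrow> p \<noteq> q" if "p \<in> P" "q \<in> P" for p q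
        using that n_pos[of "fst q" "snd q"] by (auto simp: \<phi>z unit_at_def P_def)
      show "snd (\<phi> h) p = 0" if "h \<in> {\<one>\<^bsub>H\<^esub>}" for p h
        using that by (simp add: heis_coords_one)
      show "g \<in> generate H (z ` P \<union> {\<one>\<^bsub>H\<^esub>})"
        using gN H.mono_generate[of "z ` P" "z ` P \<union> {\<one>\<^bsub>H\<^esub>}"] unfolding N_def by blast
    qed (use gP in auto)
    then show ?thesis by simp
  qed
  show ?thesis
  proof (rule that[of \<phi>])
    show "\<phi> \<in> hom (heis_hat l \<nu> a n) ?K" using \<phi> unfolding H_def .
    have "\<phi> ` carrier H = generate ?K (\<phi> ` (?g ` ?X))"
      using \<phi>.generate_img[of "?g ` ?X"] gc gen by auto
    moreover have "\<phi> ` (?g ` ?X) = {(unit_at (i, r), \<lambda>_. 0) | i r. i \<in> {1..l} \<and> r \<in> {1..\<nu>}} \<union>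
       {(\<lambda>_. 0, \<lambda>p. - int (n r s) * unit_at (r, s) p) | r s. 1 \<le> r \<and> r < s \<and> s \<le> \<nu>}"
    proof -
      have "\<phi> ` (y ` A) = (\<lambda>p. (unit_at p, \<lambda>_. 0)) ` A" unfolding image_image using \<phi>y by (intro image_cong) auto
      moreover have "\<phi> ` (z ` P) = (\<lambda>p. (\<lambda>_. 0, \<lambda>q. - int (n (fst p) (snd p)) * unit_at p q)) ` P"
        unfolding image_image using \<phi>z by (intro image_cong) auto
      moreover have "F ` A = {F (i, r) | i r. i \<in> {1..l} \<and> r \<in> {1..\<nu>}}" for F :: "nat \<times> nat \<Rightarrow> (nat \<times> nat \<Rightarrow> int) \<times> (nat \<times> nat \<Rightarrow> int)"
        unfolding A_def by blast
      moreover have "F ` P = {F (r, s) | r s. 1 \<le> r \<and> r < s \<and> s \<le> \<nu>}" for F :: "nat \<times> nat \<Rightarrow> (nat \<times> nat \<Rightarrow> int) \<times> (nat \<times> nat \<Rightarrow> int)"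
        unfolding P_def by blast
      ultimately show ?thesis unfolding gX image_Un by (simp only: fst_conv snd_conv)
    qed
    ultimately show "\<phi> ` carrier (heis_hat l \<nu> a n) = generate ?K
      ({(unit_at (i, r), \<lambda>_. 0) | i r. i \<in> {1..l} \<and> r \<in> {1..\<nu>}} \<union>
       {(\<lambda>_. 0, \<lambda>p. - int (n r s) * unit_at (r, s) p) | r s. 1 \<le> r \<and> r < s \<and> s \<le> \<nu>})"
      unfolding H_def by simp
    show "\<forall>g \<in> carrier (heis_hat l \<nu> a n).
        (\<forall>i \<in> {1..l}. \<forall>r \<in> {1..\<nu>}. fst (\<phi> g) (i, r) = 0) \<longrightarrow>
        (\<forall>r s. 1 \<le> r \<and> r < s \<and> s \<le> \<nu> \<longrightarrow> snd (\<phi> g) (r, s) = 0) \<longrightarrow> g = \<one>\<^bsub>heis_hat l \<nu> a n\<^esub>"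
      using ker unfolding H_def A_def P_def by auto
  qed
qed

section \<open>Simply laced extended affine root systems\<close>

lemma isolated_in_translation:
  fixes A :: "'a::real_normed_vector set"
  assumes "x isolated_in A"
  shows "(x - t) isolated_in ((\<lambda>s. s - t) ` A)"
proof -
  obtain T where T: "x \<in> A" "open T" "T \<inter> A = {x}"
    using assms by (auto simp: isolated_in_def)
  have "(\<lambda>s. s - t) ` T \<inter> (\<lambda>s. s - t) ` A = (\<lambda>s. s - t) ` (T \<inter> A)" by auto
  moreover have "open ((\<lambda>s. s - t) ` T)"
    using open_translation[OF T(2), of "- t"] by simp
  ultimately show ?thesis using T unfolding isolated_in_def by (intro conjI exI[of _ "(\<lambda>s. s - t) ` T"]) auto
qed

lemma independent_family_eqD:
  fixes f :: "'b \<Rightarrow> 'a::real_vector"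
  assumes "independent (f ` A)" "inj_on f A" "finite A"
    and "(\<Sum>i\<in>A. c i *\<^sub>R f i) = (\<Sum>i\<in>A. d i *\<^sub>R f i)" "i \<in> A"
  shows "c i = d i"
proof -
  define u where "u v = c (the_inv_into A f v) - d (the_inv_into A f v)" for v
  have u: "u (f j) = c j - d j" if "j \<in> A" for j
    unfolding u_def using the_inv_into_f_f[OF assms(2) that] by simp
  have "(\<Sum>v\<in>f ` A. u v *\<^sub>R v) = (\<Sum>j\<in>A. u (f j) *\<^sub>R f j)"
    by (subst sum.reindex[OF assms(2)]) simp
  also have "\<dots> = (\<Sum>j\<in>A. (c j - d j) *\<^sub>R f j)" using u by (intro sum.cong) auto
  also have "\<dots> = 0" using assms(4) by (simp add: scaleR_diff_left sum_subtractf)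
  finally have "u (f i) = 0"
    using independentD[OF assms(1), of "f ` A" u "f i"] assms(3,5) by auto
  then show ?thesis using u[OF assms(5)] by simp
qed

locale simply_laced =
  fixes form :: "'v::euclidean_space \<Rightarrow> 'v \<Rightarrow> real"
    and R Vd S :: "'v set"
    and X :: ade_type
    and \<alpha> \<sigma> :: "nat \<Rightarrow> 'v"
  assumes ears: "simply_laced_ears form R X Vd S \<alpha> \<sigma>"
begin

abbreviation "\<nu> \<equiv> nullity form"
abbreviation "l \<equiv> type_rank X"
abbreviation "V0 \<equiv> form_radical form"
abbreviation "\<Phi> \<equiv> finite_part form Vd R"
abbreviation "\<Lambda> \<equiv> group_closure S"

lemma ears_R: "extended_affine_root_system form R"
  and complement: "complement_of V0 Vd"
  and root_system: "root_system_of_type form Vd \<Phi> X"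
  and semilattice: "semilattice_in V0 S"
  and lattice: "l > 1 \<Longrightarrow> lattice_in V0 S"
  and R_eq: "R = (S + S) \<union> (\<Phi> + S)"
  and fundamental: "fundamental_system \<Phi> l \<alpha>"
  and norm_simple: "i \<in> {1..l} \<Longrightarrow> form (\<alpha> i) (\<alpha> i) = 2"
  and \<sigma>_in_S: "r \<in> {1..\<nu>} \<Longrightarrow> \<sigma> r \<in> S"
  and z_basis_\<sigma>: "z_basis \<nu> \<sigma> \<Lambda>"
  using ears unfolding simply_laced_ears_def by auto

lemma bilinear: "bilinear form"
  and form_sym: "form x y = form y x"
  using ears_R unfolding extended_affine_root_system_def psd_form_def by auto

lemma form_simps [simp]:
  "form (x + y) z = form x z + form y z" "form z (x + y) = form z x + form z y"
  "form (c *\<^sub>R x) z = c * form x z" "form z (c *\<^sub>R x) = c * form z x"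
  "form (- x) z = - form x z" "form z (- x) = - form z x"
  "form (x - y) z = form x z - form y z" "form z (x - y) = form z x - form z y"
  "form 0 z = 0" "form z 0 = 0"
  using bilinear
  by (simp_all add: bilinear_ladd bilinear_radd bilinear_lmul bilinear_rmul bilinear_lneg
      bilinear_rneg bilinear_lsub bilinear_rsub bilinear_lzero bilinear_rzero)

lemma form_sum_left: "form (sum f A) z = (\<Sum>i\<in>A. form (f i) z)"
  by (induction A rule: infinite_finite_induct) auto

lemma form_sum_right: "form z (sum f A) = (\<Sum>i\<in>A. form z (f i))"
  by (induction A rule: infinite_finite_induct) auto

lemma subspace_V0: "subspace V0"
  by (auto simp: subspace_def form_radical_def)

lemma form_V0 [simp]: "v \<in> V0 \<Longrightarrow> form v w = 0" "v \<in> V0 \<Longrightarrow> form w v = 0"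
  using form_sym[of w v] by (auto simp: form_radical_def)

lemma subspace_Vd: "subspace Vd"
  and Vd_Int_V0: "Vd \<inter> V0 = {0}"
  and Vd_plus_V0: "Vd + V0 = UNIV"
  using complement unfolding complement_of_def by auto

lemma decompose:
  obtains d s where "d \<in> Vd" "s \<in> V0" "v = d + s"
  using Vd_plus_V0 set_plus_def by (metis (no_types, lifting) UNIV_I set_plus_elim)

lemma decompose_unique:
  assumes "d \<in> Vd" "d' \<in> Vd" "s \<in> V0" "s' \<in> V0" "d + s = d' + s'"
  shows "d = d'" "s = s'"
proof -
  have "d - d' = s' - s" using assms(5) by (simp add: algebra_simps)
  moreover have "d - d' \<in> Vd" "s' - s \<in> V0"
    using assms subspace_diff[OF subspace_Vd] subspace_diff[OF subspace_V0] by auto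
  ultimately have "d - d' \<in> Vd \<inter> V0" by auto
  then show "d = d'" using Vd_Int_V0 by auto
  then show "s = s'" using assms(5) by simp
qed

lemma finite_root_system: "finite_root_system form Vd \<Phi>"
  using root_system unfolding root_system_of_type_def by simp

lemma form_pos: "\<lbrakk>x \<in> Vd; x \<noteq> 0\<rbrakk> \<Longrightarrow> 0 < form x x"
  and span_\<Phi>: "span \<Phi> = Vd"
  and zero_in_\<Phi>: "0 \<in> \<Phi>"
  and \<Phi>_integral: "\<lbrakk>\<beta> \<in> \<Phi>; \<beta> \<noteq> 0; \<gamma> \<in> \<Phi>\<rbrakk> \<Longrightarrow> form \<gamma> (coroot form \<beta>) \<in> \<int>"
  and \<Phi>_reflect: "\<lbrakk>\<beta> \<in> \<Phi>; \<beta> \<noteq> 0; \<gamma> \<in> \<Phi>\<rbrakk> \<Longrightarrow> \<gamma> - form \<gamma> (coroot form \<beta>) *\<^sub>R \<beta> \<in> \<Phi>"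
  and \<Phi>_reduced: "\<lbrakk>\<beta> \<in> \<Phi>; \<beta> \<noteq> 0; t *\<^sub>R \<beta> \<in> \<Phi>\<rbrakk> \<Longrightarrow> t \<in> {-1, 0, 1}"
  using finite_root_system unfolding finite_root_system_def by auto

lemma \<Phi>_subset: "\<Phi> \<subseteq> Vd" by (auto simp: finite_part_def)

lemma simple_root: "i \<in> {1..l} \<Longrightarrow> \<alpha> i \<in> \<Phi>"
  and inj_\<alpha>: "inj_on \<alpha> {1..l}"
  and independent_\<alpha>: "independent (\<alpha> ` {1..l})"
  and \<Phi>_simple: "\<beta> \<in> \<Phi> \<Longrightarrow> \<exists>k :: nat \<Rightarrow> nat.
        \<beta> = (\<Sum>i=1..l. real (k i) *\<^sub>R \<alpha> i) \<or> \<beta> = - (\<Sum>i=1..l. real (k i) *\<^sub>R \<alpha> i)"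
  using fundamental unfolding fundamental_system_def by auto

lemma simple_in_Vd: "i \<in> {1..l} \<Longrightarrow> \<alpha> i \<in> Vd"
  using simple_root \<Phi>_subset by auto

lemmas \<alpha>_eqD = independent_family_eqD[OF independent_\<alpha> inj_\<alpha> finite_atLeastAtMost]

lemma span_\<alpha>: "span (\<alpha> ` {1..l}) = Vd"
proof -
  have "\<beta> \<in> span (\<alpha> ` {1..l})" if "\<beta> \<in> \<Phi>" for \<beta>
  proof -
    have "(\<Sum>i=1..l. real (k i) *\<^sub>R \<alpha> i) \<in> span (\<alpha> ` {1..l})" for k
      by (intro span_sum span_scale span_base) auto
    then show ?thesis using \<Phi>_simple[OF that] span_neg by metis
  qed
  then have "span \<Phi> \<subseteq> span (\<alpha> ` {1..l})" by (intro span_minimal) auto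
  moreover have "span (\<alpha> ` {1..l}) \<subseteq> span \<Phi>" using simple_root by (intro span_mono) auto
  ultimately show ?thesis using span_\<Phi> by auto
qed

lemma dim_Vd: "dim Vd = l"
  using dim_span_eq_card_independent[OF independent_\<alpha>] card_image[OF inj_\<alpha>]
  unfolding span_\<alpha> by simp

lemma DIM_eq: "DIM('v) = l + \<nu>"
proof -
  have "v \<in> {x + y | x y. x \<in> Vd \<and> y \<in> V0}" for v
    by (rule decompose[of v]) blast
  then have "{x + y | x y. x \<in> Vd \<and> y \<in> V0} = UNIV" by blast
  then show ?thesis
    using dim_sums_Int[OF subspace_Vd subspace_V0] Vd_Int_V0 dim_Vd by (simp add: nullity_def)
qed

lemma rank_eq: "form_rank form = l"
  using DIM_eq by (simp add: form_rank_def)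

section \<open>The semilattice and the coordinates of its lattice\<close>

lemma S_subset: "S \<subseteq> V0"
  and span_S: "span S = V0"
  and zero_in_S: "0 \<in> S"
  and S_double: "\<lbrakk>s \<in> S; t \<in> S\<rbrakk> \<Longrightarrow> s + 2 *\<^sub>R t \<in> S" "\<lbrakk>s \<in> S; t \<in> S\<rbrakk> \<Longrightarrow> s - 2 *\<^sub>R t \<in> S"
  using semilattice unfolding semilattice_in_def by auto

lemma S_uminus: "s \<in> S \<Longrightarrow> - s \<in> S"
  using S_double(2)[of s s] by (simp add: scaleR_2)

lemma S_in_\<Lambda>: "s \<in> S \<Longrightarrow> s \<in> \<Lambda>"
  by (rule group_closure.base) simp

lemma \<Lambda>_subset: "\<Lambda> \<subseteq> V0"
proof
  fix x assume "x \<in> \<Lambda>"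
  then show "x \<in> V0"
    by induction (use S_subset subspace_0[OF subspace_V0] subspace_diff[OF subspace_V0] in auto)
qed

lemma S_plus_double_\<Lambda>:
  assumes "t \<in> \<Lambda>" "s \<in> S"
  shows "s + 2 *\<^sub>R t \<in> S"
proof -
  have "\<forall>s \<in> S. s + 2 *\<^sub>R t \<in> S \<and> s - 2 *\<^sub>R t \<in> S"
    using assms(1)
  proof induction
    case (base t)
    then show ?case using S_double zero_in_S by auto
  next
    case (diff t u)
    then show ?case
      by (metis (no_types, lifting) add_diff_eq diff_diff_add diff_add_eq scaleR_right_diff_distrib diff_diff_eq2)
  qed
  then show ?thesis using assms(2) by blast
qed

lemma \<sigma>_in_V0: "r \<in> {1..\<nu>} \<Longrightarrow> \<sigma> r \<in> V0" using \<sigma>_in_S S_subset by auto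

lemma \<Lambda>_eq: "\<Lambda> = {(\<Sum>r=1..\<nu>. of_int (k r) *\<^sub>R \<sigma> r) | k :: nat \<Rightarrow> int. True}"
  using z_basis_\<sigma> unfolding z_basis_def by simp

lemma span_\<sigma>: "span (\<sigma> ` {1..\<nu>}) = V0"
proof -
  have "\<Lambda> \<subseteq> span (\<sigma> ` {1..\<nu>})"
    unfolding \<Lambda>_eq by (auto intro!: span_sum span_scale intro: span_base)
  then have "S \<subseteq> span (\<sigma> ` {1..\<nu>})" using S_in_\<Lambda> by auto
  then have "span S \<subseteq> span (\<sigma> ` {1..\<nu>})" by (intro span_minimal) auto
  moreover have "span (\<sigma> ` {1..\<nu>}) \<subseteq> span S" using \<sigma>_in_S by (intro span_mono) auto
  ultimately show ?thesis using span_S by simp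
qed

text \<open>The simple roots and the \<open>\<sigma> r\<close> together span the whole space and are no more than its
  dimension, so they form a basis.\<close>

lemma independent_\<alpha>_\<sigma>: "independent (\<alpha> ` {1..l} \<union> \<sigma> ` {1..\<nu>})"
  and inj_\<sigma>: "inj_on \<sigma> {1..\<nu>}"
  and \<alpha>_\<sigma>_disjoint: "\<alpha> ` {1..l} \<inter> \<sigma> ` {1..\<nu>} = {}"
proof -
  let ?B = "\<alpha> ` {1..l} \<union> \<sigma> ` {1..\<nu>}"
  have "v \<in> span ?B" for v
  proof -
    obtain d s where "d \<in> Vd" "s \<in> V0" "v = d + s" by (rule decompose)
    moreover have "Vd \<subseteq> span ?B" "V0 \<subseteq> span ?B"
      unfolding span_\<alpha>[symmetric] span_\<sigma>[symmetric] by (intro span_mono; auto)+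
    ultimately show ?thesis by (auto intro: span_add)
  qed
  then have span: "UNIV \<subseteq> span ?B" by auto
  have card: "card (\<alpha> ` {1..l}) \<le> l" "card (\<sigma> ` {1..\<nu>}) \<le> \<nu>"
    using card_image_le[of "{1..l}" \<alpha>] card_image_le[of "{1..\<nu>}" \<sigma>] by auto
  have "card ?B \<le> card (\<alpha> ` {1..l}) + card (\<sigma> ` {1..\<nu>})" by (rule card_Un_le)
  then have le: "card ?B \<le> dim (UNIV :: 'v set)" using card DIM_eq by simp
  show "independent ?B"
    by (rule card_le_dim_spanning[OF _ span _ le]) auto
  have ge: "l + \<nu> \<le> card ?B" using span DIM_eq dim_le_card[OF span] by simp
  have "card ?B + card (\<alpha> ` {1..l} \<inter> \<sigma> ` {1..\<nu>}) = card (\<alpha> ` {1..l}) + card (\<sigma> ` {1..\<nu>})"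
    by (rule card_Un_Int[symmetric]) auto
  with ge card have "card (\<sigma> ` {1..\<nu>}) = \<nu>" "card (\<alpha> ` {1..l} \<inter> \<sigma> ` {1..\<nu>}) = 0" by linarith+
  then show "inj_on \<sigma> {1..\<nu>}" "\<alpha> ` {1..l} \<inter> \<sigma> ` {1..\<nu>} = {}"
    by (auto intro: eq_card_imp_inj_on)
qed

lemma independent_\<sigma>: "independent (\<sigma> ` {1..\<nu>})"
  using independent_mono[OF independent_\<alpha>_\<sigma>] by auto

lemmas \<sigma>_eqD = independent_family_eqD[OF independent_\<sigma> inj_\<sigma> finite_atLeastAtMost]

text \<open>The dual basis of the radical, as functionals that vanish on the complement: evaluating a group
  element there reads off its central entries.\<close>

lemma dual_functional:
  assumes "r \<in> {1..\<nu>}"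
  obtains \<phi> where "(0, \<phi>) \<in> hyper_space Vd"
    and "\<And>s. s \<in> {1..\<nu>} \<Longrightarrow> blinfun_apply \<phi> (\<sigma> s) = (if s = r then 1 else 0)"
proof -
  obtain g :: "'v \<Rightarrow> real" where g: "linear g"
    "\<forall>x \<in> \<alpha> ` {1..l} \<union> \<sigma> ` {1..\<nu>}. g x = (if x = \<sigma> r then 1 else 0)"
    using linear_independent_extend[OF independent_\<alpha>_\<sigma>, of "\<lambda>x. if x = \<sigma> r then 1 else 0"] by blast
  have bl: "bounded_linear g" using g(1) by (rule linear_conv_bounded_linear[THEN iffD1])
  have "g x = 0" if "x \<in> Vd" for x
  proof (rule linear_eq_0_on_span[OF g(1), of "\<alpha> ` {1..l}"])
    show "g y = 0" if "y \<in> \<alpha> ` {1..l}" for y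
      using g(2) that \<alpha>_\<sigma>_disjoint assms by auto
    show "x \<in> span (\<alpha> ` {1..l})" using that span_\<alpha> by simp
  qed
  then have "(0, Blinfun g) \<in> hyper_space Vd"
    by (simp add: hyper_space_def bounded_linear_Blinfun_apply[OF bl])
  moreover have "blinfun_apply (Blinfun g) (\<sigma> s) = (if s = r then 1 else 0)" if "s \<in> {1..\<nu>}" for s
    using g(2) that assms inj_\<sigma> by (auto simp: bounded_linear_Blinfun_apply[OF bl] inj_on_eq_iff)
  ultimately show ?thesis by (rule that)
qed

abbreviation "coord \<equiv> coords \<nu> \<sigma>"

lemma coords_eqI:
  assumes "\<And>r. r \<notin> {1..\<nu>} \<Longrightarrow> k r = 0" "x = (\<Sum>r=1..\<nu>. of_int (k r) *\<^sub>R \<sigma> r)"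
  shows "coord x = k"
  unfolding coords_def
proof (rule the_equality)
  fix k' assume k': "(\<forall>r. r \<notin> {1..\<nu>} \<longrightarrow> k' r = 0) \<and> x = (\<Sum>r=1..\<nu>. of_int (k' r) *\<^sub>R \<sigma> r)"
  show "k' = k"
  proof
    fix r
    show "k' r = k r"
    proof (cases "r \<in> {1..\<nu>}")
      case True
      have "real_of_int (k' r) = real_of_int (k r)"
        by (rule \<sigma>_eqD[OF _ True, where c = "\<lambda>r. of_int (k' r)" and d = "\<lambda>r. of_int (k r)"])
          (use k' assms(2) in simp)
      then show ?thesis by simp
    qed (use k' assms(1) in simp)
  qed
qed (use assms in auto)

lemma coords_\<Lambda>:
  assumes "x \<in> \<Lambda>"
  shows "x = (\<Sum>r=1..\<nu>. of_int (coord x r) *\<^sub>R \<sigma> r)" "r \<notin> {1..\<nu>} \<Longrightarrow> coord x r = 0"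
proof -
  obtain k where k: "x = (\<Sum>r=1..\<nu>. of_int (k r) *\<^sub>R \<sigma> r)" using assms \<Lambda>_eq by auto
  define k' where "k' r = (if r \<in> {1..\<nu>} then k r else 0)" for r
  have "x = (\<Sum>r=1..\<nu>. of_int (k' r) *\<^sub>R \<sigma> r)" unfolding k by (intro sum.cong) (auto simp: k'_def)
  then have "coord x = k'" by (intro coords_eqI) (auto simp: k'_def)
  then show "x = (\<Sum>r=1..\<nu>. of_int (coord x r) *\<^sub>R \<sigma> r)" "r \<notin> {1..\<nu>} \<Longrightarrow> coord x r = 0"
    using \<open>x = (\<Sum>r=1..\<nu>. of_int (k' r) *\<^sub>R \<sigma> r)\<close> by (auto simp: k'_def)
qed

lemma supp_sum:
  "supp \<nu> \<sigma> (\<Sum>r=1..\<nu>. of_int (k r) *\<^sub>R \<sigma> r) = {r \<in> {1..\<nu>}. odd (k r)}"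
proof -
  have "coord (\<Sum>r=1..\<nu>. of_int (k r) *\<^sub>R \<sigma> r) = (\<lambda>r. if r \<in> {1..\<nu>} then k r else 0)"
    by (intro coords_eqI sum.cong) auto
  then show ?thesis by (auto simp: supp_def)
qed

lemma sum_in_\<Lambda>: "(\<Sum>r=1..\<nu>. of_int (k r) *\<^sub>R \<sigma> r) \<in> \<Lambda>"
  using \<Lambda>_eq by auto

text \<open>A semilattice is a union of cosets of \<open>2 \<Lambda>\<close>, so membership depends on parities only. This is how
  the supporting class enters all later arguments.\<close>

lemma in_S_iff:
  assumes "x \<in> \<Lambda>"
  shows "x \<in> S \<longleftrightarrow> supp \<nu> \<sigma> x \<in> supp_class \<nu> \<sigma> S"
proof
  assume "supp \<nu> \<sigma> x \<in> supp_class \<nu> \<sigma> S"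
  then obtain s where s: "s \<in> S" "supp \<nu> \<sigma> x = supp \<nu> \<sigma> s" by (auto simp: supp_class_def)
  have par: "even (coord x r - coord s r)" if "r \<in> {1..\<nu>}" for r
    using s(2) that unfolding supp_def by auto
  have "x - s = (\<Sum>r=1..\<nu>. of_int (coord x r - coord s r) *\<^sub>R \<sigma> r)"
    using coords_\<Lambda>(1)[OF assms] coords_\<Lambda>(1)[OF S_in_\<Lambda>[OF s(1)]]
    by (simp add: scaleR_diff_left sum_subtractf)
  also have "\<dots> = (\<Sum>r=1..\<nu>. of_int (2 * ((coord x r - coord s r) div 2)) *\<^sub>R \<sigma> r)"
    using par by (intro sum.cong) auto
  also have "\<dots> = 2 *\<^sub>R (\<Sum>r=1..\<nu>. of_int ((coord x r - coord s r) div 2) *\<^sub>R \<sigma> r)"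
    by (simp add: scaleR_sum_right)
  finally have "x = s + 2 *\<^sub>R (\<Sum>r=1..\<nu>. of_int ((coord x r - coord s r) div 2) *\<^sub>R \<sigma> r)"
    by (metis add.commute diff_add_cancel)
  then show "x \<in> S" using S_plus_double_\<Lambda>[OF sum_in_\<Lambda> s(1)] by metis
qed (auto simp: supp_class_def)

lemma sum_in_S_iff:
  "(\<Sum>r=1..\<nu>. of_int (k r) *\<^sub>R \<sigma> r) \<in> S \<longleftrightarrow> {r \<in> {1..\<nu>}. odd (k r)} \<in> supp_class \<nu> \<sigma> S"
  unfolding in_S_iff[OF sum_in_\<Lambda>] supp_sum ..

lemma supp_class_subset: "J \<in> supp_class \<nu> \<sigma> S \<Longrightarrow> J \<subseteq> {1..\<nu>}"
  by (auto simp: supp_class_def supp_def)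

lemma in_supp_class_iff:
  assumes "J \<subseteq> {1..\<nu>}"
  shows "J \<in> supp_class \<nu> \<sigma> S \<longleftrightarrow> (\<Sum>r\<in>J. \<sigma> r) \<in> S"
proof -
  have "(\<Sum>r\<in>J. \<sigma> r) = (\<Sum>r=1..\<nu>. if r \<in> J then \<sigma> r else 0)"
    using assms by (simp add: sum.inter_restrict[symmetric] Int_absorb1)
  also have "\<dots> = (\<Sum>r=1..\<nu>. of_int (if r \<in> J then 1 else 0) *\<^sub>R \<sigma> r)"
    by (intro sum.cong) auto
  finally have "(\<Sum>r\<in>J. \<sigma> r) \<in> S \<longleftrightarrow> {r \<in> {1..\<nu>}. odd (if r \<in> J then 1 else 0 :: int)} \<in> supp_class \<nu> \<sigma> S"
    using sum_in_S_iff[of "\<lambda>r. if r \<in> J then 1 else 0"] by simp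
  moreover have "{r \<in> {1..\<nu>}. odd (if r \<in> J then 1 else 0 :: int)} = J" using assms by auto
  ultimately show ?thesis by simp
qed

section \<open>The finite root system\<close>

lemma simple_nonzero: "i \<in> {1..l} \<Longrightarrow> \<alpha> i \<noteq> 0"
  using norm_simple[of i] by auto

lemma form_simple_int:
  assumes "i \<in> {1..l}" "\<beta> \<in> \<Phi>"
  shows "form \<beta> (\<alpha> i) \<in> \<int>"
  using \<Phi>_integral[OF simple_root[OF assms(1)] simple_nonzero[OF assms(1)] assms(2)]
    norm_simple[OF assms(1)] by (simp add: coroot_def)

text \<open>The normalisation of the simple roots carries over to all roots. If \<open>\<beta>\<close> is positive and not
  simple, positivity of its norm provides a simple root with positive coefficient and positive product
  with \<open>\<beta>\<close>; the reflection in it keeps the norm, and keeps some positive coefficient, hence positivity,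
  but lowers the height.\<close>

lemma root_norm_height:
  assumes "\<beta> \<in> \<Phi>" "\<beta> \<noteq> 0" "\<beta> = (\<Sum>i=1..l. real (k i) *\<^sub>R \<alpha> i)"
  shows "form \<beta> \<beta> = 2"
  using assms
proof (induction "\<Sum>i=1..l. k i" arbitrary: \<beta> k rule: less_induct)
  case less
  have pos: "0 < form \<beta> \<beta>" using form_pos less.prems \<Phi>_subset by auto
  have "form \<beta> \<beta> = (\<Sum>i=1..l. real (k i) * form \<beta> (\<alpha> i))"
    using arg_cong[OF less.prems(3), of "form \<beta>"] by (simp add: form_sum_right)
  then obtain i where i: "i \<in> {1..l}" "0 < real (k i) * form \<beta> (\<alpha> i)"
    using pos sum_nonpos[of "{1..l}" "\<lambda>i. real (k i) * form \<beta> (\<alpha> i)"] by (metis not_less)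
  obtain c where c: "form \<beta> (\<alpha> i) = of_int c"
    using form_simple_int[OF i(1) less.prems(1)] by (auto elim: Ints_cases)
  have c_pos: "0 < c" using i(2) c by (simp add: zero_less_mult_iff)
  have ki: "0 < k i" using i(2) by (metis mult_zero_left of_nat_0 not_gr_zero less_irrefl)
  show ?case
  proof (cases "\<forall>j \<in> {1..l}. j \<noteq> i \<longrightarrow> k j = 0")
    case True
    have "\<beta> = (\<Sum>j=1..l. if j = i then real (k i) *\<^sub>R \<alpha> i else 0)"
      unfolding less.prems(3) using True by (intro sum.cong) auto
    also have "\<dots> = real (k i) *\<^sub>R \<alpha> i" using i(1) by simp
    finally have \<beta>: "\<beta> = real (k i) *\<^sub>R \<alpha> i" .
    then have "real (k i) \<in> {-1, 0, 1}"
      using \<Phi>_reduced[OF simple_root[OF i(1)] simple_nonzero[OF i(1)]] less.prems(1) by blast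
    then show ?thesis using \<beta> ki norm_simple[OF i(1)] by auto
  next
    case False
    then obtain j where j: "j \<in> {1..l}" "j \<noteq> i" "0 < k j" by auto
    define \<beta>' where "\<beta>' = \<beta> - of_int c *\<^sub>R \<alpha> i"
    have \<beta>': "\<beta>' \<in> \<Phi>"
      using \<Phi>_reflect[OF simple_root[OF i(1)] simple_nonzero[OF i(1)] less.prems(1)] c norm_simple[OF i(1)]
      by (simp add: coroot_def \<beta>'_def)
    define k' where "k' = (\<lambda>q. if q = i then int (k i) - c else int (k q))"
    have "\<beta>' = (\<Sum>q=1..l. real (k q) *\<^sub>R \<alpha> q) - (\<Sum>q=1..l. if q = i then of_int c *\<^sub>R \<alpha> i else 0)"
      unfolding \<beta>'_def using less.prems(3) i(1) by simp
    also have "\<dots> = (\<Sum>q=1..l. of_int (k' q) *\<^sub>R \<alpha> q)"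
      unfolding sum_subtractf[symmetric] by (intro sum.cong) (auto simp: k'_def scaleR_diff_left)
    finally have \<beta>'_eq: "\<beta>' = (\<Sum>q=1..l. of_int (k' q) *\<^sub>R \<alpha> q)" .
    obtain m where m: "\<beta>' = (\<Sum>i=1..l. real (m i) *\<^sub>R \<alpha> i) \<or> \<beta>' = - (\<Sum>i=1..l. real (m i) *\<^sub>R \<alpha> i)"
      using \<Phi>_simple[OF \<beta>'] by blast
    \<comment> \<open>the coefficient at \<open>j\<close> is unchanged and positive\<close>
    have "\<not> \<beta>' = - (\<Sum>i=1..l. real (m i) *\<^sub>R \<alpha> i)"
    proof
      assume "\<beta>' = - (\<Sum>i=1..l. real (m i) *\<^sub>R \<alpha> i)"
      then have "(\<Sum>q=1..l. of_int (k' q) *\<^sub>R \<alpha> q) = (\<Sum>i=1..l. (- real (m i)) *\<^sub>R \<alpha> i)"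
        using \<beta>'_eq by (simp add: sum_negf)
      then have "of_int (k' j) = - real (m j)" by (rule \<alpha>_eqD) (rule j(1))
      then show False using j by (simp add: k'_def)
    qed
    then have \<beta>'m: "\<beta>' = (\<Sum>i=1..l. real (m i) *\<^sub>R \<alpha> i)" using m by blast
    have mk: "int (m q) = k' q" if "q \<in> {1..l}" for q
    proof -
      have "real (m q) = real_of_int (k' q)" using \<beta>'m \<beta>'_eq \<alpha>_eqD[OF _ that] by metis
      then show ?thesis by linarith
    qed
    have "(\<Sum>q=1..l. m q) < (\<Sum>q=1..l. k q)"
    proof (rule sum_strict_mono_ex1)
      show "\<forall>q\<in>{1..l}. m q \<le> k q"
      proof
        fix q assume "q \<in> {1..l}"
        then show "m q \<le> k q" using mk[of q] c_pos by (auto simp: k'_def split: if_splits)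
      qed
      show "\<exists>q\<in>{1..l}. m q < k q"
        using mk[OF i(1)] c_pos i(1) by (intro bexI[of _ i]) (auto simp: k'_def)
    qed simp
    moreover have norm: "form \<beta>' \<beta>' = form \<beta> \<beta>"
      using c norm_simple[OF i(1)] form_sym[of "\<alpha> i" \<beta>] by (simp add: \<beta>'_def algebra_simps)
    moreover have "\<beta>' \<noteq> 0" using norm pos by auto
    ultimately have "form \<beta>' \<beta>' = 2" using less.hyps[of m \<beta>'] \<beta>' \<beta>'m by blast
    then show ?thesis using norm by simp
  qed
qed

lemma \<Phi>_uminus: "\<beta> \<in> \<Phi> \<Longrightarrow> - \<beta> \<in> \<Phi>"
proof (cases "\<beta> = 0")
  case False
  assume \<beta>: "\<beta> \<in> \<Phi>"
  have "form \<beta> \<beta> \<noteq> 0" using form_pos[of \<beta>] \<beta> \<Phi>_subset False by auto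
  then have "form \<beta> (coroot form \<beta>) = 2" by (simp add: coroot_def)
  then show ?thesis using \<Phi>_reflect[OF \<beta> False \<beta>] by (simp add: scaleR_2)
qed simp

lemma root_norm:
  assumes "\<beta> \<in> \<Phi>" "\<beta> \<noteq> 0"
  shows "form \<beta> \<beta> = 2"
proof -
  obtain k where "\<beta> = (\<Sum>i=1..l. real (k i) *\<^sub>R \<alpha> i) \<or> - \<beta> = (\<Sum>i=1..l. real (k i) *\<^sub>R \<alpha> i)"
    using \<Phi>_simple[OF assms(1)] by (metis minus_minus)
  moreover have "form (- \<beta>) (- \<beta>) = 2" if "- \<beta> = (\<Sum>i=1..l. real (k i) *\<^sub>R \<alpha> i)"
    using root_norm_height[OF \<Phi>_uminus[OF assms(1)] _ that] assms(2) by (metis neg_equal_0_iff_equal)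
  ultimately have "form \<beta> \<beta> = 2 \<or> form (- \<beta>) (- \<beta>) = 2" using root_norm_height[OF assms] by blast
  then show ?thesis by simp
qed

lemma root_integer_combination:
  assumes "\<beta> \<in> \<Phi>"
  obtains k :: "nat \<Rightarrow> int" where "\<beta> = (\<Sum>i=1..l. of_int (k i) *\<^sub>R \<alpha> i)"
proof -
  obtain k :: "nat \<Rightarrow> nat" where "\<beta> = (\<Sum>i=1..l. real (k i) *\<^sub>R \<alpha> i) \<or> \<beta> = - (\<Sum>i=1..l. real (k i) *\<^sub>R \<alpha> i)"
    using \<Phi>_simple[OF assms] by blast
  then show ?thesis
    using that[of "\<lambda>i. int (k i)"] that[of "\<lambda>i. - int (k i)"] by (auto simp: sum_negf)
qed

end

section \<open>Linear groups\<close>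

lemma subgroup_GL:
  assumes "subspace W"
  shows "subgroup (carrier (GL W)) (BijGroup W)"
proof (rule subgroup.intro)
  let ?G = "BijGroup W"
  interpret B: group ?G by (rule group_BijGroup)
  show "carrier (GL W) \<subseteq> carrier ?G" by (auto simp: GL_def BijGroup_def)
  show "\<one>\<^bsub>?G\<^esub> \<in> carrier (GL W)"
    using id_Bij[of W] subspace_add[OF assms] subspace_scale[OF assms] by (auto simp: GL_def BijGroup_def)
  fix f assume f: "f \<in> carrier (GL W)"
  then have fB: "f \<in> Bij W" by (simp add: GL_def)
  note fW = Bij_imp_funcset[OF fB]
  show "f \<otimes>\<^bsub>?G\<^esub> g \<in> carrier (GL W)" if g: "g \<in> carrier (GL W)" for g
  proof -
    have gB: "g \<in> Bij W" using g by (simp add: GL_def)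
    have "g x \<in> W" if "x \<in> W" for x using Bij_imp_funcset[OF gB] that by auto
    then show ?thesis
      using f g compose_Bij[OF fB gB] subspace_add[OF assms] subspace_scale[OF assms] fB gB
      by (simp add: GL_def BijGroup_def compose_def)
  qed
  have bij: "bij_betw f W W" using fB by (simp add: Bij_def)
  let ?i = "inv_into W f"
  have i: "?i x \<in> W" "f (?i x) = x" if "x \<in> W" for x
    using that bij by (auto simp: bij_betw_def inv_into_into f_inv_into_f)
  have inj: "x = y" if "x \<in> W" "y \<in> W" "f x = f y" for x y
    using that bij by (auto simp: bij_betw_def inj_on_def)
  have add: "f (x + y) = f x + f y" if "x \<in> W" "y \<in> W" for x y
    using f that by (simp add: GL_def)
  have scale: "f (c *\<^sub>R x) = c *\<^sub>R f x" if "x \<in> W" for c x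
    using f that by (simp add: GL_def)
  have "?i (x + y) = ?i x + ?i y" if xy: "x \<in> W" "y \<in> W" for x y
  proof (rule inj)
    show "?i (x + y) \<in> W" by (rule i(1)[OF subspace_add[OF assms xy]])
    show "?i x + ?i y \<in> W" by (rule subspace_add[OF assms i(1)[OF xy(1)] i(1)[OF xy(2)]])
    show "f (?i (x + y)) = f (?i x + ?i y)"
      by (simp only: add i xy subspace_add[OF assms])
  qed
  moreover have "?i (c *\<^sub>R x) = c *\<^sub>R ?i x" if x: "x \<in> W" for x c
  proof (rule inj)
    show "?i (c *\<^sub>R x) \<in> W" by (rule i(1)[OF subspace_scale[OF assms x]])
    show "c *\<^sub>R ?i x \<in> W" by (rule subspace_scale[OF assms i(1)[OF x]])
    show "f (?i (c *\<^sub>R x)) = f (c *\<^sub>R ?i x)"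
      by (simp only: scale i x subspace_scale[OF assms])
  qed
  ultimately show "inv\<^bsub>?G\<^esub> f \<in> carrier (GL W)"
    unfolding inv_BijGroup[OF fB]
    using restrict_inv_into_Bij[OF fB] subspace_add[OF assms] subspace_scale[OF assms]
    by (simp add: GL_def)
qed

lemma group_GL:
  assumes "subspace W"
  shows "group (GL W)"
proof -
  have "GL W = (BijGroup W)\<lparr>carrier := carrier (GL W)\<rparr>" by (simp add: GL_def)
  then show ?thesis
    using group.subgroup_imp_group[OF group_BijGroup subgroup_GL[OF assms]] by simp
qed

lemma GL_mult: "\<lbrakk>f \<in> carrier (GL W); g \<in> carrier (GL W)\<rbrakk> \<Longrightarrow> f \<otimes>\<^bsub>GL W\<^esub> g = compose W f g"
  by (simp add: GL_def BijGroup_def)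

lemma GL_one: "\<one>\<^bsub>GL W\<^esub> = (\<lambda>x\<in>W. x)"
  by (simp add: GL_def BijGroup_def)

lemma subspace_hyper_space: "subspace (hyper_space Vd)"
  by (auto simp: subspace_def hyper_space_def plus_blinfun.rep_eq scaleR_blinfun.rep_eq zero_prod_def)

section \<open>The Heisenberg-like group in coordinates\<close>

context simply_laced
begin

abbreviation "U \<equiv> hyper_space Vd"

sublocale GL: group "GL U" by (rule group_GL[OF subspace_hyper_space])

abbreviation gl_mult (infixl \<open>\<cdot>\<close> 70) where "g \<cdot> h \<equiv> g \<otimes>\<^bsub>GL U\<^esub> h"
abbreviation "reflection \<equiv> refl_w form Vd"
abbreviation "c_rs \<equiv> c_elt form Vd \<sigma>"
abbreviation "z_J \<equiv> z_elt form Vd S \<sigma>"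

text \<open>The form of the hyperbolic space with one argument restricted to \<open>V\<close>.\<close>

definition pairing :: "'v \<Rightarrow> 'v hyper \<Rightarrow> real" where
  "pairing v u = form v (fst u) + blinfun_apply (snd u) v"

lemma pairing_simps [simp]:
  "pairing (v + w) u = pairing v u + pairing w u"
  "pairing (c *\<^sub>R v) u = c * pairing v u"
  "pairing v (u + u') = pairing v u + pairing v u'"
  "pairing v (u - u') = pairing v u - pairing v u'"
  "pairing v (c *\<^sub>R u) = c * pairing v u"
  "pairing v (w, 0) = form v w"
  "pairing 0 u = 0"
  by (simp_all add: pairing_def blinfun.bilinear_simps algebra_simps)

lemma pairing_sum: "pairing (sum f A) u = (\<Sum>i\<in>A. pairing (f i) u)"
  by (induction A rule: infinite_finite_induct) auto

lemma hyper_form_pairing: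
  "hyper_form form (v, 0) u = pairing v u" "hyper_form form u (v, 0) = pairing v u"
  using form_sym by (auto simp: hyper_form_def pairing_def)

lemma V_in_U [simp]: "(v, 0) \<in> U" by (simp add: hyper_space_def)

lemma U_closed: "u \<in> U \<Longrightarrow> u' \<in> U \<Longrightarrow> u + u' \<in> U" "u \<in> U \<Longrightarrow> c *\<^sub>R u \<in> U" "u \<in> U \<Longrightarrow> u' \<in> U \<Longrightarrow> u - u' \<in> U"
  using subspace_hyper_space by (auto intro: subspace_add subspace_scale subspace_diff)

text \<open>The entries of the Cartan matrix are integers; the floor only turns them into values of type
  \<^typ>\<open>int\<close>.\<close>

definition gram :: "nat \<Rightarrow> nat \<Rightarrow> int" where
  "gram i j = \<lfloor>form (\<alpha> i) (\<alpha> j)\<rfloor>"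

lemma gram: "\<lbrakk>i \<in> {1..l}; j \<in> {1..l}\<rbrakk> \<Longrightarrow> of_int (gram i j) = form (\<alpha> i) (\<alpha> j)"
  using form_simple_int[OF _ simple_root, of j i] by (auto simp: gram_def elim: Ints_cases)

lemma gram_sym: "gram i j = gram j i" using form_sym by (simp add: gram_def)

abbreviation "heis \<equiv> heis_coords l gram"

text \<open>A group element with coordinates \<open>(x, m)\<close> acts as \<open>u\<close> plus a vector that is linear in \<open>u\<close>:
  each basis vector \<open>\<sigma> r\<close> of the radical is coupled with a vector \<open>root_part x r\<close> of the root space, and
  with the other \<open>\<sigma> s\<close> through a matrix. Since the element preserves the form, the sum of
  this matrix and its transpose has the entries \<open>form (root_part x r) (root_part x s)\<close>. So the entries
  above the diagonal, which are the \<open>m (r, s)\<close>, determine the others.\<close>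

definition root_part :: "(nat \<times> nat \<Rightarrow> int) \<Rightarrow> nat \<Rightarrow> 'v" where
  "root_part x r = (\<Sum>i=1..l. of_int (x (i, r)) *\<^sub>R \<alpha> i)"

definition isotropic_part :: "(nat \<times> nat \<Rightarrow> int) \<Rightarrow> (nat \<times> nat \<Rightarrow> int) \<Rightarrow> nat \<Rightarrow> nat \<Rightarrow> real" where
  "isotropic_part x m r s =
     (if r < s then of_int (m (r, s))
      else if r = s then form (root_part x r) (root_part x r) / 2
      else form (root_part x r) (root_part x s) - of_int (m (s, r)))"

definition heis_shift :: "(nat \<times> nat \<Rightarrow> int) \<times> (nat \<times> nat \<Rightarrow> int) \<Rightarrow> 'v hyper \<Rightarrow> 'v" where
  "heis_shift g u =
     (\<Sum>r=1..\<nu>. pairing (root_part (fst g) r) u *\<^sub>R \<sigma> r)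
     - (\<Sum>r=1..\<nu>. pairing (\<sigma> r) u *\<^sub>R root_part (fst g) r)
     - (\<Sum>r=1..\<nu>. \<Sum>s=1..\<nu>. (isotropic_part (fst g) (snd g) r s * pairing (\<sigma> r) u) *\<^sub>R \<sigma> s)"

definition heis_map :: "(nat \<times> nat \<Rightarrow> int) \<times> (nat \<times> nat \<Rightarrow> int) \<Rightarrow> 'v hyper \<Rightarrow> 'v hyper" where
  "heis_map g = (\<lambda>u\<in>U. u + (heis_shift g u, 0))"

lemma root_part_add: "root_part (\<lambda>p. x p + y p) r = root_part x r + root_part y r"
  by (simp add: root_part_def scaleR_add_left sum.distrib)

lemma root_part_in_Vd: "root_part x r \<in> Vd"
  unfolding root_part_def using simple_in_Vd by (intro subspace_sum[OF subspace_Vd] subspace_scale[OF subspace_Vd]) auto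

lemma cocycle_form:
  assumes "r < s"
  shows "of_int (heis_cocycle l gram x y (r, s)) = form (root_part x s) (root_part y r)"
proof -
  have "form (root_part x s) (root_part y r)
      = (\<Sum>i=1..l. \<Sum>j=1..l. of_int (x (i, s)) * (of_int (y (j, r)) * form (\<alpha> i) (\<alpha> j)))"
    by (simp add: root_part_def form_sum_left form_sum_right sum_distrib_left)
      (subst sum.swap, simp add: mult.left_commute)
  also have "\<dots> = (\<Sum>i=1..l. \<Sum>j=1..l. of_int (gram i j * x (i, s) * y (j, r)))"
    by (intro sum.cong) (auto simp: gram)
  also have "\<dots> = of_int (heis_cocycle l gram x y (r, s))"
    using assms by (simp add: heis_cocycle_def)
  finally show ?thesis by simp
qed

text \<open>The twist of the group law of coordinates is the one that composition of maps produces, above,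
  on and below the diagonal alike.\<close>

lemma isotropic_part_mult:
  "isotropic_part (\<lambda>p. x p + y p) (\<lambda>p. m p + k p + heis_cocycle l gram x y p) r s
     = isotropic_part x m r s + isotropic_part y k r s + form (root_part x s) (root_part y r)"
  using form_sym[of "root_part x s" "root_part y r"] form_sym[of "root_part x r" "root_part y s"]
    form_sym[of "root_part x s" "root_part y s"]
  by (auto simp: isotropic_part_def root_part_add cocycle_form field_simps)

lemma heis_shift_add: "heis_shift g (u + u') = heis_shift g u + heis_shift g u'"
  by (simp add: heis_shift_def sum.distrib algebra_simps)

lemma heis_shift_scale: "heis_shift g (c *\<^sub>R u) = c *\<^sub>R heis_shift g u"
  by (simp add: heis_shift_def scaleR_sum_right algebra_simps)

lemma heis_shift_mult:
  "heis_shift (g \<otimes>\<^bsub>heis\<^esub> h) u = heis_shift h u + heis_shift g (u + (heis_shift h u, 0))"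
proof -
  obtain x m where g: "g = (x, m)" by force
  obtain y k where h: "h = (y, k)" by force
  have rad: "form (root_part x r) (heis_shift h u) = - (\<Sum>s=1..\<nu>. pairing (\<sigma> s) u * form (root_part x r) (root_part y s))" for r
    using \<sigma>_in_V0 by (simp add: heis_shift_def form_sum_right h)
  have \<sigma>0: "form (\<sigma> r) v = 0" if "r \<in> {1..\<nu>}" for r v using \<sigma>_in_V0[OF that] by simp
  have eq: "heis_shift g (u + (heis_shift h u, 0)) = heis_shift g u
      - (\<Sum>r=1..\<nu>. \<Sum>s=1..\<nu>. (pairing (\<sigma> s) u * form (root_part x r) (root_part y s)) *\<^sub>R \<sigma> r)"
  proof -
    have "heis_shift g (heis_shift h u, 0)
        = (\<Sum>r=1..\<nu>. form (root_part x r) (heis_shift h u) *\<^sub>R \<sigma> r)"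
      unfolding heis_shift_def[of g] using \<sigma>0 by (simp add: g)
    then show ?thesis
      by (simp add: heis_shift_add rad scaleR_sum_left sum_negf)
  qed
  have "(\<Sum>r=1..\<nu>. \<Sum>s=1..\<nu>. (pairing (\<sigma> s) u * form (root_part x r) (root_part y s)) *\<^sub>R \<sigma> r)
      = (\<Sum>s=1..\<nu>. \<Sum>r=1..\<nu>. (form (root_part x r) (root_part y s) * pairing (\<sigma> s) u) *\<^sub>R \<sigma> r)"
    by (subst sum.swap) (simp add: mult.commute)
  then show ?thesis
    unfolding eq
    by (simp add: g h heis_shift_def root_part_add isotropic_part_mult) (simp add: sum.distrib algebra_simps)
qed

lemma heis_shift_one: "heis_shift \<one>\<^bsub>heis\<^esub> u = 0"
proof -
  have "root_part (\<lambda>_. 0) r = 0" for r by (simp add: root_part_def)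
  moreover from this have "isotropic_part (\<lambda>_. 0) (\<lambda>_. 0) r s = 0" for r s
    by (auto simp: isotropic_part_def)
  ultimately show ?thesis by (simp add: heis_shift_def heis_coords_one)
qed

lemma heis_map_in_U: "u \<in> U \<Longrightarrow> heis_map g u \<in> U"
  by (simp add: heis_map_def U_closed)

lemma heis_map_mult: "u \<in> U \<Longrightarrow> heis_map (g \<otimes>\<^bsub>heis\<^esub> h) u = heis_map g (heis_map h u)"
  by (simp add: heis_map_def U_closed heis_shift_mult)

lemma heis_map_one: "heis_map \<one>\<^bsub>heis\<^esub> = \<one>\<^bsub>GL U\<^esub>"
  by (auto simp: heis_map_def heis_shift_one GL_one zero_prod_def[symmetric])

lemma heis_map_in_GL: "heis_map g \<in> carrier (GL U)"
proof -
  let ?i = "inv\<^bsub>heis\<^esub> g"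
  have "heis_map ?i (heis_map g u) = u" "heis_map g (heis_map ?i u) = u" if "u \<in> U" for u
    using heis_map_mult[OF that, of ?i g] heis_map_mult[OF that, of g ?i] that
    by (simp_all add: heis_map_one GL_one)
  then have "bij_betw (heis_map g) U U"
    using heis_map_in_U by (intro bij_betw_byWitness[where f' = "heis_map ?i"]) blast+
  moreover have "heis_map g (u + u') = heis_map g u + heis_map g u'" if "u \<in> U" "u' \<in> U" for u u'
    using that by (simp add: heis_map_def U_closed heis_shift_add algebra_simps)
  moreover have "heis_map g (c *\<^sub>R u) = c *\<^sub>R heis_map g u" if "u \<in> U" for c u
    using that by (simp add: heis_map_def U_closed heis_shift_scale algebra_simps)
  moreover have "heis_map g \<in> extensional U" by (simp add: heis_map_def)
  ultimately show ?thesis by (simp add: GL_def Bij_def)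
qed

lemma heis_map_hom: "heis_map \<in> hom heis (GL U)"
proof (rule homI)
  fix g h
  show "heis_map (g \<otimes>\<^bsub>heis\<^esub> h) = heis_map g \<cdot> heis_map h"
    unfolding GL_mult[OF heis_map_in_GL heis_map_in_GL]
  proof
    show "heis_map (g \<otimes>\<^bsub>heis\<^esub> h) u = compose U (heis_map g) (heis_map h) u" for u
      using heis_map_mult[of u g h] by (cases "u \<in> U") (auto simp: compose_def heis_map_def)
  qed
qed (rule heis_map_in_GL)

sublocale heis_map: group_hom heis "GL U" heis_map
  using heis_map_hom by unfold_locales

text \<open>Vectors of \<open>V\<close> detect the root parts, since the form is positive definite on the complement of
  the radical; the dual basis of the radical detects the central entries.\<close>

lemma heis_map_kernel:
  assumes "heis_map g = \<one>\<^bsub>GL U\<^esub>"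
  shows "\<lbrakk>i \<in> {1..l}; r \<in> {1..\<nu>}\<rbrakk> \<Longrightarrow> fst g (i, r) = 0"
    and "\<lbrakk>1 \<le> r; r < s; s \<le> \<nu>\<rbrakk> \<Longrightarrow> snd g (r, s) = 0"
proof -
  obtain x m where g: "g = (x, m)" by force
  have shift: "heis_shift g u = 0" if "u \<in> U" for u
  proof -
    have "heis_map g u = u" using assms that by (simp add: GL_one)
    then show ?thesis using that by (simp add: heis_map_def zero_prod_def)
  qed
  have root: "root_part x r = 0" if r: "r \<in> {1..\<nu>}" for r
  proof -
    have "heis_shift g (v, 0) = (\<Sum>r=1..\<nu>. form (root_part x r) v *\<^sub>R \<sigma> r)" for v
      using \<sigma>_in_V0 by (simp add: heis_shift_def g)
    then have "(\<Sum>r=1..\<nu>. form (root_part x r) v *\<^sub>R \<sigma> r) = (\<Sum>r=1..\<nu>. 0 *\<^sub>R \<sigma> r)" for v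
      using shift[of "(v, 0)"] by simp
    then have "form (root_part x r) v = 0" for v by (rule \<sigma>_eqD) (rule r)
    then show ?thesis using form_pos[OF root_part_in_Vd, of x r] by force
  qed
  show "fst g (i, r) = 0" if "i \<in> {1..l}" "r \<in> {1..\<nu>}" for i r
  proof -
    have "(\<Sum>i=1..l. of_int (x (i, r)) *\<^sub>R \<alpha> i) = (\<Sum>i=1..l. 0 *\<^sub>R \<alpha> i)"
      using root[OF that(2)] by (simp add: root_part_def)
    then have "real_of_int (x (i, r)) = 0" by (rule \<alpha>_eqD) (rule that(1))
    then show ?thesis by (simp add: g)
  qed
  show "snd g (r, s) = 0" if rs: "1 \<le> r" "r < s" "s \<le> \<nu>" for r s
  proof -
    have r: "r \<in> {1..\<nu>}" and s: "s \<in> {1..\<nu>}" using rs by auto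
    obtain \<phi> where \<phi>: "(0, \<phi>) \<in> U" "\<And>s. s \<in> {1..\<nu>} \<Longrightarrow> blinfun_apply \<phi> (\<sigma> s) = (if s = r then 1 else 0)"
      using dual_functional[OF r] by blast
    have "heis_shift g (0, \<phi>)
       = - (\<Sum>r'=1..\<nu>. \<Sum>s=1..\<nu>. (isotropic_part x m r' s * pairing (\<sigma> r') (0, \<phi>)) *\<^sub>R \<sigma> s)"
      using root by (simp add: heis_shift_def g)
    also have "(\<Sum>r'=1..\<nu>. \<Sum>s=1..\<nu>. (isotropic_part x m r' s * pairing (\<sigma> r') (0, \<phi>)) *\<^sub>R \<sigma> s)
       = (\<Sum>r'=1..\<nu>. if r' = r then \<Sum>s=1..\<nu>. isotropic_part x m r s *\<^sub>R \<sigma> s else 0)"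
      using \<phi>(2) by (intro sum.cong) (auto simp: pairing_def)
    also have "\<dots> = (\<Sum>s=1..\<nu>. isotropic_part x m r s *\<^sub>R \<sigma> s)" using r by simp
    finally have "(\<Sum>s=1..\<nu>. isotropic_part x m r s *\<^sub>R \<sigma> s) = (\<Sum>s=1..\<nu>. 0 *\<^sub>R \<sigma> s)"
      using shift[OF \<phi>(1)] by simp
    then have "isotropic_part x m r s = 0" by (rule \<sigma>_eqD) (rule s)
    then show ?thesis using rs by (simp add: isotropic_part_def g)
  qed
qed

lemma c_elt_coords:
  assumes "1 \<le> r" "r < s" "s \<le> \<nu>"
  shows "c_rs r s = heis_map (\<lambda>_. 0, \<lambda>p. - unit_at (r, s) p)"
proof
  fix u
  have r: "r \<in> {1..\<nu>}" and s: "s \<in> {1..\<nu>}" using assms by auto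
  have root0: "root_part (\<lambda>_. 0) r = 0" for r by (simp add: root_part_def)
  have "heis_shift (\<lambda>_. 0, \<lambda>p. - unit_at (r, s) p) u
      = - (\<Sum>r'=1..\<nu>. \<Sum>s'=1..\<nu>. (isotropic_part (\<lambda>_. 0) (\<lambda>p. - unit_at (r, s) p) r' s' * pairing (\<sigma> r') u) *\<^sub>R \<sigma> s')"
    by (simp add: heis_shift_def root0)
  also have "(\<Sum>r'=1..\<nu>. \<Sum>s'=1..\<nu>. (isotropic_part (\<lambda>_. 0) (\<lambda>p. - unit_at (r, s) p) r' s' * pairing (\<sigma> r') u) *\<^sub>R \<sigma> s')
      = (\<Sum>r'=1..\<nu>. \<Sum>s'=1..\<nu>. (if r' = s then if s' = r then pairing (\<sigma> s) u *\<^sub>R \<sigma> r else 0 else 0)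
          - (if r' = r then if s' = s then pairing (\<sigma> r) u *\<^sub>R \<sigma> s else 0 else 0))"
    using assms(2) by (intro sum.cong) (auto simp: isotropic_part_def unit_at_def root0)
  also have "\<dots> = (\<Sum>r'=1..\<nu>. (if r' = s then pairing (\<sigma> s) u *\<^sub>R \<sigma> r else 0)
          - (if r' = r then pairing (\<sigma> r) u *\<^sub>R \<sigma> s else 0))"
    using r s by (intro sum.cong) (auto simp: sum_subtractf)
  also have "\<dots> = pairing (\<sigma> s) u *\<^sub>R \<sigma> r - pairing (\<sigma> r) u *\<^sub>R \<sigma> s"
    using r s by (simp add: sum_subtractf)
  finally have shift: "heis_shift (\<lambda>_. 0, \<lambda>p. - unit_at (r, s) p) u = pairing (\<sigma> r) u *\<^sub>R \<sigma> s - pairing (\<sigma> s) u *\<^sub>R \<sigma> r"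
    by simp
  show "c_rs r s u = heis_map (\<lambda>_. 0, \<lambda>p. - unit_at (r, s) p) u"
    using \<sigma>_in_V0[OF r]
    by (cases "u \<in> U") (simp_all add: c_elt_def T_map_def heis_map_def shift hyper_form_pairing prod_eq_iff)
qed

text \<open>The product of the reflections in \<open>\<beta> + q\<close> and \<open>\<beta>\<close>, for a root \<open>\<beta>\<close> with coefficients \<open>k\<close> and a
  lattice vector \<open>q\<close> with coefficients \<open>c\<close>, is a transvection and has these coordinates. The off-diagonal
  entry \<open>c r * c s\<close> is half of \<open>form (root_part x r) (root_part x s)\<close> because roots have norm \<open>2\<close>.\<close>

definition transvection_coords :: "(nat \<Rightarrow> int) \<Rightarrow> (nat \<Rightarrow> int) \<Rightarrow> (nat \<times> nat \<Rightarrow> int) \<times> (nat \<times> nat \<Rightarrow> int)" where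
  "transvection_coords k c =
     (\<lambda>(i, r). if i \<in> {1..l} \<and> r \<in> {1..\<nu>} then k i * c r else 0,
      \<lambda>(r, s). if 1 \<le> r \<and> r < s \<and> s \<le> \<nu> then c r * c s else 0)"

lemma refl_w_apply:
  assumes "form \<beta> \<beta> = 2" "u \<in> U"
  shows "reflection \<beta> u = u - pairing \<beta> u *\<^sub>R (\<beta>, 0)"
proof -
  have "coroot form \<beta> = \<beta>" using assms(1) by (simp add: coroot_def)
  then show ?thesis using assms(2) by (simp add: refl_w_def hyper_form_pairing)
qed

lemma refl_w_involution:
  assumes "form \<beta> \<beta> = 2" "u \<in> U"
  shows "reflection \<beta> u \<in> U" "reflection \<beta> (reflection \<beta> u) = u"
proof -
  show *: "reflection \<beta> u \<in> U" using assms by (simp add: refl_w_apply U_closed)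
  show "reflection \<beta> (reflection \<beta> u) = u"
    unfolding refl_w_apply[OF assms(1) *] unfolding refl_w_apply[OF assms] using assms(1)
    by (simp add: algebra_simps flip: scaleR_left.add) (simp add: prod_eq_iff scaleR_2 algebra_simps)
qed

lemma refl_w_in_GL:
  assumes "form \<beta> \<beta> = 2"
  shows "reflection \<beta> \<in> carrier (GL U)"
proof -
  have "bij_betw (reflection \<beta>) U U"
    using refl_w_involution[OF assms] by (intro bij_betw_byWitness[where f' = "reflection \<beta>"]) blast+
  moreover have "reflection \<beta> (u + u') = reflection \<beta> u + reflection \<beta> u'" if "u \<in> U" "u' \<in> U" for u u'
    using that by (simp add: refl_w_apply[OF assms] U_closed algebra_simps)
  moreover have "reflection \<beta> (c *\<^sub>R u) = c *\<^sub>R reflection \<beta> u" if "u \<in> U" for c u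
    using that by (simp add: refl_w_apply[OF assms] U_closed algebra_simps)
  moreover have "reflection \<beta> \<in> extensional U" by (simp add: refl_w_def)
  ultimately show ?thesis by (simp add: GL_def Bij_def)
qed

lemma refl_product_coords:
  assumes \<beta>: "\<beta> \<in> \<Phi>" "\<beta> \<noteq> 0" "\<beta> = (\<Sum>i=1..l. of_int (k i) *\<^sub>R \<alpha> i)"
    and q: "q = (\<Sum>r=1..\<nu>. of_int (c r) *\<^sub>R \<sigma> r)"
  shows "reflection (\<beta> + q) \<cdot> reflection \<beta> = heis_map (transvection_coords k c)"
proof
  fix u
  have q0: "q \<in> V0" using sum_in_\<Lambda>[of c] \<Lambda>_subset q by auto
  have n1: "form \<beta> \<beta> = 2" by (rule root_norm[OF \<beta>(1,2)])
  then have n2: "form (\<beta> + q) (\<beta> + q) = 2" using q0 by simp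
  let ?g = "transvection_coords k c"
  have root: "root_part (fst ?g) r = of_int (c r) *\<^sub>R \<beta>" if "r \<in> {1..\<nu>}" for r
    using that unfolding \<beta>(3)
    by (simp add: root_part_def transvection_coords_def scaleR_sum_right mult.commute)
  have iso: "isotropic_part (fst ?g) (snd ?g) r s = of_int (c r) * of_int (c s)"
    if "r \<in> {1..\<nu>}" "s \<in> {1..\<nu>}" for r s
    using that n1 by (auto simp: isotropic_part_def root) (auto simp: transvection_coords_def)
  show "(reflection (\<beta> + q) \<cdot> reflection \<beta>) u = heis_map ?g u"
  proof (cases "u \<in> U")
    case True
    have "heis_shift ?g u = (\<Sum>r=1..\<nu>. (of_int (c r) * pairing \<beta> u) *\<^sub>R \<sigma> r)
        - (\<Sum>r=1..\<nu>. pairing (\<sigma> r) u *\<^sub>R of_int (c r) *\<^sub>R \<beta>)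
        - (\<Sum>r=1..\<nu>. \<Sum>s=1..\<nu>. (of_int (c r) * of_int (c s) * pairing (\<sigma> r) u) *\<^sub>R \<sigma> s)"
      unfolding heis_shift_def using root iso by simp
    also have "(\<Sum>r=1..\<nu>. (of_int (c r) * pairing \<beta> u) *\<^sub>R \<sigma> r) = pairing \<beta> u *\<^sub>R q"
      unfolding q by (simp add: scaleR_sum_right mult.commute)
    also have "(\<Sum>r=1..\<nu>. pairing (\<sigma> r) u *\<^sub>R of_int (c r) *\<^sub>R \<beta>) = pairing q u *\<^sub>R \<beta>"
      unfolding q by (simp add: pairing_sum scaleR_sum_left mult.commute)
    also have "(\<Sum>r=1..\<nu>. \<Sum>s=1..\<nu>. (of_int (c r) * of_int (c s) * pairing (\<sigma> r) u) *\<^sub>R \<sigma> s) = pairing q u *\<^sub>R q"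
      unfolding q by (simp add: pairing_sum scaleR_sum_left scaleR_sum_right mult_ac)
        (subst sum.swap, simp add: sum_distrib_left scaleR_sum_left mult_ac)
    finally have shift: "heis_shift ?g u = pairing \<beta> u *\<^sub>R q - pairing q u *\<^sub>R \<beta> - pairing q u *\<^sub>R q" .
    have "(reflection (\<beta> + q) \<cdot> reflection \<beta>) u
        = reflection (\<beta> + q) (reflection \<beta> u)"
      using True unfolding GL_mult[OF refl_w_in_GL[OF n2] refl_w_in_GL[OF n1]] by (simp add: compose_def)
    also have "\<dots> = reflection \<beta> u - pairing (\<beta> + q) (reflection \<beta> u) *\<^sub>R (\<beta> + q, 0)"
      by (rule refl_w_apply[OF n2 refl_w_involution(1)[OF n1 True]])
    also have "pairing (\<beta> + q) (reflection \<beta> u) = pairing q u - pairing \<beta> u"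
      unfolding refl_w_apply[OF n1 True] using n1 q0 by simp
    also have "reflection \<beta> u - (pairing q u - pairing \<beta> u) *\<^sub>R (\<beta> + q, 0) = heis_map ?g u"
      unfolding refl_w_apply[OF n1 True] using True
      by (simp add: heis_map_def shift prod_eq_iff algebra_simps)
    finally show ?thesis .
  next
    case False
    then show ?thesis
      unfolding GL_mult[OF refl_w_in_GL[OF n2] refl_w_in_GL[OF n1]] by (simp add: compose_def heis_map_def)
  qed
qed


definition pairs :: "(nat \<times> nat) set" where
  "pairs = {(r, s). 1 \<le> r \<and> r < s \<and> s \<le> \<nu>}"

lemma finite_pairs: "finite pairs"
proof -
  have "pairs \<subseteq> {1..\<nu>} \<times> {1..\<nu>}" unfolding pairs_def by auto
  then show ?thesis by (rule finite_subset) auto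
qed

lemma heis_map_cong:
  assumes x: "\<And>i r. \<lbrakk>i \<in> {1..l}; r \<in> {1..\<nu>}\<rbrakk> \<Longrightarrow> x (i, r) = y (i, r)"
    and m: "\<And>p. p \<in> pairs \<Longrightarrow> m p = k p"
  shows "heis_map (x, m) = heis_map (y, k)"
proof -
  have root: "root_part x r = root_part y r" if "r \<in> {1..\<nu>}" for r
    unfolding root_part_def using x that by (intro sum.cong) auto
  have iso: "isotropic_part x m r s = isotropic_part y k r s" if "r \<in> {1..\<nu>}" "s \<in> {1..\<nu>}" for r s
    using that m[of "(r, s)"] m[of "(s, r)"] root[OF that(1)] root[OF that(2)]
    by (auto simp: isotropic_part_def pairs_def)
  have "heis_shift (x, m) u = heis_shift (y, k) u" for u
    unfolding heis_shift_def using root iso by simp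
  then show ?thesis by (simp add: heis_map_def)
qed

section \<open>The central part\<close>

definition central :: "(nat \<times> nat \<Rightarrow> int) \<Rightarrow> 'v hyper \<Rightarrow> 'v hyper" where
  "central m = heis_map (\<lambda>_. 0, m)"

lemma central_in_GL: "central m \<in> carrier (GL U)"
  by (simp add: central_def heis_map_in_GL)

lemma central_mult: "central m \<cdot> central k = central (\<lambda>p. m p + k p)"
  unfolding central_def by (simp flip: heis_map.hom_mult)

lemma central_zero: "central (\<lambda>_. 0) = \<one>\<^bsub>GL U\<^esub>"
  using heis_map_one by (simp add: central_def heis_coords_one)

lemma central_inv: "inv\<^bsub>GL U\<^esub> central m = central (\<lambda>p. - m p)"
  by (rule GL.inv_equality) (simp_all add: central_mult central_zero central_in_GL)

lemma central_pow: "central m [^]\<^bsub>GL U\<^esub> (j :: nat) = central (\<lambda>p. int j * m p)"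
  by (induction j) (auto simp: central_mult central_zero algebra_simps)

lemma central_cong: "(\<And>p. p \<in> pairs \<Longrightarrow> m p = k p) \<Longrightarrow> central m = central k"
  unfolding central_def by (rule heis_map_cong) auto

lemma central_eqD:
  assumes "central m = central k" "p \<in> pairs"
  shows "m p = k p"
proof -
  have "central (\<lambda>p. m p - k p) = central m \<cdot> inv\<^bsub>GL U\<^esub> central k"
    by (simp add: central_inv central_mult)
  also have "\<dots> = \<one>\<^bsub>GL U\<^esub>" using assms(1) by (simp add: central_in_GL)
  finally have "heis_map (\<lambda>_. 0, \<lambda>p. m p - k p) = \<one>\<^bsub>GL U\<^esub>" by (simp add: central_def)
  from heis_map_kernel(2)[OF this, of "fst p" "snd p"] show ?thesis
    using assms(2) by (auto simp: pairs_def)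
qed

lemma c_elt_central: "(r, s) \<in> pairs \<Longrightarrow> c_rs r s = central (\<lambda>p. - unit_at (r, s) p)"
  using c_elt_coords by (simp add: pairs_def central_def)

lemma c_elt_pow:
  assumes "(r, s) \<in> pairs"
  shows "c_rs r s [^]\<^bsub>GL U\<^esub> (j :: nat) = central (\<lambda>p. - int j * unit_at (r, s) p)"
  using central_pow[of "\<lambda>p. - unit_at (r, s) p" j] by (simp add: c_elt_central[OF assms])

lemma subgroup_central:
  "subgroup {central m | m. \<forall>(r, s) \<in> pairs. int (N r s) dvd m (r, s)} (GL U)" (is "subgroup ?K _")
proof (rule GL.subgroupI)
  show "?K \<subseteq> carrier (GL U)" using central_in_GL by auto
  have "central (\<lambda>_. 0) \<in> ?K" by auto
  then show "?K \<noteq> {}" by blast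
  show "inv\<^bsub>GL U\<^esub> g \<in> ?K" if "g \<in> ?K" for g
  proof -
    obtain m where "g = central m" "\<forall>(r, s) \<in> pairs. int (N r s) dvd m (r, s)" using \<open>g \<in> ?K\<close> by blast
    then show ?thesis by (auto simp: central_inv intro!: exI[of _ "\<lambda>p. - m p"])
  qed
  show "g \<cdot> h \<in> ?K" if "g \<in> ?K" "h \<in> ?K" for g h
  proof -
    obtain m where "g = central m" "\<forall>(r, s) \<in> pairs. int (N r s) dvd m (r, s)" using \<open>g \<in> ?K\<close> by blast
    moreover obtain k where "h = central k" "\<forall>(r, s) \<in> pairs. int (N r s) dvd k (r, s)" using \<open>h \<in> ?K\<close> by blast
    ultimately show ?thesis by (fastforce simp: central_mult intro!: exI[of _ "\<lambda>p. m p + k p"] dvd_add)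
  qed
qed

lemma central_span:
  assumes K: "subgroup K (GL U)"
    and gen: "\<And>r s. (r, s) \<in> pairs \<Longrightarrow> c_rs r s [^]\<^bsub>GL U\<^esub> N r s \<in> K"
    and m: "\<And>r s. (r, s) \<in> pairs \<Longrightarrow> int (N r s) dvd m (r, s)"
  shows "central m \<in> K"
proof -
  define m' where "m' p = (if p \<in> pairs then m p else 0)" for p
  have "central m' \<in> K"
    using finite_pairs
  proof (induction rule: integer_combination_induct[where c = "\<lambda>(r, s). - int (N r s)"])
    case zero
    then show ?case using subgroup.one_closed[OF K] by (simp add: central_zero)
  next
    case (add f g)
    then show ?case using subgroup.m_closed[OF K] central_mult by metis
  next
    case (minus f)
    then show ?case using subgroup.m_inv_closed[OF K] central_inv by metis
  next
    case (unit p)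
    then show ?case using gen[of "fst p" "snd p"] c_elt_pow[of "fst p" "snd p"] by (simp add: case_prod_unfold)
  qed (use m in \<open>auto simp: m'_def\<close>)
  moreover have "central m' = central m" by (rule central_cong) (simp add: m'_def)
  ultimately show ?thesis by simp
qed

abbreviation "C \<equiv> C_group form Vd \<sigma>"

abbreviation "c_gens \<equiv> {c_rs r s | r s. 1 \<le> r \<and> r < s \<and> s \<le> \<nu>}"

lemma c_gens_subset: "c_gens \<subseteq> carrier (GL U)"
  using c_elt_central central_in_GL by (auto simp: pairs_def)

lemma C_eq: "C = (GL U)\<lparr>carrier := range central\<rparr>"
proof -
  let ?D = "generate (GL U) c_gens"
  have D: "subgroup ?D (GL U)" by (rule GL.generate_is_subgroup[OF c_gens_subset])
  have "range central = {central m | m. \<forall>(r, s) \<in> pairs. int 1 dvd m (r, s)}" by auto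
  then have "subgroup (range central) (GL U)" using subgroup_central[of "\<lambda>_ _. 1"] by simp
  moreover have "c_gens \<subseteq> range central" using c_elt_central by (auto simp: pairs_def)
  ultimately have "?D \<subseteq> range central" by (intro GL.generate_subgroup_incl)
  moreover have "central m \<in> ?D" for m
  proof (rule central_span[OF D, where N = "\<lambda>_ _. 1"])
    fix r s assume rs: "(r, s) \<in> pairs"
    then have "c_rs r s \<in> c_gens" by (auto simp: pairs_def)
    moreover from this have "c_rs r s [^]\<^bsub>GL U\<^esub> (1 :: nat) = c_rs r s"
      by (simp only: c_elt_pow[OF rs]) (simp add: c_elt_central[OF rs])
    ultimately show "c_rs r s [^]\<^bsub>GL U\<^esub> (1 :: nat) \<in> ?D"
      by (simp only: generate.incl)
  qed auto
  ultimately have "?D = range central" by auto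
  then show ?thesis
    unfolding C_group_def subgroup_generated_def using c_gens_subset by (simp add: Int_absorb1)
qed

lemma subgroup_C: "subgroup (range central) (GL U)"
proof -
  have "range central = {central m | m. \<forall>(r, s) \<in> pairs. int 1 dvd m (r, s)}" by auto
  then show ?thesis using subgroup_central[of "\<lambda>_ _. 1"] by simp
qed

lemma C_simps [simp]: "carrier C = range central" "mult C = mult (GL U)" "one C = one (GL U)"
  by (simp_all add: C_eq)

sublocale C: comm_group C
proof -
  have "group C" unfolding C_eq by (rule GL.subgroup_imp_group[OF subgroup_C])
  then show "comm_group C"
    by (rule group.group_comm_groupI) (auto simp: central_mult add.commute)
qed

lemma C_pow: "x [^]\<^bsub>C\<^esub> (j :: nat) = x [^]\<^bsub>GL U\<^esub> j"
  by (simp add: C_eq nat_pow_def)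

lemma C_generate: "A \<subseteq> range central \<Longrightarrow> generate C A = generate (GL U) A"
  unfolding C_eq using GL.generate_consistent[OF _ subgroup_C] by simp

lemma finprod_c_elt:
  assumes "Q \<subseteq> pairs"
  shows "finprod C (\<lambda>(r, s). c_rs r s) Q = central (\<lambda>p. if p \<in> Q then - 1 else 0)"
  using finite_subset[OF assms finite_pairs] assms
proof (induction Q rule: finite_induct)
  case empty
  then show ?case by (simp add: central_zero)
next
  case (insert p Q)
  obtain r s where p: "p = (r, s)" by force
  have c: "(case q of (r, s) \<Rightarrow> c_rs r s) \<in> range central" if "q \<in> pairs" for q
    using that c_elt_central by (auto split: prod.split)
  have "finprod C (\<lambda>(r, s). c_rs r s) (insert p Q)
      = (case p of (r, s) \<Rightarrow> c_rs r s) \<otimes>\<^bsub>C\<^esub> finprod C (\<lambda>(r, s). c_rs r s) Q"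
    using insert c by (intro C.finprod_insert) (auto simp del: C_simps(2,3))
  also have "\<dots> = central (\<lambda>q. - unit_at (r, s) q + (if q \<in> Q then - 1 else 0))"
    using insert p by (simp add: c_elt_central central_mult)
  also have "(\<lambda>q. - unit_at (r, s) q + (if q \<in> Q then - 1 else 0)) = (\<lambda>q. if q \<in> insert p Q then - 1 else 0)"
    using insert.hyps p by (auto simp: unit_at_def)
  finally show ?case .
qed

abbreviation "SC \<equiv> supp_class \<nu> \<sigma> S"
abbreviation "F \<equiv> F_group form Vd S \<sigma>"
abbreviation "n \<equiv> n_exp form Vd S \<sigma>"

lemma z_elt_supp:
  assumes "J \<in> SC"
  shows "z_J J = central (\<lambda>(r, s). if r \<in> J \<and> s \<in> J \<and> r < s then - 1 else 0)"
proof -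
  have "{(r, s). r \<in> J \<and> s \<in> J \<and> r < s} \<subseteq> pairs"
    using supp_class_subset[OF assms] by (auto simp: pairs_def)
  from finprod_c_elt[OF this] show ?thesis
    using assms by (simp add: z_elt_def case_prod_unfold)
qed

lemma card_two_pairs:
  assumes "J \<subseteq> {1..\<nu>}" "card J = 2"
  obtains r s where "J = {r, s}" "(r, s) \<in> pairs" "Min J = r" "Max J = s"
proof -
  obtain a b where ab: "J = {a, b}" "a \<noteq> b" using assms(2) by (auto simp: card_2_iff)
  show ?thesis
  proof (cases "a < b")
    case True
    then show ?thesis using that[of a b] ab assms(1) by (auto simp: pairs_def)
  next
    case False
    then show ?thesis using that[of b a] ab assms(1) by (auto simp: pairs_def)
  qed
qed

lemma z_elt_pair:
  assumes "(r, s) \<in> pairs" "{r, s} \<notin> SC"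
  shows "z_J {r, s} = c_rs r s [^]\<^bsub>GL U\<^esub> (2 :: nat)"
  using assms by (auto simp: z_elt_def C_pow pairs_def)

lemma z_elt_pair_supp:
  assumes "(r, s) \<in> pairs" "{r, s} \<in> SC"
  shows "z_J {r, s} = c_rs r s"
  unfolding z_elt_supp[OF assms(2)] c_elt_central[OF assms(1)]
  using assms(1) by (intro central_cong) (auto simp: unit_at_def pairs_def split: if_splits)

lemma z_elt_cases:
  assumes "J \<subseteq> {1..\<nu>}"
  obtains "J \<in> SC"
  | r s where "(r, s) \<in> pairs" "J = {r, s}" "J \<notin> SC" "z_J J = c_rs r s [^]\<^bsub>GL U\<^esub> (2 :: nat)"
  | "z_J J = \<one>\<^bsub>GL U\<^esub>"
proof (cases "J \<in> SC")
  case False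
  show ?thesis
  proof (cases "card J = 2")
    case True
    then obtain r s where "J = {r, s}" "(r, s) \<in> pairs" using card_two_pairs[OF assms] by metis
    then show ?thesis using that(2) z_elt_pair False by metis
  next
    case card: False
    then show ?thesis using that(3) False by (simp add: z_elt_def)
  qed
qed (rule that(1))

lemma z_elt_central: "J \<subseteq> {1..\<nu>} \<Longrightarrow> z_J J \<in> range central"
proof (elim z_elt_cases)
  assume "z_J J = \<one>\<^bsub>GL U\<^esub>"
  then show ?thesis unfolding central_zero[symmetric] by simp
qed (auto simp: z_elt_supp c_elt_pow)

lemma F_eq: "F = generate (GL U) {z_J J | J. J \<subseteq> {1..\<nu>}}"
  unfolding F_group_def by (rule C_generate) (use z_elt_central in blast)

lemma subgroup_F: "subgroup F (GL U)"
proof -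
  have "range central \<subseteq> carrier (GL U)" using central_in_GL by auto
  moreover have "{z_J J | J. J \<subseteq> {1..\<nu>}} \<subseteq> range central" using z_elt_central by blast
  ultimately show ?thesis unfolding F_eq by (intro GL.generate_is_subgroup) (rule subset_trans)
qed

lemma z_elt_in_F: "J \<subseteq> {1..\<nu>} \<Longrightarrow> z_J J \<in> F"
  unfolding F_eq by (rule generate.incl) blast

lemma F_subset_subgroup:
  assumes K: "subgroup K (GL U)"
    and supp: "\<And>J. J \<in> SC \<Longrightarrow> z_J J \<in> K"
    and sq: "\<And>r s. \<lbrakk>(r, s) \<in> pairs; {r, s} \<notin> SC\<rbrakk> \<Longrightarrow> c_rs r s [^]\<^bsub>GL U\<^esub> (2 :: nat) \<in> K"
  shows "F \<subseteq> K"
  unfolding F_eq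
proof (rule GL.generate_subgroup_incl[OF _ K])
  have "z_J J \<in> K" if "J \<subseteq> {1..\<nu>}" for J
    using that
  proof (cases rule: z_elt_cases)
    case 1
    then show ?thesis by (rule supp)
  next
    case (2 r s)
    then show ?thesis using sq by metis
  next
    case 3
    then show ?thesis using subgroup.one_closed[OF K] by simp
  qed
  then show "{z_J J | J. J \<subseteq> {1..\<nu>}} \<subseteq> K" by blast
qed

lemma c_elt_supp_in_F: "\<lbrakk>(r, s) \<in> pairs; {r, s} \<in> SC\<rbrakk> \<Longrightarrow> c_rs r s \<in> F"
  by (metis z_elt_in_F z_elt_pair_supp supp_class_subset)

lemma c_elt_pow_one:
  assumes "(r, s) \<in> pairs"
  shows "c_rs r s [^]\<^bsub>GL U\<^esub> (1 :: nat) = c_rs r s"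
  by (simp only: c_elt_pow[OF assms]) (simp add: c_elt_central[OF assms])

lemma c_elt_square_in_F:
  assumes "(r, s) \<in> pairs"
  shows "c_rs r s [^]\<^bsub>GL U\<^esub> (2 :: nat) \<in> F"
proof (cases "{r, s} \<in> SC")
  case True
  then have c: "c_rs r s \<in> F" using assms c_elt_supp_in_F by simp
  have "c_rs r s \<in> carrier (GL U)" using assms c_elt_central central_in_GL by simp
  then show ?thesis using subgroup.m_closed[OF subgroup_F c c] by (simp add: numeral_2_eq_2)
next
  case False
  have "{r, s} \<subseteq> {1..\<nu>}" using assms by (auto simp: pairs_def)
  then show ?thesis using z_elt_in_F z_elt_pair[OF assms False] by metis
qed

lemma n_exp_properties:
  assumes "(r, s) \<in> pairs"
  shows "1 \<le> n r s" "c_rs r s [^]\<^bsub>GL U\<^esub> n r s \<in> F"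
    and "\<And>j. \<lbrakk>1 \<le> j; c_rs r s [^]\<^bsub>GL U\<^esub> (j :: nat) \<in> F\<rbrakk> \<Longrightarrow> n r s \<le> j"
proof -
  let ?P = "\<lambda>j. 1 \<le> j \<and> c_rs r s [^]\<^bsub>C\<^esub> (j :: nat) \<in> F"
  have n: "n r s = (LEAST j. ?P j)" by (simp add: n_exp_def)
  have "?P 2" using c_elt_square_in_F[OF assms] by (simp add: C_pow)
  then have "?P (n r s)" unfolding n by (rule LeastI)
  then show "1 \<le> n r s" "c_rs r s [^]\<^bsub>GL U\<^esub> n r s \<in> F" by (auto simp: C_pow)
  show "n r s \<le> j" if "1 \<le> j" "c_rs r s [^]\<^bsub>GL U\<^esub> j \<in> F" for j
    unfolding n by (rule Least_le) (use that in \<open>simp add: C_pow\<close>)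
qed

lemma n_supp:
  assumes "(r, s) \<in> pairs" "{r, s} \<in> SC"
  shows "n r s = 1"
proof -
  have "n r s \<le> 1"
    by (rule n_exp_properties(3)[OF assms(1) order_refl])
      (simp only: c_elt_pow_one[OF assms(1)] c_elt_supp_in_F[OF assms])
  then show ?thesis using n_exp_properties(1)[OF assms(1)] by simp
qed

abbreviation "c_powers \<equiv> {c_rs r s [^]\<^bsub>C\<^esub> n r s | r s. 1 \<le> r \<and> r < s \<and> s \<le> \<nu>}"

lemma c_powers_subset: "c_powers \<subseteq> range central"
  using c_elt_pow by (auto simp: C_pow pairs_def)

lemma generated_by_powers_iff: "F_generated_by_powers form Vd S \<sigma> \<longleftrightarrow> F = generate (GL U) c_powers"
  unfolding F_generated_by_powers_def C_generate[OF c_powers_subset] ..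

lemma generate_c_powers_subset: "generate (GL U) c_powers \<subseteq> F"
  using n_exp_properties(2) by (intro GL.generate_subgroup_incl[OF _ subgroup_F]) (auto simp: C_pow pairs_def)

text \<open>This covers lattices and all supporting classes representing the ranks up to three. If with a
  set also its two-element subsets belong to the supporting class, then each
  \<open>z_elt\<close> is a product of elements \<open>c_elt\<close> and squares of these, so that the generators decouple.\<close>

lemma pair_closed_F:
  assumes closed: "\<And>J r s. \<lbrakk>J \<in> SC; r \<in> J; s \<in> J; r < s\<rbrakk> \<Longrightarrow> {r, s} \<in> SC"
  shows "F_generated_by_powers form Vd S \<sigma>"
    and "\<And>r s. (r, s) \<in> pairs \<Longrightarrow> n r s = (if {r, s} \<in> SC then 1 else 2)"
proof -
  define N where "N r s = (if {r, s} \<in> SC then 1 else 2 :: nat)" for r s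
  let ?K = "{central m | m. \<forall>(r, s) \<in> pairs. int (N r s) dvd m (r, s)}"
  have FK: "F \<subseteq> ?K"
  proof (rule F_subset_subgroup[OF subgroup_central])
    show "z_J J \<in> ?K" if J: "J \<in> SC" for J
      unfolding z_elt_supp[OF J] using closed[OF J]
      by (intro CollectI exI conjI refl) (auto simp: N_def)
    show "c_rs r s [^]\<^bsub>GL U\<^esub> (2 :: nat) \<in> ?K" if "(r, s) \<in> pairs" "{r, s} \<notin> SC" for r s
      unfolding c_elt_pow[OF that(1)]
      by (intro CollectI exI conjI refl) (auto simp: N_def)
  qed
  \<comment> \<open>squares are always available, so the exponent is \<open>1\<close> or \<open>2\<close>, and parity decides\<close>
  have nN: "n r s = N r s" if rs: "(r, s) \<in> pairs" for r s
  proof (cases "{r, s} \<in> SC")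
    case True
    then show ?thesis using n_supp[OF rs] by (simp add: N_def)
  next
    case False
    obtain m where m: "central (\<lambda>p. - int (n r s) * unit_at (r, s) p) = central m"
        "\<forall>(r, s) \<in> pairs. int (N r s) dvd m (r, s)"
      using n_exp_properties(2)[OF rs] FK unfolding c_elt_pow[OF rs] by blast
    have "int (N r s) dvd - int (n r s)"
      using m(2) central_eqD[OF m(1) rs] rs by (auto simp: unit_at_def)
    then have "2 dvd n r s" using False by (simp add: N_def)
    then have "2 \<le> n r s" using n_exp_properties(1)[OF rs] by (auto dest: dvd_imp_le)
    moreover have "n r s \<le> 2" using n_exp_properties(3)[OF rs, of 2] c_elt_square_in_F[OF rs] by simp
    ultimately show ?thesis using False by (simp add: N_def)
  qed
  then show "n r s = (if {r, s} \<in> SC then 1 else 2)" if "(r, s) \<in> pairs" for r s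
    using that by (simp add: N_def)
  have K: "subgroup (generate (GL U) c_powers) (GL U)"
    by (rule GL.generate_is_subgroup, rule subset_trans[OF c_powers_subset]) (use central_in_GL in auto)
  have "central m \<in> generate (GL U) c_powers" if "\<forall>(r, s) \<in> pairs. int (N r s) dvd m (r, s)" for m
  proof (rule central_span[OF K, where N = n])
    show "c_rs r s [^]\<^bsub>GL U\<^esub> n r s \<in> generate (GL U) c_powers" if "(r, s) \<in> pairs" for r s
      using that by (intro generate.incl) (auto simp: C_pow pairs_def)
    show "int (n r s) dvd m (r, s)" if "(r, s) \<in> pairs" for r s
      using that nN \<open>\<forall>(r, s) \<in> pairs. int (N r s) dvd m (r, s)\<close> by auto
  qed
  then have "?K \<subseteq> generate (GL U) c_powers" by blast
  with FK have "F \<subseteq> generate (GL U) c_powers" by (rule subset_trans)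
  then show "F_generated_by_powers form Vd S \<sigma>"
    unfolding generated_by_powers_iff using generate_c_powers_subset by (rule subset_antisym)
qed

lemma lattice_supp_class:
  assumes "l > 1" "J \<subseteq> {1..\<nu>}"
  shows "J \<in> SC"
proof -
  have "finite J" using assms(2) by (rule finite_subset) auto
  then have "(\<Sum>r\<in>J. \<sigma> r) \<in> S" using assms(2)
  proof (induction J rule: finite_induct)
    case empty
    then show ?case using zero_in_S by simp
  next
    case (insert r J)
    then show ?case using lattice[OF assms(1)] \<sigma>_in_S by (auto simp: lattice_in_def)
  qed
  then show ?thesis using in_supp_class_iff[OF assms(2)] by simp
qed

lemma lattice_F:
  assumes "l > 1"
  shows "F_generated_by_powers form Vd S \<sigma>" "\<And>r s. (r, s) \<in> pairs \<Longrightarrow> n r s = 1"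
proof -
  show "F_generated_by_powers form Vd S \<sigma>"
  proof (rule pair_closed_F)
    show "{r, s} \<in> SC" if "J \<in> SC" "r \<in> J" "s \<in> J" for J r s
      using that supp_class_subset by (intro lattice_supp_class[OF assms]) blast
  qed
  show "n r s = 1" if "(r, s) \<in> pairs" for r s
    by (rule n_supp[OF that], rule lattice_supp_class[OF assms]) (use that in \<open>auto simp: pairs_def\<close>)
qed

section \<open>The presentation\<close>

lemma l_pos: "1 \<le> l"
proof -
  have "valid_type X" using root_system by (simp add: root_system_of_type_def)
  then show ?thesis by (cases X) auto
qed

abbreviation "reflection_products \<equiv>
  {reflection (\<beta> + \<tau>) \<cdot> reflection \<beta> | \<beta> \<tau>.
     \<beta> \<in> nonisotropic form R \<and> \<tau> \<in> V0 \<and> \<beta> + \<tau> \<in> R}"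

abbreviation "heisenberg_carrier \<equiv> generate (GL U) reflection_products"

lemma form_S [simp]: "s \<in> S \<Longrightarrow> form s v = 0" "s \<in> S \<Longrightarrow> form v s = 0"
  using S_subset by auto

lemma in_R_iff: "\<beta> \<in> R \<longleftrightarrow> \<beta> \<in> S + S \<or> \<beta> \<in> \<Phi> + S"
  using arg_cong[OF R_eq, of "\<lambda>A. \<beta> \<in> A"] by (simp only: Un_iff)

lemma nonisotropic_R:
  assumes "\<beta> \<in> R" "form \<beta> \<beta> \<noteq> 0"
  obtains \<gamma> p where "\<gamma> \<in> \<Phi>" "\<gamma> \<noteq> 0" "p \<in> S" "\<beta> = \<gamma> + p"
proof -
  have "\<beta> \<notin> S + S"
    using assms(2) S_subset by (auto simp: set_plus_def)
  then obtain \<gamma> p where \<gamma>: "\<gamma> \<in> \<Phi>" "p \<in> S" "\<beta> = \<gamma> + p"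
    using assms(1) in_R_iff by (blast elim: set_plus_elim)
  moreover have "\<gamma> \<noteq> 0" using \<gamma> assms(2) S_subset by auto
  ultimately show ?thesis using that by blast
qed

lemma \<Phi>_plus_S: "\<lbrakk>\<gamma> \<in> \<Phi>; p \<in> S\<rbrakk> \<Longrightarrow> \<gamma> + p \<in> R"
  using in_R_iff by (blast intro: set_plus_intro)

lemma transvection_mem:
  assumes "\<gamma> \<in> \<Phi>" "\<gamma> \<noteq> 0" "p \<in> S"
  shows "reflection (\<gamma> + p) \<cdot> reflection \<gamma> \<in> reflection_products"
proof -
  have "\<gamma> + 0 \<in> R" by (rule \<Phi>_plus_S[OF assms(1) zero_in_S])
  then have "\<gamma> \<in> nonisotropic form R" using root_norm[OF assms(1,2)] by (simp add: nonisotropic_def)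
  moreover have "p \<in> V0" using S_subset assms(3) by auto
  ultimately show ?thesis using \<Phi>_plus_S[OF assms(1,3)] by blast
qed

text \<open>A generator of the Heisenberg-like group involves two roots with the same component in the root
  space, say \<open>\<gamma> + p\<close> and \<open>\<gamma> + q\<close>. Inserting the square of the reflection in \<open>\<gamma>\<close>, which is trivial, turns
  it into a quotient of two transvections with the root \<open>\<gamma>\<close>.\<close>

lemma reflection_product_quotient:
  assumes "g \<in> reflection_products"
  obtains \<gamma> p q where "\<gamma> \<in> \<Phi>" "\<gamma> \<noteq> 0" "p \<in> S" "q \<in> S"
    and "g = (reflection (\<gamma> + q) \<cdot> reflection \<gamma>)
      \<cdot> inv\<^bsub>GL U\<^esub> (reflection (\<gamma> + p) \<cdot> reflection \<gamma>)"
proof -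
  obtain \<beta> \<tau> where g: "g = reflection (\<beta> + \<tau>) \<cdot> reflection \<beta>"
      and \<beta>: "\<beta> \<in> R" "form \<beta> \<beta> \<noteq> 0" and \<tau>: "\<tau> \<in> V0" "\<beta> + \<tau> \<in> R"
    using assms by (auto simp: nonisotropic_def)
  obtain \<gamma> p where \<gamma>: "\<gamma> \<in> \<Phi>" "\<gamma> \<noteq> 0" "p \<in> S" "\<beta> = \<gamma> + p" by (rule nonisotropic_R[OF \<beta>])
  have "form (\<beta> + \<tau>) (\<beta> + \<tau>) \<noteq> 0" using \<beta> \<tau> by simp
  then obtain \<gamma>' q where \<gamma>': "\<gamma>' \<in> \<Phi>" "q \<in> S" "\<beta> + \<tau> = \<gamma>' + q" using nonisotropic_R[OF \<tau>(2)] by metis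
  have "\<gamma> + (p + \<tau>) = \<gamma>' + q" using \<gamma> \<gamma>' by (simp add: algebra_simps)
  moreover have "p + \<tau> \<in> V0" "q \<in> V0" "\<gamma> \<in> Vd" "\<gamma>' \<in> Vd"
    using \<gamma> \<gamma>' \<tau> S_subset \<Phi>_subset subspace_add[OF subspace_V0] by auto
  ultimately have eq: "\<gamma>' = \<gamma>" using decompose_unique(1)[of \<gamma> \<gamma>' "p + \<tau>" q] by simp
  let ?w = "reflection"
  have n: "form \<gamma> \<gamma> = 2" "form (\<gamma> + p) (\<gamma> + p) = 2" "form (\<gamma> + q) (\<gamma> + q) = 2"
    using root_norm[OF \<gamma>(1,2)] \<gamma> \<gamma>' S_subset by auto
  note w = refl_w_in_GL[OF n(1)] refl_w_in_GL[OF n(2)] refl_w_in_GL[OF n(3)]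
  have invol: "?w \<delta> \<cdot> ?w \<delta> = \<one>\<^bsub>GL U\<^esub>" if "form \<delta> \<delta> = 2" for \<delta>
    using refl_w_involution[OF that] refl_w_in_GL[OF that] by (auto simp: GL_mult GL_one compose_def)
  have inv: "inv\<^bsub>GL U\<^esub> ?w \<delta> = ?w \<delta>" if "form \<delta> \<delta> = 2" for \<delta>
    by (rule GL.inv_equality[OF invol[OF that]]) (use refl_w_in_GL[OF that] in auto)
  have g': "g = ?w (\<gamma> + q) \<cdot> ?w (\<gamma> + p)"
    unfolding g \<gamma>'(3) eq unfolding \<gamma>(4) ..
  have "inv\<^bsub>GL U\<^esub> (?w (\<gamma> + p) \<cdot> ?w \<gamma>) = ?w \<gamma> \<cdot> ?w (\<gamma> + p)"
    using w by (simp add: GL.inv_mult_group inv[OF n(1)] inv[OF n(2)])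
  moreover have "(?w (\<gamma> + q) \<cdot> ?w \<gamma>) \<cdot> (?w \<gamma> \<cdot> ?w (\<gamma> + p))
      = ?w (\<gamma> + q) \<cdot> ((?w \<gamma> \<cdot> ?w \<gamma>) \<cdot> ?w (\<gamma> + p))"
    using w by (simp add: GL.m_assoc)
  ultimately have "g = (?w (\<gamma> + q) \<cdot> ?w \<gamma>) \<cdot> inv\<^bsub>GL U\<^esub> (?w (\<gamma> + p) \<cdot> ?w \<gamma>)"
    using g' w by (simp add: invol[OF n(1)])
  then show ?thesis using that \<gamma> \<gamma>'(2) by blast
qed


abbreviation "coordinate_gens \<equiv>
  {(unit_at (i, r), \<lambda>_. 0 :: int) | i r. i \<in> {1..l} \<and> r \<in> {1..\<nu>}} \<union>
  {(\<lambda>_. 0, \<lambda>p. - int (n r s) * unit_at (r, s) p) | r s. 1 \<le> r \<and> r < s \<and> s \<le> \<nu>}"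

text \<open>The coordinates of the presented group form the full set of pairs \<open>(x, m)\<close> with \<open>m\<close> divisible
  entrywise by \<open>n\<close>. Central entries are adjusted last, so the \<open>y\<close>-generators only need to reach each
  \<open>x\<close> with some admissible \<open>m\<close>; the cocycle is admissible since \<open>n\<close> divides the Cartan matrix.\<close>

lemma heis_lattice:
  assumes gram_dvd: "\<And>i j r s. \<lbrakk>i \<in> {1..l}; j \<in> {1..l}; (r, s) \<in> pairs\<rbrakk> \<Longrightarrow> int (n r s) dvd gram i j"
    and x: "\<And>p. p \<notin> {1..l} \<times> {1..\<nu>} \<Longrightarrow> x p = 0"
    and m: "\<And>r s. (r, s) \<in> pairs \<Longrightarrow> int (n r s) dvd m (r, s)" "\<And>p. p \<notin> pairs \<Longrightarrow> m p = 0"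
  shows "(x, m) \<in> generate heis coordinate_gens"
proof -
  define I where "I = generate heis coordinate_gens"
  have I: "subgroup I heis" unfolding I_def by (rule heis_coords.generate_is_subgroup) auto
  have y_in: "(unit_at p, \<lambda>_. 0) \<in> I" if "p \<in> {1..l} \<times> {1..\<nu>}" for p
    using that unfolding I_def by (cases p) (intro generate.incl UnI1, blast)
  have z_in: "(\<lambda>_. 0, \<lambda>q. - int (n (fst p) (snd p)) * unit_at p q) \<in> I" if "p \<in> pairs" for p
    using that unfolding I_def pairs_def by (cases p) (intro generate.incl UnI2, auto)
  have mult_in: "(\<lambda>p. y p + z p, \<lambda>p. m p + k p + heis_cocycle l gram y z p) \<in> I"
    if "(y, m) \<in> I" "(z, k) \<in> I" for y z m k
    using subgroup.m_closed[OF I that] by simp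
  have inv_in: "(\<lambda>p. - y p, \<lambda>p. heis_cocycle l gram y y p - m p) \<in> I" if "(y, m) \<in> I" for y m
    using subgroup.m_inv_closed[OF I that] by (simp add: heis_coords_inv)
  have one_in: "(\<lambda>_. 0, \<lambda>_. 0) \<in> I"
    using subgroup.one_closed[OF I] by (simp add: heis_coords_one)
  define lat where "lat m \<longleftrightarrow> (\<forall>(r, s) \<in> pairs. int (n r s) dvd m (r, s)) \<and> (\<forall>p. p \<notin> pairs \<longrightarrow> m p = 0)" for m
  have lat_add: "lat (\<lambda>p. m p + k p)" and lat_minus: "lat (\<lambda>p. - m p)" if "lat m" "lat k" for m k
    using that unfolding lat_def by (fastforce intro: dvd_add)+
  have central: "(\<lambda>_. 0, m) \<in> I" if "lat m" for m
    using finite_pairs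
  proof (induction rule: integer_combination_induct[where f = m and c = "\<lambda>(r, s). - int (n r s)"])
    case zero
    show ?case by (rule one_in)
  next
    case (add f g)
    then show ?case using mult_in[of "\<lambda>_. 0" f "\<lambda>_. 0" g] by simp
  next
    case (minus f)
    then show ?case using inv_in[of "\<lambda>_. 0" f] by simp
  next
    case (unit p)
    then show ?case using z_in[of p] by (simp add: case_prod_unfold)
  qed (use \<open>lat m\<close> in \<open>auto simp: lat_def\<close>)
  have finite_box: "finite ({1..l} \<times> {1..\<nu>})" by simp
  have cocycle_lat: "lat (heis_cocycle l gram y z)"
    if "\<And>p. p \<notin> {1..l} \<times> {1..\<nu>} \<Longrightarrow> y p = 0" "\<And>p. p \<notin> {1..l} \<times> {1..\<nu>} \<Longrightarrow> z p = 0" for y z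
    unfolding lat_def
  proof (intro conjI ballI allI impI)
    show "case p of (r, s) \<Rightarrow> int (n r s) dvd heis_cocycle l gram y z (r, s)" if "p \<in> pairs" for p
      using that gram_dvd by (auto simp: heis_cocycle_def intro!: dvd_sum dvd_mult2)
    show "heis_cocycle l gram y z p = 0" if "p \<notin> pairs" for p
    proof -
      obtain r s where p: "p = (r, s)" by force
      have "z (j, r) = 0 \<or> y (i, s) = 0" if "r < s" for i j
        using \<open>p \<notin> pairs\<close> that \<open>\<And>p. p \<notin> {1..l} \<times> {1..\<nu>} \<Longrightarrow> z p = 0\<close>[of "(j, r)"]
          \<open>\<And>p. p \<notin> {1..l} \<times> {1..\<nu>} \<Longrightarrow> y p = 0\<close>[of "(i, s)"] by (auto simp: p pairs_def)
      then have "gram i j * y (i, s) * z (j, r) = 0" if "r < s" for i j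
        using that by (metis mult_zero_right mult_zero_left)
      then show ?thesis unfolding p heis_cocycle_def by (simp del: mult_eq_0_iff)
    qed
  qed
  have "(\<forall>p. p \<notin> {1..l} \<times> {1..\<nu>} \<longrightarrow> x p = 0) \<and> (\<exists>k. lat k \<and> (x, k) \<in> I)"
    using finite_box
  proof (induction rule: integer_combination_induct[where f = x and A = "{1..l} \<times> {1..\<nu>}" and c = "\<lambda>_. 1"])
    case zero
    have "lat (\<lambda>_. 0)" by (auto simp: lat_def)
    then show ?case using one_in by blast
  next
    case (add f g)
    then obtain k k' where k: "lat k" "(f, k) \<in> I" "lat k'" "(g, k') \<in> I" by blast
    note mult_in[OF k(2,4)]
    moreover have "lat (\<lambda>p. k p + k' p + heis_cocycle l gram f g p)"
      by (rule lat_add[OF lat_add[OF k(1,3)] cocycle_lat]) (use add in blast)+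
    ultimately show ?case using add by (intro conjI exI) simp_all
  next
    case (minus f)
    then obtain k where k: "lat k" "(f, k) \<in> I" by blast
    note inv_in[OF k(2)]
    moreover have "lat (\<lambda>p. heis_cocycle l gram f f p - k p)"
      using lat_add[OF cocycle_lat lat_minus[OF k(1) k(1)], of f f] minus by simp
    ultimately show ?case using minus by (intro conjI exI) simp_all
  next
    case (unit p)
    show ?case
    proof (intro conjI exI)
      show "lat (\<lambda>_. 0)" by (auto simp: lat_def)
      show "(\<lambda>q. 1 * unit_at p q, \<lambda>_. 0) \<in> I" using y_in[OF unit] by simp
      show "\<forall>q. q \<notin> {1..l} \<times> {1..\<nu>} \<longrightarrow> 1 * unit_at p q = 0" using unit by (auto simp: unit_at_def)
    qed
  qed (use x in auto)
  then obtain k where k: "lat k" "(x, k) \<in> I" by blast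
  have "lat m" using m by (auto simp: lat_def)
  from mult_in[OF k(2) central[OF lat_add[OF this lat_minus[OF k(1) k(1)]]]]
  show ?thesis by (simp add: I_def)
qed

text \<open>The transvection for \<open>p \<in> S\<close> has central entries \<open>coord p r * coord p s\<close>. If both factors are odd,
  then \<open>r\<close> and \<open>s\<close> lie in the support of \<open>p\<close> and \<open>n r s = 1\<close>; otherwise the entry is even.\<close>

lemma heis_gens_products:
  assumes gram_dvd: "\<And>i j r s. \<lbrakk>i \<in> {1..l}; j \<in> {1..l}; (r, s) \<in> pairs\<rbrakk> \<Longrightarrow> int (n r s) dvd gram i j"
    and n2: "\<And>r s. (r, s) \<in> pairs \<Longrightarrow> n r s dvd 2"
    and n1: "\<And>J r s. \<lbrakk>J \<in> SC; r \<in> J; s \<in> J; r < s\<rbrakk> \<Longrightarrow> n r s = 1"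
    and \<gamma>: "\<gamma> \<in> \<Phi>" "\<gamma> \<noteq> 0" "p \<in> S"
  shows "reflection (\<gamma> + p) \<cdot> reflection \<gamma> \<in> generate (GL U) (heis_map ` coordinate_gens)"
proof -
  obtain k where k: "\<gamma> = (\<Sum>i=1..l. of_int (k i) *\<^sub>R \<alpha> i)" using root_integer_combination[OF \<gamma>(1)] by blast
  let ?c = "coord p"
  have p: "p = (\<Sum>r=1..\<nu>. of_int (?c r) *\<^sub>R \<sigma> r)" by (rule coords_\<Lambda>(1)[OF S_in_\<Lambda>[OF \<gamma>(3)]])
  have J: "supp \<nu> \<sigma> p \<in> SC" using \<gamma>(3) by (auto simp: supp_class_def)
  have dvd: "int (n r s) dvd ?c r * ?c s" if rs: "(r, s) \<in> pairs" for r s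
  proof (cases "odd (?c r) \<and> odd (?c s)")
    case True
    then have "r \<in> supp \<nu> \<sigma> p" "s \<in> supp \<nu> \<sigma> p" "r < s" using rs by (auto simp: supp_def pairs_def)
    then show ?thesis using n1[OF J] by simp
  next
    case False
    then have "2 dvd ?c r * ?c s" by auto
    moreover have "int (n r s) dvd 2" using n2[OF rs] by (metis int_dvd_int_iff of_nat_numeral)
    ultimately show ?thesis by (metis dvd_trans)
  qed
  have "transvection_coords k ?c \<in> generate heis coordinate_gens"
    unfolding transvection_coords_def
    by (rule heis_lattice[OF gram_dvd]) (use dvd in \<open>auto simp: pairs_def split: if_splits\<close>)
  then have "heis_map (transvection_coords k ?c) \<in> heis_map ` generate heis coordinate_gens" by (rule imageI)
  also have "heis_map ` generate heis coordinate_gens = generate (GL U) (heis_map ` coordinate_gens)"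
    by (rule heis_map.generate_img[symmetric]) auto
  finally show ?thesis using refl_product_coords[OF \<gamma>(1,2) k p] by simp
qed

lemma subgroup_reflection_products: "subgroup (heisenberg_carrier) (GL U)"
  and reflection_products_subset: "reflection_products \<subseteq> carrier (GL U)"
proof -
  show *: "reflection_products \<subseteq> carrier (GL U)"
  proof
    fix g assume "g \<in> reflection_products"
    then obtain \<gamma> p q where g: "\<gamma> \<in> \<Phi>" "\<gamma> \<noteq> 0" "p \<in> S" "q \<in> S"
      "g = (reflection (\<gamma> + q) \<cdot> reflection \<gamma>)
      \<cdot> inv\<^bsub>GL U\<^esub> (reflection (\<gamma> + p) \<cdot> reflection \<gamma>)"
      by (rule reflection_product_quotient)
    have "form \<gamma> \<gamma> = 2" "form (\<gamma> + p) (\<gamma> + p) = 2" "form (\<gamma> + q) (\<gamma> + q) = 2"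
      using root_norm[OF g(1,2)] g(3,4) by auto
    then show "g \<in> carrier (GL U)" using refl_w_in_GL g(5) by simp
  qed
  show "subgroup (heisenberg_carrier) (GL U)" by (rule GL.generate_is_subgroup[OF *])
qed

lemma transvection_generated:
  assumes i: "i \<in> {1..l}" and J: "(\<Sum>r\<in>J. \<sigma> r) \<in> S" "J \<subseteq> {1..\<nu>}"
  shows "heis_map (\<lambda>p. if fst p = i \<and> snd p \<in> J then 1 else 0, \<lambda>p. if fst p \<in> J \<and> snd p \<in> J \<and> fst p < snd p then 1 else 0)
    \<in> heisenberg_carrier"
proof -
  let ?k = "\<lambda>j. if j = i then 1 else 0 :: int" and ?c = "\<lambda>r. if r \<in> J then 1 else 0 :: int"
  have "\<alpha> i = (\<Sum>j=1..l. if j = i then \<alpha> i else 0)" using i by simp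
  also have "\<dots> = (\<Sum>j=1..l. of_int (?k j) *\<^sub>R \<alpha> j)" by (intro sum.cong) auto
  finally have \<alpha>: "\<alpha> i = (\<Sum>j=1..l. of_int (?k j) *\<^sub>R \<alpha> j)" .
  have "(\<Sum>r\<in>J. \<sigma> r) = (\<Sum>r=1..\<nu>. if r \<in> J then \<sigma> r else 0)"
    using J(2) by (simp add: sum.inter_restrict[symmetric] Int_absorb1)
  also have "\<dots> = (\<Sum>r=1..\<nu>. of_int (?c r) *\<^sub>R \<sigma> r)" by (intro sum.cong) auto
  finally have q: "(\<Sum>r\<in>J. \<sigma> r) = (\<Sum>r=1..\<nu>. of_int (?c r) *\<^sub>R \<sigma> r)" .
  have "heis_map (transvection_coords ?k ?c) \<in> reflection_products"
    using transvection_mem[OF simple_root[OF i] simple_nonzero[OF i] J(1)]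
    unfolding refl_product_coords[OF simple_root[OF i] simple_nonzero[OF i] \<alpha> q] .
  moreover have "heis_map (transvection_coords ?k ?c)
    = heis_map (\<lambda>p. if fst p = i \<and> snd p \<in> J then 1 else 0, \<lambda>p. if fst p \<in> J \<and> snd p \<in> J \<and> fst p < snd p then 1 else 0)"
    unfolding transvection_coords_def by (rule heis_map_cong) (auto simp: pairs_def)
  ultimately show ?thesis by (auto intro: generate.incl)
qed

lemma simple_transvection_generated:
  assumes i: "i \<in> {1..l}" and r: "r \<in> {1..\<nu>}"
  shows "heis_map (unit_at (i, r), \<lambda>_. 0) \<in> heisenberg_carrier"
proof -
  have "heis_map (unit_at (i, r), \<lambda>_. 0) =
     heis_map (\<lambda>p. if fst p = i \<and> snd p \<in> {r} then 1 else 0, \<lambda>p. if fst p \<in> {r} \<and> snd p \<in> {r} \<and> fst p < snd p then 1 else 0)"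
    by (rule heis_map_cong) (auto simp: unit_at_def pairs_def)
  then show ?thesis using transvection_generated[OF i, of "{r}"] \<sigma>_in_S[OF r] r by simp
qed

text \<open>Multiplying the elements with coordinates \<open>unit_at (i, r)\<close>, \<open>r \<in> J\<close>, in increasing order of
  \<open>r\<close> produces no central term, because the cocycle pairs a larger index on the left with a smaller
  one on the right.\<close>

lemma ordered_product_generated:
  assumes i: "i \<in> {1..l}" and J: "J \<subseteq> {1..\<nu>}"
  shows "heis_map (\<lambda>p. if fst p = i \<and> snd p \<in> J then 1 else 0, \<lambda>_. 0)
    \<in> heisenberg_carrier"
proof -
  let ?G = heisenberg_carrier
  have "finite J" using J by (rule finite_subset) auto
  then show ?thesis using J
  proof (induction J rule: finite_linorder_max_induct)
    case empty
    then show ?case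
      using subgroup.one_closed[OF subgroup_reflection_products] heis_map_one by (simp add: heis_coords_one)
  next
    case (insert b J)
    let ?x = "\<lambda>p. if fst p = i \<and> snd p \<in> J then 1 else 0 :: int"
    have b: "b \<in> {1..\<nu>}" using insert.prems by auto
    have c0: "heis_cocycle l gram ?x (unit_at (i, b)) p = 0" for p
    proof -
      obtain r s where p: "p = (r, s)" by force
      show ?thesis
      proof (cases "r < s")
        case True
        have "gram i' j * ?x (i', s) * unit_at (i, b) (j, r) = 0" for i' j
        proof (cases "r = b")
          case eq: True
          then have "s \<notin> J" using insert.hyps(2) True by (metis less_asym)
          then show ?thesis by simp
        qed (simp add: unit_at_def)
        with True show ?thesis
          by (simp only: p heis_cocycle_def prod.case if_True sum.neutral_const)
      qed (simp add: p heis_cocycle_def)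
    qed
    have "heis_map (?x, \<lambda>_. 0) \<cdot> heis_map (unit_at (i, b), \<lambda>_. 0) \<in> ?G"
      using insert.IH insert.prems simple_transvection_generated[OF i b]
      by (intro subgroup.m_closed[OF subgroup_reflection_products]) auto
    also have "heis_map (?x, \<lambda>_. 0) \<cdot> heis_map (unit_at (i, b), \<lambda>_. 0)
        = heis_map (\<lambda>p. ?x p + unit_at (i, b) p, \<lambda>_. 0)"
      by (simp add: c0 flip: heis_map.hom_mult)
    also have "(\<lambda>p. ?x p + unit_at (i, b) p) = (\<lambda>p. if fst p = i \<and> snd p \<in> insert b J then 1 else 0)"
      using insert.hyps(2) by (auto simp: unit_at_def fun_eq_iff)
    finally show ?case .
  qed
qed

text \<open>For \<open>J\<close> in the supporting class, the transvection for \<open>\<alpha> 1\<close> and the sum of the \<open>\<sigma> r\<close> with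
  \<open>r \<in> J\<close> differs from the ordered product by exactly the inverse of \<open>z_J J\<close>; the squares are commutators,
  as \<open>\<alpha> 1\<close> has norm \<open>2\<close>.\<close>

lemma F_subset_heisenberg: "F \<subseteq> heisenberg_carrier"
proof (rule F_subset_subgroup[OF subgroup_reflection_products])
  let ?G = heisenberg_carrier
  have one: "1 \<in> {1..l}" using l_pos by simp
  show "z_J J \<in> ?G" if J: "J \<in> SC" for J
  proof -
    let ?x = "\<lambda>p. if fst p = (1 :: nat) \<and> snd p \<in> J then 1 else 0 :: int"
    let ?m = "\<lambda>p. if fst p \<in> J \<and> snd p \<in> J \<and> fst p < snd p then 1 else 0 :: int"
    have Jn: "J \<subseteq> {1..\<nu>}" by (rule supp_class_subset[OF J])
    have "inv\<^bsub>GL U\<^esub> heis_map (?x, \<lambda>_. 0) \<cdot> heis_map (?x, ?m) \<in> ?G"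
      using transvection_generated[OF one _ Jn] in_supp_class_iff[OF Jn] J ordered_product_generated[OF one Jn]
      by (intro subgroup.m_closed[OF subgroup_reflection_products] subgroup.m_inv_closed[OF subgroup_reflection_products]) auto
    also have "inv\<^bsub>GL U\<^esub> heis_map (?x, \<lambda>_. 0) \<cdot> heis_map (?x, ?m)
        = heis_map (inv\<^bsub>heis\<^esub> (?x, \<lambda>_. 0) \<otimes>\<^bsub>heis\<^esub> (?x, ?m))"
      by (simp only: heis_map.hom_mult heis_map.hom_inv carrier_heis_coords heis_coords.inv_closed)
    also have "\<dots> = central ?m"
      by (simp add: heis_coords_inv heis_cocycle_minus_left central_def)
    finally have "inv\<^bsub>GL U\<^esub> central ?m \<in> ?G" by (rule subgroup.m_inv_closed[OF subgroup_reflection_products])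
    also have "inv\<^bsub>GL U\<^esub> central ?m = z_J J"
      unfolding central_inv z_elt_supp[OF J] by (rule central_cong) auto
    finally show ?thesis .
  qed
  show "c_rs r s [^]\<^bsub>GL U\<^esub> (2 :: nat) \<in> ?G" if rs: "(r, s) \<in> pairs" for r s
  proof -
    have r: "r \<in> {1..\<nu>}" and s: "s \<in> {1..\<nu>}" and lt: "r < s" using rs by (auto simp: pairs_def)
    let ?y = "(unit_at (1, r), \<lambda>_. 0)" and ?z = "(unit_at (1, s), \<lambda>_. 0)"
    have "inv\<^bsub>GL U\<^esub> heis_map ?y \<cdot> inv\<^bsub>GL U\<^esub> heis_map ?z \<cdot> heis_map ?y \<cdot> heis_map ?z \<in> ?G"
      using simple_transvection_generated[OF one r] simple_transvection_generated[OF one s]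
      by (intro subgroup.m_closed[OF subgroup_reflection_products] subgroup.m_inv_closed[OF subgroup_reflection_products])
    also have "inv\<^bsub>GL U\<^esub> heis_map ?y \<cdot> inv\<^bsub>GL U\<^esub> heis_map ?z \<cdot> heis_map ?y \<cdot> heis_map ?z
        = heis_map (inv\<^bsub>heis\<^esub> ?y \<otimes>\<^bsub>heis\<^esub> inv\<^bsub>heis\<^esub> ?z \<otimes>\<^bsub>heis\<^esub> ?y \<otimes>\<^bsub>heis\<^esub> ?z)"
      by (simp only: heis_map.hom_mult heis_map.hom_inv carrier_heis_coords heis_coords.inv_closed heis_coords.m_closed)
    also have "\<dots> = central (\<lambda>p. heis_cocycle l gram (unit_at (1, r)) (unit_at (1, s)) p
        - heis_cocycle l gram (unit_at (1, s)) (unit_at (1, r)) p)"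
      unfolding heis_coords_commutator central_def ..
    also have "\<dots> = central (\<lambda>p. - int 2 * unit_at (r, s) p)"
    proof (rule central_cong)
      have "gram 1 1 = 2" using norm_simple[OF one] by (simp add: gram_def)
      then show "heis_cocycle l gram (unit_at (1, r)) (unit_at (1, s)) p
        - heis_cocycle l gram (unit_at (1, s)) (unit_at (1, r)) p = - int 2 * unit_at (r, s) p" for p
        unfolding heis_cocycle_unit[OF one one] using lt by (simp add: unit_at_def)
    qed
    also have "\<dots> = c_rs r s [^]\<^bsub>GL U\<^esub> (2 :: nat)" by (rule c_elt_pow[OF rs, symmetric])
    finally show ?thesis .
  qed
qed

text \<open>Composing coordinates with the action embeds the presented group into the linear group. Its image
  contains the transvections, hence the Heisenberg-like group, by divisibility of their central entries;
  it is contained in that group because \<open>F\<close> is.\<close>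

theorem heisenberg_presentation:
  assumes "F_generated_by_powers form Vd S \<sigma>"
  shows "heisenberg_group form Vd R \<cong> heis_hat l \<nu> (\<lambda>i j. form (\<alpha> i) (\<alpha> j)) n"
proof -
  have Fgen: "F = generate (GL U) c_powers" using assms generated_by_powers_iff by simp
  let ?K = "{central m | m. \<forall>(r, s) \<in> pairs. int (n r s) dvd m (r, s)}"
  have FK: "F \<subseteq> ?K"
    unfolding Fgen
  proof (rule GL.generate_subgroup_incl[OF _ subgroup_central])
    show "c_powers \<subseteq> ?K"
    proof
      fix g assume "g \<in> c_powers"
      then obtain r s where rs: "(r, s) \<in> pairs" "g = c_rs r s [^]\<^bsub>GL U\<^esub> n r s"
        by (auto simp: C_pow pairs_def)
      show "g \<in> ?K" unfolding rs(2) c_elt_pow[OF rs(1)]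
        by (intro CollectI exI conjI refl) (auto simp: unit_at_def)
    qed
  qed
  have in_F_dvd: "int (n r s) dvd m (r, s)" if "central m \<in> F" "(r, s) \<in> pairs" for m r s
  proof -
    obtain k where "central m = central k" "\<forall>(r, s) \<in> pairs. int (n r s) dvd k (r, s)" using FK \<open>central m \<in> F\<close> by blast
    then show ?thesis using central_eqD[of m k "(r, s)"] that(2) by auto
  qed
  have n2: "n r s dvd 2" if rs: "(r, s) \<in> pairs" for r s
  proof -
    have "int (n r s) dvd - int 2 * unit_at (r, s) (r, s)"
      by (rule in_F_dvd[OF _ rs]) (use c_elt_square_in_F[OF rs] in \<open>simp add: c_elt_pow[OF rs]\<close>)
    then have "int (n r s) dvd int 2" by (simp add: unit_at_def)
    then show ?thesis by (simp only: int_dvd_int_iff)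
  qed
  have n1: "n r s = 1" if J: "J \<in> SC" "r \<in> J" "s \<in> J" "r < s" for J r s
  proof -
    have rs: "(r, s) \<in> pairs" using supp_class_subset[OF J(1)] J by (auto simp: pairs_def)
    have "central (\<lambda>(r, s). if r \<in> J \<and> s \<in> J \<and> r < s then - 1 else 0) \<in> F"
      using z_elt_in_F[OF supp_class_subset[OF J(1)]] unfolding z_elt_supp[OF J(1)] .
    from in_F_dvd[OF this rs] show ?thesis using J by simp
  qed
  have gram_dvd: "int (n r s) dvd gram i j" if "i \<in> {1..l}" "j \<in> {1..l}" "(r, s) \<in> pairs" for i j r s
  proof (cases "l > 1")
    case True
    then show ?thesis using lattice_F(2) that(3) by simp
  next
    case False
    then have "i = 1" "j = 1" using that by auto
    then have "gram i j = 2" using that norm_simple[of 1] by (simp add: gram_def)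
    then show ?thesis using n2[OF that(3)] by (metis int_dvd_int_iff of_nat_numeral)
  qed
  let ?H = "heis_hat l \<nu> (\<lambda>i j. form (\<alpha> i) (\<alpha> j)) n"
  have gram': "form (\<alpha> i) (\<alpha> j) = of_int (gram i j)" if "i \<in> {1..l}" "j \<in> {1..l}" for i j
    using gram[OF that] by simp
  have n_pos': "0 < n r s" if "1 \<le> r" "r < s" "s \<le> \<nu>" for r s
    using n_exp_properties(1)[of r s] that by (simp add: pairs_def)
  have n_dvd': "int (n r s) dvd gram i j" if "i \<in> {1..l}" "j \<in> {1..l}" "1 \<le> r" "r < s" "s \<le> \<nu>" for i j r s
    using gram_dvd[OF that(1,2)] that(3-5) by (simp add: pairs_def)
  obtain \<phi> where \<phi>: "\<phi> \<in> hom ?H heis"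
    and img: "\<phi> ` carrier ?H = generate heis coordinate_gens"
    and ker: "\<forall>g \<in> carrier ?H.
        (\<forall>i \<in> {1..l}. \<forall>r \<in> {1..\<nu>}. fst (\<phi> g) (i, r) = 0) \<longrightarrow>
        (\<forall>r s. 1 \<le> r \<and> r < s \<and> s \<le> \<nu> \<longrightarrow> snd (\<phi> g) (r, s) = 0) \<longrightarrow> g = \<one>\<^bsub>?H\<^esub>"
    by (rule heis_hat_coordinates[OF gram' gram_sym n_pos' n_dvd'])
  have gH: "group ?H" unfolding heis_hat_def by (rule group_presented_group)
  let ?G = heisenberg_carrier
  have H_eq: "heisenberg_group form Vd R = (GL U)\<lparr>carrier := ?G\<rparr>"
    unfolding heisenberg_group_def subgroup_generated_def using reflection_products_subset by (simp only: Int_absorb1)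
  have gens_in_GL: "heis_map ` coordinate_gens \<subseteq> carrier (GL U)" using heis_map_in_GL by blast
  have "?G = generate (GL U) (heis_map ` coordinate_gens)"
  proof
    show "?G \<subseteq> generate (GL U) (heis_map ` coordinate_gens)"
    proof (rule GL.generate_subgroup_incl[OF _ GL.generate_is_subgroup[OF gens_in_GL]])
      show "reflection_products \<subseteq> generate (GL U) (heis_map ` coordinate_gens)"
      proof
        fix g assume "g \<in> reflection_products"
        then obtain \<gamma> p q where g: "\<gamma> \<in> \<Phi>" "\<gamma> \<noteq> 0" "p \<in> S" "q \<in> S"
          "g = (reflection (\<gamma> + q) \<cdot> reflection \<gamma>)
          \<cdot> inv\<^bsub>GL U\<^esub> (reflection (\<gamma> + p) \<cdot> reflection \<gamma>)"
          by (rule reflection_product_quotient)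
        have mem: "reflection (\<gamma> + p') \<cdot> reflection \<gamma> \<in> generate (GL U) (heis_map ` coordinate_gens)"
          if "p' \<in> S" for p'
          by (rule heis_gens_products[OF _ _ _ g(1,2) that]) (erule (2) gram_dvd, erule n2, erule (3) n1)
        show "g \<in> generate (GL U) (heis_map ` coordinate_gens)"
          unfolding g(5)
          by (rule generate.eng[OF mem[OF g(4)] GL.generate_m_inv_closed[OF gens_in_GL mem[OF g(3)]]])
      qed
    qed
    show "generate (GL U) (heis_map ` coordinate_gens) \<subseteq> ?G"
    proof (rule GL.generate_subgroup_incl[OF _ subgroup_reflection_products])
      have "heis_map (\<lambda>_. 0, \<lambda>p. - int (n r s) * unit_at (r, s) p) \<in> ?G" if "(r, s) \<in> pairs" for r s
        using n_exp_properties(2)[OF that] F_subset_heisenberg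
        unfolding c_elt_pow[OF that] central_def by blast
      then show "heis_map ` coordinate_gens \<subseteq> ?G"
        using simple_transvection_generated unfolding pairs_def by blast
    qed
  qed
  also have "\<dots> = heis_map ` generate heis coordinate_gens"
    by (rule heis_map.generate_img) auto
  finally have img': "(heis_map \<circ> \<phi>) ` carrier ?H = ?G"
    by (simp only: image_comp[symmetric] img)
  have hom: "heis_map \<circ> \<phi> \<in> hom ?H (GL U)" by (rule hom_compose[OF \<phi> heis_map_hom])
  interpret \<psi>: group_hom ?H "GL U" "heis_map \<circ> \<phi>"
    using hom gH by (simp add: group_hom_def group_hom_axioms_def GL.group_axioms)
  have "inj_on (heis_map \<circ> \<phi>) (carrier ?H)"
  proof (rule \<psi>.inj_on_one_iff[THEN iffD2], intro allI impI)
    fix g assume g: "g \<in> carrier ?H" "(heis_map \<circ> \<phi>) g = \<one>\<^bsub>GL U\<^esub>"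
    then have "heis_map (\<phi> g) = \<one>\<^bsub>GL U\<^esub>" by simp
    from heis_map_kernel[OF this] show "g = \<one>\<^bsub>?H\<^esub>" using ker g(1) by blast
  qed
  moreover have "heis_map \<circ> \<phi> \<in> hom ?H (heisenberg_group form Vd R)"
    unfolding H_eq using hom img' by (auto simp: hom_def)
  ultimately have "heis_map \<circ> \<phi> \<in> iso ?H (heisenberg_group form Vd R)"
    using img' by (simp add: iso_def bij_betw_def H_eq)
  then have "?H \<cong> heisenberg_group form Vd R" by (auto simp: is_iso_def)
  then show ?thesis by (rule group.iso_sym[OF gH])
qed

section \<open>Rank one\<close>

text \<open>Vectors of the lattice whose integer combinations give the old basis are a basis, because the
  dimension of the radical leaves no room for a relation between them.\<close>

lemma z_basisI:
  assumes \<sigma>': "\<And>r. r \<in> {1..\<nu>} \<Longrightarrow> \<sigma>' r \<in> \<Lambda>"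
    and \<sigma>: "\<And>r. r \<in> {1..\<nu>} \<Longrightarrow> \<sigma> r = (\<Sum>s=1..\<nu>. of_int (w r s) *\<^sub>R \<sigma>' s)"
  shows "z_basis \<nu> \<sigma>' \<Lambda>"
  unfolding z_basis_def
proof (intro conjI allI impI)
  have "\<sigma> ` {1..\<nu>} \<subseteq> span (\<sigma>' ` {1..\<nu>})"
  proof
    fix x assume "x \<in> \<sigma> ` {1..\<nu>}"
    then obtain r where "r \<in> {1..\<nu>}" "x = \<sigma> r" by blast
    then have "x = (\<Sum>s=1..\<nu>. of_int (w r s) *\<^sub>R \<sigma>' s)" using \<sigma> by simp
    also have "\<dots> \<in> span (\<sigma>' ` {1..\<nu>})" by (intro span_sum span_scale span_base) auto
    finally show "x \<in> span (\<sigma>' ` {1..\<nu>})" .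
  qed
  then have "span (\<sigma> ` {1..\<nu>}) \<subseteq> span (\<sigma>' ` {1..\<nu>})" by (rule span_minimal) simp
  then have V0_sub: "V0 \<subseteq> span (\<sigma>' ` {1..\<nu>})" unfolding span_\<sigma> .
  have card_le: "card (\<sigma>' ` {1..\<nu>}) \<le> \<nu>" using card_image_le[of "{1..\<nu>}" \<sigma>'] by simp
  have sub: "\<sigma>' ` {1..\<nu>} \<subseteq> V0" using \<sigma>' \<Lambda>_subset by auto
  have "independent (\<sigma>' ` {1..\<nu>})"
    by (rule card_le_dim_spanning[OF sub V0_sub]) (use card_le in \<open>auto simp: nullity_def\<close>)
  moreover have "inj_on \<sigma>' {1..\<nu>}"
  proof -
    have "\<nu> \<le> card (\<sigma>' ` {1..\<nu>})"
      using dim_le_card[OF V0_sub] by (simp add: nullity_def)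
    then show ?thesis using card_le by (intro eq_card_imp_inj_on) auto
  qed
  ultimately have zero: "k r = 0" if "(\<Sum>r=1..\<nu>. of_int (k r) *\<^sub>R \<sigma>' r) = 0" "r \<in> {1..\<nu>}" for k :: "nat \<Rightarrow> int" and r
    using independent_family_eqD[of \<sigma>' "{1..\<nu>}" "\<lambda>r. of_int (k r)" "\<lambda>_. 0" r] that by simp
  show "\<forall>r \<in> {1..\<nu>}. k r = 0" if "(\<Sum>r=1..\<nu>. of_int (k r) *\<^sub>R \<sigma>' r) = 0" for k :: "nat \<Rightarrow> int"
    using zero[OF that] by blast
  show "\<Lambda> = {(\<Sum>r=1..\<nu>. of_int (k r) *\<^sub>R \<sigma>' r) | k :: nat \<Rightarrow> int. True}" (is "_ = ?L")
  proof
    show "\<Lambda> \<subseteq> ?L"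
    proof
      fix x assume "x \<in> \<Lambda>"
      then obtain k :: "nat \<Rightarrow> int" where "x = (\<Sum>r=1..\<nu>. of_int (k r) *\<^sub>R \<sigma> r)" using \<Lambda>_eq by blast
      also have "\<dots> = (\<Sum>r=1..\<nu>. \<Sum>s=1..\<nu>. of_int (k r * w r s) *\<^sub>R \<sigma>' s)"
        using \<sigma> by (intro sum.cong) (auto simp: scaleR_sum_right)
      also have "\<dots> = (\<Sum>s=1..\<nu>. of_int (\<Sum>r=1..\<nu>. k r * w r s) *\<^sub>R \<sigma>' s)"
        by (subst sum.swap) (simp add: scaleR_sum_left)
      finally show "x \<in> ?L" by (intro CollectI exI[of _ "\<lambda>s. \<Sum>r=1..\<nu>. k r * w r s"]) simp
    qed
    have zsmul: "of_int k *\<^sub>R x \<in> \<Lambda>" if "x \<in> \<Lambda>" for k x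
    proof -
      have "x = (\<Sum>r=1..\<nu>. of_int (coord x r) *\<^sub>R \<sigma> r)" by (rule coords_\<Lambda>(1)[OF that])
      then have "of_int k *\<^sub>R x = of_int k *\<^sub>R (\<Sum>r=1..\<nu>. of_int (coord x r) *\<^sub>R \<sigma> r)" by simp
      also have "\<dots> = (\<Sum>r=1..\<nu>. of_int (k * coord x r) *\<^sub>R \<sigma> r)" by (simp add: scaleR_sum_right)
      finally show ?thesis using sum_in_\<Lambda> by metis
    qed
    have "(\<Sum>r\<in>A. of_int (k r) *\<^sub>R \<sigma>' r) \<in> \<Lambda>" if "finite A" "A \<subseteq> {1..\<nu>}" for A and k :: "nat \<Rightarrow> int"
      using that by (induction A rule: finite_induct) (auto intro!: group_closure_add zsmul \<sigma>')
    then show "?L \<subseteq> \<Lambda>" by auto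
  qed
qed

lemma rank_one_root_system:
  assumes b: "form b b = 2"
  shows "finite_root_system form (span {b}) {0, b, - b}"
  unfolding finite_root_system_def
proof (intro conjI ballI impI allI)
  have V: "span {b} = range (\<lambda>c. c *\<^sub>R b)" by (rule span_singleton)
  have b0: "b \<noteq> 0" using b by auto
  show "0 < form x x" if "x \<in> span {b}" "x \<noteq> 0" for x
  proof -
    obtain c where c: "x = c *\<^sub>R b" using \<open>x \<in> span {b}\<close> V by blast
    then show ?thesis using b that(2) by (auto simp: zero_less_mult_iff)
  qed
  show "span {0, b, - b} = span {b}"
  proof (rule antisym; rule span_minimal)
    show "{0, b, - b} \<subseteq> span {b}" by (auto intro: span_base span_zero span_neg)
    show "{b} \<subseteq> span {0, b, - b}" by (auto intro: span_base)
  qed simp_all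
  fix \<beta> assume \<beta>: "\<beta> \<in> {0, b, - b} - {0}"
  then obtain j where j: "\<beta> = j *\<^sub>R b" "j = 1 \<or> j = - 1" by (metis Diff_iff insert_iff empty_iff scaleR_one scaleR_minus1_left)
  have coroot: "coroot form \<beta> = j *\<^sub>R b" using j b by (auto simp: coroot_def)
  show "form \<gamma> (coroot form \<beta>) \<in> \<int>" "\<gamma> - form \<gamma> (coroot form \<beta>) *\<^sub>R \<beta> \<in> {0, b, - b}"
    if \<gamma>: "\<gamma> \<in> {0, b, - b}" for \<gamma>
  proof -
    show "form \<gamma> (coroot form \<beta>) \<in> \<int>" using \<gamma> j b unfolding coroot by auto
    show "\<gamma> - form \<gamma> (coroot form \<beta>) *\<^sub>R \<beta> \<in> {0, b, - b}"
      using \<gamma> j b unfolding coroot by (auto simp: scaleR_2)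
  qed
  show "t \<in> {-1, 0, 1}" if "t *\<^sub>R \<beta> \<in> {0, b, - b}" for t
  proof -
    have "(t * j) *\<^sub>R b = 0 *\<^sub>R b \<or> (t * j) *\<^sub>R b = 1 *\<^sub>R b \<or> (t * j) *\<^sub>R b = (- 1) *\<^sub>R b"
      using that j(1) by auto
    then have "t * j = 0 \<or> t * j = 1 \<or> t * j = - 1" using b0 unfolding scaleR_cancel_right by blast
    then show ?thesis using j(2) by auto
  qed
qed auto

text \<open>In rank one, replacing \<open>\<alpha> 1\<close> by \<open>\<alpha> 1 + \<tau>\<close> for some \<open>\<tau> \<in> S\<close> moves the complement of the
  radical and translates the semilattice by \<open>- \<tau>\<close>. The root system stays the same: for the roots over
  \<open>\<alpha> 1\<close> the two shifts cancel, and otherwise they add up to \<open>2 \<tau>\<close>, which leaves \<open>S\<close> invariant.\<close>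

lemma shifted_ears:
  assumes l: "l = 1" and \<tau>: "\<tau> \<in> S"
    and \<sigma>'_S: "\<And>r. r \<in> {1..\<nu>} \<Longrightarrow> \<sigma>' r + \<tau> \<in> S"
    and basis: "z_basis \<nu> \<sigma>' \<Lambda>"
  shows "simply_laced_ears form R X (span {\<alpha> 1 + \<tau>}) ((\<lambda>s. s - \<tau>) ` S) (\<lambda>_. \<alpha> 1 + \<tau>) \<sigma>'"
    and "similar_semilattices V0 S ((\<lambda>s. s - \<tau>) ` S)"
proof -
  let ?a = "\<alpha> 1 + \<tau>" and ?S = "(\<lambda>s. s - \<tau>) ` S"
  let ?V = "span {?a}"
  have one: "1 \<in> {1..l}" using l by simp
  have \<alpha>: "form (\<alpha> 1) (\<alpha> 1) = 2" "\<alpha> 1 \<noteq> 0" "\<alpha> 1 \<in> \<Phi>" "\<alpha> 1 \<in> Vd"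
    using norm_simple[OF one] simple_nonzero[OF one] simple_root[OF one] simple_in_Vd[OF one] by auto
  have \<tau>0: "\<tau> \<in> V0" using \<tau> S_subset by auto
  have norm: "form ?a ?a = 2" using \<alpha> \<tau> by simp
  have a0: "?a \<noteq> 0"
  proof
    assume "?a = 0"
    then have "form ?a ?a = 0" by (simp only: form_simps(9))
    then show False using norm by simp
  qed
  have V: "?V = range (\<lambda>c. c *\<^sub>R ?a)" by (rule span_singleton)
  have Vd: "Vd = range (\<lambda>c. c *\<^sub>R \<alpha> 1)"
    using span_\<alpha> l by (simp add: span_singleton)
  have \<Phi>_cases: "\<gamma> \<in> {0, \<alpha> 1, - \<alpha> 1}" if \<gamma>: "\<gamma> \<in> \<Phi>" for \<gamma>
  proof -
    obtain c where c: "\<gamma> = c *\<^sub>R \<alpha> 1" using \<gamma> \<Phi>_subset Vd by blast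
    then have "c \<in> {-1, 0, 1}" using \<Phi>_reduced[OF \<alpha>(3,2)] \<gamma> by blast
    then show ?thesis using c by auto
  qed
  have \<Phi>: "\<Phi> = {0, \<alpha> 1, - \<alpha> 1}"
    using \<Phi>_cases zero_in_\<Phi> \<alpha>(3) \<Phi>_uminus[OF \<alpha>(3)] by blast
  have in_V0: "c = 0" if "c *\<^sub>R ?a \<in> V0" for c
  proof -
    have "form (c *\<^sub>R ?a) (\<alpha> 1) = 0" using that by (rule form_V0)
    then show ?thesis using \<alpha> \<tau> by simp
  qed
  have complement: "complement_of V0 ?V"
    unfolding complement_of_def
  proof (intro conjI)
    show "?V \<inter> V0 = {0}" using in_V0 subspace_0[OF subspace_V0] unfolding V by force
    have "v \<in> ?V + V0" for v
    proof -
      obtain d s where d: "d \<in> Vd" "s \<in> V0" "v = d + s" by (rule decompose)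
      then obtain c where "d = c *\<^sub>R \<alpha> 1" using Vd by blast
      then have "v = c *\<^sub>R ?a + (s - c *\<^sub>R \<tau>)" using d by (simp add: algebra_simps)
      moreover have "s - c *\<^sub>R \<tau> \<in> V0"
        using d(2) \<tau>0 subspace_diff[OF subspace_V0] subspace_scale[OF subspace_V0] by blast
      ultimately show ?thesis unfolding V by (metis rangeI set_plus_intro)
    qed
    then show "?V + V0 = UNIV" by blast
  qed (rule subspace_span)
  have \<Phi>': "finite_part form ?V R = {0, ?a, - ?a}"
  proof
    show "finite_part form ?V R \<subseteq> {0, ?a, - ?a}"
    proof
      fix x assume "x \<in> finite_part form ?V R"
      then obtain c \<rho> where x: "x = c *\<^sub>R ?a" "\<rho> \<in> V0" "x + \<rho> \<in> R"
        unfolding finite_part_def V by blast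
      show "x \<in> {0, ?a, - ?a}"
      proof (cases "x + \<rho> \<in> S + S")
        case True
        then obtain p q where "p \<in> S" "q \<in> S" "x = (p + q) - \<rho>"
          by (metis add_diff_cancel_right' set_plus_elim)
        then have "x \<in> V0" using S_subset x(2) subspace_diff[OF subspace_V0] subspace_add[OF subspace_V0] by blast
        then show ?thesis using in_V0 x(1) by simp
      next
        case False
        then obtain \<gamma> p where p: "\<gamma> \<in> \<Phi>" "p \<in> S" "x + \<rho> = \<gamma> + p"
          using x(3) in_R_iff by (blast elim: set_plus_elim)
        have "c *\<^sub>R \<alpha> 1 + (c *\<^sub>R \<tau> + \<rho>) = \<gamma> + p" using p(3) x(1) by (simp add: algebra_simps)
        moreover have "c *\<^sub>R \<alpha> 1 \<in> Vd" "\<gamma> \<in> Vd" "c *\<^sub>R \<tau> + \<rho> \<in> V0" "p \<in> V0"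
          using Vd p(1,2) \<Phi>_subset S_subset x(2) \<tau>0 subspace_add[OF subspace_V0] subspace_scale[OF subspace_V0] by blast+
        ultimately have "c *\<^sub>R \<alpha> 1 = \<gamma>" using decompose_unique(1) by metis
        then have "c \<in> {-1, 0, 1}" using \<Phi>_reduced[OF \<alpha>(3,2)] p(1) by blast
        then show ?thesis using x(1) by auto
      qed
    qed
    have "0 + 0 \<in> R" "?a + 0 \<in> R" "- ?a + 0 \<in> R"
      using \<Phi>_plus_S[OF zero_in_\<Phi> zero_in_S] \<Phi>_plus_S[OF \<alpha>(3) \<tau>]
        \<Phi>_plus_S[OF \<Phi>_uminus[OF \<alpha>(3)] S_uminus[OF \<tau>]] by simp_all
    moreover have "0 \<in> V0" by (rule subspace_0[OF subspace_V0])
    moreover have "0 \<in> ?V" "?a \<in> ?V" "- ?a \<in> ?V"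
      by (rule span_zero, rule span_base, simp, rule span_neg, rule span_base, simp)
    ultimately show "{0, ?a, - ?a} \<subseteq> finite_part form ?V R" unfolding finite_part_def by blast
  qed
  have coroot: "coroot form ?a = ?a" by (simp only: coroot_def norm) simp
  have fund: "fundamental_system {0, ?a, - ?a} l (\<lambda>_. ?a)"
    unfolding fundamental_system_def l
  proof (intro conjI ballI)
    fix \<beta> assume "\<beta> \<in> {0, ?a, - ?a}"
    then show "\<exists>k :: nat \<Rightarrow> nat. \<beta> = (\<Sum>i=1..1. real (k i) *\<^sub>R ?a) \<or> \<beta> = - (\<Sum>i=1..1. real (k i) *\<^sub>R ?a)"
      by (auto intro: exI[of _ "\<lambda>_. 0"] exI[of _ "\<lambda>_. 1"])
  qed (use a0 in auto)
  have frs: "finite_root_system form ?V {0, ?a, - ?a}" by (rule rank_one_root_system[OF norm])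
  have valid: "valid_type X" using root_system by (simp add: root_system_of_type_def)
  have rs: "root_system_of_type form ?V (finite_part form ?V R) X"
    unfolding root_system_of_type_def \<Phi>'
  proof (intro conjI exI[of _ "\<lambda>_. ?a"] ballI)
    show "form ?a (coroot form ?a) = of_int (cartan_matrix X i j)" if "i \<in> {1..l}" "j \<in> {1..l}" for i j
      unfolding coroot norm using that l by (simp add: cartan_matrix_def)
  qed (rule frs valid fund)+
  have zero_S': "0 \<in> ?S" using \<tau> by force
  have semi: "semilattice_in V0 ?S"
    unfolding semilattice_in_def
  proof (intro conjI ballI)
    show "?S \<subseteq> V0" using S_subset \<tau>0 subspace_diff[OF subspace_V0] by blast
    show "discrete ?S"
      using semilattice isolated_in_translation unfolding semilattice_in_def discrete_def by blast
    show "span ?S = V0"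
    proof
      have "?S \<subseteq> V0" using S_subset \<tau>0 subspace_diff[OF subspace_V0] by blast
      then show "span ?S \<subseteq> V0" by (rule span_minimal[OF _ subspace_V0])
      have "- \<tau> \<in> ?S" using zero_in_S by force
      then have "s \<in> span ?S" if "s \<in> S" for s
        using span_diff[OF span_base[of "s - \<tau>" ?S] span_base[of "- \<tau>" ?S]] that by simp
      then have "span S \<subseteq> span ?S" by (intro span_minimal) auto
      then show "V0 \<subseteq> span ?S" using span_S by simp
    qed
    show "0 \<in> ?S" by (rule zero_S')
    fix s t assume "s \<in> ?S" "t \<in> ?S"
    then obtain s' t' where s: "s' \<in> S" "s = s' - \<tau>" "t' \<in> S" "t = t' - \<tau>" by blast
    have "s + 2 *\<^sub>R t = (s' + 2 *\<^sub>R t' - 2 *\<^sub>R \<tau>) - \<tau>" "s - 2 *\<^sub>R t = (s' - 2 *\<^sub>R t' + 2 *\<^sub>R \<tau>) - \<tau>"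
      unfolding s(2,4) by (simp_all add: algebra_simps)
    then show "s + 2 *\<^sub>R t \<in> ?S" "s - 2 *\<^sub>R t \<in> ?S"
      using S_double s(1,3) \<tau> by blast+
  qed
  have R: "R = (?S + ?S) \<union> (finite_part form ?V R + ?S)"
    unfolding \<Phi>'
  proof (rule Set.set_eqI)
    fix x
    have "x \<in> S + S \<longleftrightarrow> x \<in> ?S + ?S"
    proof
      assume "x \<in> S + S"
      then obtain s t where s: "s \<in> S" "t \<in> S" "x = s + t" by (rule set_plus_elim)
      then have "x = ((s + 2 *\<^sub>R \<tau>) - \<tau>) + (t - \<tau>)" by (simp add: scaleR_2)
      then show "x \<in> ?S + ?S" using S_double(1)[OF s(1) \<tau>] s(2) by blast
    next
      assume "x \<in> ?S + ?S"
      then obtain s t where s: "s \<in> S" "t \<in> S" "x = (s - \<tau>) + (t - \<tau>)" by (blast elim: set_plus_elim)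
      then have "x = (s - 2 *\<^sub>R \<tau>) + t" by (simp add: scaleR_2)
      then show "x \<in> S + S" using S_double(2)[OF s(1) \<tau>] s(2) by blast
    qed
    moreover have "x \<in> {0} + S \<Longrightarrow> x \<in> S + S" "x \<in> {0} + ?S \<Longrightarrow> x \<in> ?S + ?S"
      using zero_in_S zero_S' by (blast elim: set_plus_elim)+
    moreover have "x \<in> {\<alpha> 1} + S \<longleftrightarrow> x \<in> {?a} + ?S"
    proof -
      have "x = \<alpha> 1 + s \<longleftrightarrow> x = ?a + (s - \<tau>)" for s by simp
      then show ?thesis by (fastforce simp: set_plus_def)
    qed
    moreover have "x \<in> {- \<alpha> 1} + S \<longleftrightarrow> x \<in> {- ?a} + ?S"
    proof
      assume "x \<in> {- \<alpha> 1} + S"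
      then obtain s where s: "s \<in> S" "x = - \<alpha> 1 + s" by (auto simp: set_plus_def)
      then have "x = - ?a + ((s + 2 *\<^sub>R \<tau>) - \<tau>)" by (simp add: scaleR_2)
      then show "x \<in> {- ?a} + ?S" using S_double(1)[OF s(1) \<tau>] by blast
    next
      assume "x \<in> {- ?a} + ?S"
      then obtain s where s: "s \<in> S" "x = - ?a + (s - \<tau>)" by (auto simp: set_plus_def)
      then have "x = - \<alpha> 1 + (s - 2 *\<^sub>R \<tau>)" by (simp add: scaleR_2)
      then show "x \<in> {- \<alpha> 1} + S" using S_double(2)[OF s(1) \<tau>] by blast
    qed
    moreover have "x \<in> {0, b, - b} + A \<longleftrightarrow> x \<in> {0} + A \<or> x \<in> {b} + A \<or> x \<in> {- b} + A" for b A
      by (auto simp: set_plus_def)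
    ultimately show "x \<in> R \<longleftrightarrow> x \<in> (?S + ?S) \<union> ({0, ?a, - ?a} + ?S)"
      unfolding in_R_iff \<Phi> Un_iff by blast
  qed
  have closure: "group_closure ?S = \<Lambda>"
  proof
    have \<tau>\<Lambda>: "\<tau> \<in> \<Lambda>" using S_in_\<Lambda>[OF \<tau>] .
    show "group_closure ?S \<subseteq> \<Lambda>"
    proof
      fix x assume "x \<in> group_closure ?S"
      then show "x \<in> \<Lambda>"
      proof induction
        case (base s)
        then show ?case using group_closure.diff[OF S_in_\<Lambda> \<tau>\<Lambda>] by auto
      qed (rule group_closure.diff)
    qed
    have "- \<tau> \<in> ?S" using zero_in_S by force
    then have m: "- \<tau> \<in> group_closure ?S" by (intro group_closure.base) simp
    show "\<Lambda> \<subseteq> group_closure ?S"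
    proof
      fix x assume "x \<in> \<Lambda>"
      then show "x \<in> group_closure ?S"
      proof induction
        case (base s)
        show ?case
        proof (cases "s = 0")
          case False
          then have "s - \<tau> \<in> group_closure ?S" using base by (intro group_closure.base) auto
          then show ?thesis using group_closure.diff[OF _ m] by force
        qed simp
      qed (rule group_closure.diff)
    qed
  qed
  show "simply_laced_ears form R X ?V ?S (\<lambda>_. ?a) \<sigma>'"
    unfolding simply_laced_ears_def closure
  proof (intro conjI ballI impI)
    show "R = (?S + ?S) \<union> (finite_part form ?V R + ?S)" by (rule R)
    show "fundamental_system (finite_part form ?V R) l (\<lambda>_. ?a)" unfolding \<Phi>' by (rule fund)
    show "\<sigma>' r \<in> ?S" if "r \<in> {1..\<nu>}" for r using \<sigma>'_S[OF that] by force
    show "lattice_in V0 ?S" if "l > 1" using that l by simp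
  qed (rule ears_R complement rs semi norm basis)+
  show "similar_semilattices V0 S ?S"
    unfolding similar_semilattices_def
  proof (intro bexI[of _ "\<lambda>x\<in>V0. x"] bexI[of _ \<tau>])
    show "(\<lambda>x\<in>V0. x) ` S = (\<lambda>x. x + \<tau>) ` ?S"
      using S_subset by (force simp: image_image)
    show "\<tau> \<in> ?S" using S_double(1)[OF \<tau> \<tau>] S_double(1)[OF zero_in_S \<tau>] by (force simp: scaleR_2)
    interpret G: group "GL V0" by (rule group_GL[OF subspace_V0])
    show "(\<lambda>x\<in>V0. x) \<in> carrier (GL V0)" using G.one_closed by (simp add: GL_one)
  qed
qed


section \<open>Semilattices of rank at most three\<close>

lemma standard_supp_closed:
  assumes "standard_supp k j A"
  shows "\<lbrakk>J \<in> A; r \<in> J; s \<in> J; r < s\<rbrakk> \<Longrightarrow> {r, s} \<in> A"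
    and "{} \<in> A" "r \<in> {1..k} \<Longrightarrow> {r} \<in> A"
  using assms by (cases rule: standard_supp.cases; force)+

lemma standard_supp_pairs:
  assumes "standard_supp k j A"
  shows "k = 2 \<Longrightarrow> {1, 2} \<in> A \<longleftrightarrow> j = 3"
    and "k = 3 \<Longrightarrow> {1, 2} \<in> A \<longleftrightarrow> j \<ge> 6"
    and "k = 3 \<Longrightarrow> {1, 3} \<in> A \<longleftrightarrow> j \<ge> 5"
    and "k = 3 \<Longrightarrow> {2, 3} \<in> A \<longleftrightarrow> j \<ge> 4"
  using assms by (cases rule: standard_supp.cases; simp add: doubleton_eq_iff)+

lemma standard_supp_F:
  assumes std: "standard_supp \<nu> m SC"
  shows "F_generated_by_powers form Vd S \<sigma>"
    and "\<nu> = 2 \<and> m = 2 \<longrightarrow> n 1 2 = 2"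
    and "\<nu> = 2 \<and> m = 3 \<longrightarrow> n 1 2 = 1"
    and "\<nu> = 3 \<and> m = 3 \<longrightarrow> (n 1 2, n 1 3, n 2 3) = (2, 2, 2)"
    and "\<nu> = 3 \<and> m = 4 \<longrightarrow> (n 1 2, n 1 3, n 2 3) = (2, 2, 1)"
    and "\<nu> = 3 \<and> m = 5 \<longrightarrow> (n 1 2, n 1 3, n 2 3) = (2, 1, 1)"
    and "\<nu> = 3 \<and> (m = 6 \<or> m = 7) \<longrightarrow> (n 1 2, n 1 3, n 2 3) = (1, 1, 1)"
proof -
  note F = pair_closed_F[OF standard_supp_closed(1)[OF std]]
  show "F_generated_by_powers form Vd S \<sigma>" by (rule F(1)) simp_all
  have n: "n r s = (if {r, s} \<in> SC then 1 else 2)" if "(r, s) \<in> pairs" for r s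
    by (rule F(2)) (simp_all add: that)
  have p: "(1, 2) \<in> pairs" if "2 \<le> \<nu>" using that by (simp add: pairs_def)
  have p3: "(1, 2) \<in> pairs" "(1, 3) \<in> pairs" "(2, 3) \<in> pairs" if "\<nu> = 3" using that by (simp_all add: pairs_def)
  have n2: "n 1 2 = (if m = 3 then 1 else 2)" if "\<nu> = 2"
    using n[OF p] standard_supp_pairs(1)[OF std that] that by simp
  have n3: "n 1 2 = (if m \<ge> 6 then 1 else 2)" "n 1 3 = (if m \<ge> 5 then 1 else 2)"
    "n 2 3 = (if m \<ge> 4 then 1 else 2)" if "\<nu> = 3"
    using n[OF p3(1)[OF that]] n[OF p3(2)[OF that]] n[OF p3(3)[OF that]]
      standard_supp_pairs(2-4)[OF std that] by simp_all
  show "\<nu> = 2 \<and> m = 2 \<longrightarrow> n 1 2 = 2" "\<nu> = 2 \<and> m = 3 \<longrightarrow> n 1 2 = 1"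
    using n2 by auto
  show "\<nu> = 3 \<and> m = 3 \<longrightarrow> (n 1 2, n 1 3, n 2 3) = (2, 2, 2)"
    "\<nu> = 3 \<and> m = 4 \<longrightarrow> (n 1 2, n 1 3, n 2 3) = (2, 2, 1)"
    "\<nu> = 3 \<and> m = 5 \<longrightarrow> (n 1 2, n 1 3, n 2 3) = (2, 1, 1)"
    "\<nu> = 3 \<and> (m = 6 \<or> m = 7) \<longrightarrow> (n 1 2, n 1 3, n 2 3) = (1, 1, 1)"
    using n3 by auto
qed

abbreviation "standardizable j \<equiv> \<exists>Vd' S' \<alpha>' \<sigma>'.
   simply_laced_ears form R X Vd' S' \<alpha>' \<sigma>' \<and> similar_semilattices V0 S S' \<and>
   standard_supp \<nu> j (supp_class \<nu> \<sigma>' S')"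

text \<open>An affine change of coordinates: the new origin has coordinates \<open>t\<close>, the new basis vectors have
  coordinates \<open>u r\<close>, and \<open>w\<close> is the inverse of the matrix \<open>u\<close>. By the parity description of \<open>S\<close>, the new
  supporting class can be computed from the old one.\<close>

lemma standardizableI:
  fixes t :: "nat \<Rightarrow> int" and u w :: "nat \<Rightarrow> nat \<Rightarrow> int"
  assumes l: "l = 1"
    and std: "standard_supp \<nu> j {J. J \<subseteq> {1..\<nu>} \<and> {q \<in> {1..\<nu>}. odd (t q + (\<Sum>r\<in>J. u r q))} \<in> SC}"
    and inverse: "\<And>r q. \<lbrakk>r \<in> {1..\<nu>}; q \<in> {1..\<nu>}\<rbrakk> \<Longrightarrow> (\<Sum>s=1..\<nu>. w r s * u s q) = (if r = q then 1 else 0)"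
  shows "standardizable j"
proof -
  define \<tau> where "\<tau> = (\<Sum>q=1..\<nu>. of_int (t q) *\<^sub>R \<sigma> q)"
  define \<sigma>' where "\<sigma>' r = (\<Sum>q=1..\<nu>. of_int (u r q) *\<^sub>R \<sigma> q)" for r
  let ?S = "(\<lambda>s. s - \<tau>) ` S"
  have sum_eq: "(\<Sum>r\<in>J. \<sigma>' r) + \<tau> = (\<Sum>q=1..\<nu>. of_int (t q + (\<Sum>r\<in>J. u r q)) *\<^sub>R \<sigma> q)" for J
  proof -
    have "(\<Sum>r\<in>J. \<sigma>' r) = (\<Sum>q=1..\<nu>. of_int (\<Sum>r\<in>J. u r q) *\<^sub>R \<sigma> q)"
      unfolding \<sigma>'_def by (subst sum.swap) (simp add: scaleR_sum_left)
    then show ?thesis by (simp add: \<tau>_def scaleR_add_left sum.distrib)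
  qed
  have in_S: "(\<Sum>r\<in>J. \<sigma>' r) + \<tau> \<in> S \<longleftrightarrow> {q \<in> {1..\<nu>}. odd (t q + (\<Sum>r\<in>J. u r q))} \<in> SC" for J
    unfolding sum_eq by (rule sum_in_S_iff)
  have \<tau>: "\<tau> \<in> S"
    using standard_supp_closed(2)[OF std] in_S[of "{}"] by simp
  have \<sigma>'_S: "\<sigma>' r + \<tau> \<in> S" if "r \<in> {1..\<nu>}" for r
    using standard_supp_closed(3)[OF std that] in_S[of "{r}"] by simp
  have \<sigma>: "\<sigma> r = (\<Sum>s=1..\<nu>. of_int (w r s) *\<^sub>R \<sigma>' s)" if r: "r \<in> {1..\<nu>}" for r
  proof -
    have "(\<Sum>s=1..\<nu>. of_int (w r s) *\<^sub>R \<sigma>' s) = (\<Sum>s=1..\<nu>. \<Sum>q=1..\<nu>. of_int (w r s * u s q) *\<^sub>R \<sigma> q)"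
      by (simp add: \<sigma>'_def scaleR_sum_right)
    also have "\<dots> = (\<Sum>q=1..\<nu>. of_int (\<Sum>s=1..\<nu>. w r s * u s q) *\<^sub>R \<sigma> q)"
      by (subst sum.swap) (simp add: scaleR_sum_left)
    also have "\<dots> = (\<Sum>q=1..\<nu>. if q = r then \<sigma> r else 0)"
      using inverse[OF r] by (intro sum.cong) auto
    also have "\<dots> = \<sigma> r" using r by simp
    finally show ?thesis by simp
  qed
  have \<sigma>'_\<Lambda>: "\<sigma>' r \<in> \<Lambda>" for r unfolding \<sigma>'_def by (rule sum_in_\<Lambda>)
  note new = shifted_ears[OF l \<tau> \<sigma>'_S z_basisI[OF \<sigma>'_\<Lambda> \<sigma>]]
  have ears': "simply_laced_ears form R X (span {\<alpha> 1 + \<tau>}) ?S (\<lambda>_. \<alpha> 1 + \<tau>) \<sigma>'"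
    by (rule new(1))
  then interpret new: simply_laced form R "span {\<alpha> 1 + \<tau>}" ?S X "\<lambda>_. \<alpha> 1 + \<tau>" \<sigma>' by (rule simply_laced.intro)
  have "supp_class \<nu> \<sigma>' ?S = {J. J \<subseteq> {1..\<nu>} \<and> {q \<in> {1..\<nu>}. odd (t q + (\<Sum>r\<in>J. u r q))} \<in> SC}"
  proof (rule Set.set_eqI)
    fix J
    have shift: "x \<in> ?S \<longleftrightarrow> x + \<tau> \<in> S" for x by force
    show "J \<in> supp_class \<nu> \<sigma>' ?S \<longleftrightarrow> J \<in> {J. J \<subseteq> {1..\<nu>} \<and> {q \<in> {1..\<nu>}. odd (t q + (\<Sum>r\<in>J. u r q))} \<in> SC}"
      using new.in_supp_class_iff[of J] new.supp_class_subset[of J] shift in_S by blast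
  qed
  then show ?thesis using ears' new(2) std by (intro exI conjI) (assumption | simp)+
qed

text \<open>For nullity three a supporting class contains the empty set and the singletons, so it is
  encoded by four truth values.\<close>

definition supp3 :: "bool \<Rightarrow> bool \<Rightarrow> bool \<Rightarrow> bool \<Rightarrow> nat set set" where
  "supp3 b12 b13 b23 b123 = {{}, {1}, {2}, {3}} \<union> (if b12 then {{1, 2}} else {}) \<union>
     (if b13 then {{1, 3}} else {}) \<union> (if b23 then {{2, 3}} else {}) \<union> (if b123 then {{1, 2, 3}} else {})"

lemma subset_three_eq_iff:
  assumes "A \<subseteq> {1, 2, 3 :: nat}" "B \<subseteq> {1, 2, 3}"
  shows "A = B \<longleftrightarrow> (1 \<in> A \<longleftrightarrow> 1 \<in> B) \<and> (2 \<in> A \<longleftrightarrow> 2 \<in> B) \<and> (3 \<in> A \<longleftrightarrow> 3 \<in> B)"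
proof (rule iffI, simp, rule Set.set_eqI)
  fix x assume h: "(1 \<in> A \<longleftrightarrow> 1 \<in> B) \<and> (2 \<in> A \<longleftrightarrow> 2 \<in> B) \<and> (3 \<in> A \<longleftrightarrow> 3 \<in> B)"
  show "x \<in> A \<longleftrightarrow> x \<in> B"
  proof (cases "x \<in> {1, 2, 3}")
    case True
    then show ?thesis using h by (elim insertE emptyE) (simp_all only:)
  next
    case False
    then show ?thesis using assms by blast
  qed
qed

lemma subset_three_cases:
  assumes "J \<subseteq> {1, 2, 3 :: nat}"
  shows "J \<in> {{}, {1}, {2}, {3}, {1, 2}, {1, 3}, {2, 3}, {1, 2, 3}}"
  using assms by (simp add: subset_three_eq_iff) blast

lemma supp3_mem:
  "{} \<in> supp3 b12 b13 b23 b123" "{1} \<in> supp3 b12 b13 b23 b123"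
  "{2} \<in> supp3 b12 b13 b23 b123" "{3} \<in> supp3 b12 b13 b23 b123"
  "{1, 2} \<in> supp3 b12 b13 b23 b123 \<longleftrightarrow> b12" "{1, 3} \<in> supp3 b12 b13 b23 b123 \<longleftrightarrow> b13"
  "{2, 3} \<in> supp3 b12 b13 b23 b123 \<longleftrightarrow> b23" "{1, 2, 3} \<in> supp3 b12 b13 b23 b123 \<longleftrightarrow> b123"
  by (simp_all add: supp3_def subset_three_eq_iff)

lemma supp3_eq:
  assumes "A \<subseteq> Pow {1, 2, 3 :: nat}" "{} \<in> A" "{1} \<in> A" "{2} \<in> A" "{3} \<in> A"
  shows "A = supp3 ({1, 2} \<in> A) ({1, 3} \<in> A) ({2, 3} \<in> A) ({1, 2, 3} \<in> A)" (is "_ = ?B")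
proof (rule Set.set_eqI)
  fix J
  have B: "?B \<subseteq> Pow {1, 2, 3}" unfolding supp3_def by simp
  show "J \<in> A \<longleftrightarrow> J \<in> ?B"
  proof (cases "J \<subseteq> {1, 2, 3}")
    case True
    from subset_three_cases[OF this] show ?thesis
      using assms(2-5) by (elim insertE emptyE) (simp_all only: supp3_mem)
  next
    case False
    then show ?thesis using assms(1) B by blast
  qed
qed

lemma card_supp3:
  "card (supp3 b12 b13 b23 b123) = 4 + of_bool b12 + of_bool b13 + of_bool b23 + of_bool b123"
  by (simp add: supp3_def card_insert_if subset_three_eq_iff)

lemma standard_supp3:
  "standard_supp 3 3 (supp3 False False False False)"
  "standard_supp 3 4 (supp3 False False True False)"
  "standard_supp 3 5 (supp3 False True True False)"
  "standard_supp 3 6 (supp3 True True True False)"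
  "standard_supp 3 7 (supp3 True True True True)"
proof -
  show "standard_supp 3 3 (supp3 False False False False)"
    using standard_supp.intros(5) by (simp add: supp3_def)
  show "standard_supp 3 4 (supp3 False False True False)"
    using standard_supp.intros(6) by (simp add: supp3_def insert_commute)
  show "standard_supp 3 5 (supp3 False True True False)"
    using standard_supp.intros(7) by (simp add: supp3_def insert_commute)
  show "standard_supp 3 6 (supp3 True True True False)"
    using standard_supp.intros(8) by (simp add: supp3_def insert_commute)
  have "Pow {1, 2, 3} = supp3 True True True True"
    by (rule trans[OF supp3_eq]) simp_all
  then show "standard_supp 3 7 (supp3 True True True True)"
    using standard_supp.intros(9) by simp
qed

definition vec3 :: "'a \<Rightarrow> 'a \<Rightarrow> 'a \<Rightarrow> nat \<Rightarrow> 'a" where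
  "vec3 a b c r = (if r = 1 then a else if r = 2 then b else c)"

lemma vec3_simps [simp]: "vec3 a b c 1 = a" "vec3 a b c (Suc 0) = a" "vec3 a b c 2 = b" "vec3 a b c 3 = c"
  by (simp_all add: vec3_def)

lemma three_set: "{1..3 :: nat} = {1, 2, 3}" by auto

lemma standardizable3:
  fixes t :: "nat \<Rightarrow> int" and u w :: "nat \<Rightarrow> nat \<Rightarrow> int"
  defines "par \<equiv> \<lambda>f :: nat \<Rightarrow> int. (if odd (f 1) then {1} else {}) \<union> (if odd (f 2) then {2} else {}) \<union> (if odd (f 3) then {3} else {})"
  assumes l: "l = 1" and \<nu>: "\<nu> = 3"
    and inverse: "\<forall>r \<in> {1, 2, 3}. \<forall>q \<in> {1, 2, 3}. w r 1 * u 1 q + w r 2 * u 2 q + w r 3 * u 3 q = (if r = q then 1 else 0)"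
    and "par t \<in> SC" "par (\<lambda>q. t q + u 1 q) \<in> SC" "par (\<lambda>q. t q + u 2 q) \<in> SC" "par (\<lambda>q. t q + u 3 q) \<in> SC"
    and "standard_supp 3 j (supp3 (par (\<lambda>q. t q + (u 1 q + u 2 q)) \<in> SC) (par (\<lambda>q. t q + (u 1 q + u 3 q)) \<in> SC)
      (par (\<lambda>q. t q + (u 2 q + u 3 q)) \<in> SC) (par (\<lambda>q. t q + (u 1 q + (u 2 q + u 3 q))) \<in> SC))"
  shows "standardizable j"
proof (rule standardizableI[OF l, where t = t and u = u and w = w])
  have par: "{q \<in> {1..\<nu>}. odd (f q)} = par f" for f
    unfolding \<nu> three_set par_def by auto
  let ?A = "{J. J \<subseteq> {1..\<nu>} \<and> {q \<in> {1..\<nu>}. odd (t q + (\<Sum>r\<in>J. u r q))} \<in> SC}"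
  have A: "?A = {J. J \<subseteq> {1, 2, 3} \<and> par (\<lambda>q. t q + (\<Sum>r\<in>J. u r q)) \<in> SC}"
    unfolding par unfolding \<nu> three_set ..
  have "?A = supp3 ({1, 2} \<in> ?A) ({1, 3} \<in> ?A) ({2, 3} \<in> ?A) ({1, 2, 3} \<in> ?A)"
    unfolding A by (rule supp3_eq) (use assms(5-8) in auto)
  moreover have "({1, 2} \<in> ?A) = (par (\<lambda>q. t q + (u 1 q + u 2 q)) \<in> SC)" "({1, 3} \<in> ?A) = (par (\<lambda>q. t q + (u 1 q + u 3 q)) \<in> SC)"
    "({2, 3} \<in> ?A) = (par (\<lambda>q. t q + (u 2 q + u 3 q)) \<in> SC)"
    "({1, 2, 3} \<in> ?A) = (par (\<lambda>q. t q + (u 1 q + (u 2 q + u 3 q))) \<in> SC)"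
    unfolding A by simp_all
  ultimately have "?A = supp3 (par (\<lambda>q. t q + (u 1 q + u 2 q)) \<in> SC) (par (\<lambda>q. t q + (u 1 q + u 3 q)) \<in> SC)
      (par (\<lambda>q. t q + (u 2 q + u 3 q)) \<in> SC) (par (\<lambda>q. t q + (u 1 q + (u 2 q + u 3 q))) \<in> SC)" by (simp only:)
  then show "standard_supp \<nu> j ?A" using assms(9) \<nu> by (simp only:)
  show "(\<Sum>s=1..\<nu>. w r s * u s q) = (if r = q then 1 else 0)" if "r \<in> {1..\<nu>}" "q \<in> {1..\<nu>}" for r q
  proof -
    have "r \<in> {1, 2, 3}" "q \<in> {1, 2, 3}" using that unfolding \<nu> three_set by blast+
    then have "w r 1 * u 1 q + w r 2 * u 2 q + w r 3 * u 3 q = (if r = q then 1 else 0)" using inverse by blast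
    then show ?thesis unfolding \<nu> three_set by simp
  qed
qed

lemma supp_class_basic: "{} \<in> SC" "r \<in> {1..\<nu>} \<Longrightarrow> {r} \<in> SC"
  using in_supp_class_iff[of "{}"] in_supp_class_iff[of "{r}"] zero_in_S \<sigma>_in_S by auto

lemma standardizable_id:
  assumes "standard_supp \<nu> j SC"
  shows "standardizable j"
proof -
  have "similar_semilattices V0 S S"
    unfolding similar_semilattices_def
  proof (intro bexI[of _ "\<lambda>x\<in>V0. x"] bexI[of _ 0])
    show "(\<lambda>x\<in>V0. x) ` S = (\<lambda>x. x + 0) ` S" using S_subset by force
    show "(\<lambda>x\<in>V0. x) \<in> carrier (GL V0)"
      using monoid.one_closed[OF group.is_monoid[OF group_GL[OF subspace_V0]]] by (simp add: GL_one)
  qed (rule zero_in_S)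
  then show ?thesis using ears assms by blast
qed

text \<open>The supporting class is a subset of the affine space of dimension three over the field with two
  elements that contains the origin and a basis; its complement has at most four points, and an affine
  change of coordinates brings it into the position of the representative with the same number of points.
  Permutations and elementary changes of the basis suffice, except when \<open>{1, 2, 3}\<close> is the only member with
  more than one element: then no two different nonzero members have their sum in the class, and the origin has to be moved.
  In the table, the coordinates of the new origin are \<open>t\<close>, those of the new basis are \<open>u\<close>, and \<open>w\<close>
  is the inverse of \<open>u\<close>.\<close>

lemma standardizable_three:
  assumes l: "l = 1" and \<nu>: "\<nu> = 3"
  shows "standardizable (card SC - 1)"
proof -
  define b12 b13 b23 b123 where b: "b12 \<longleftrightarrow> {1, 2} \<in> SC" "b13 \<longleftrightarrow> {1, 3} \<in> SC" "b23 \<longleftrightarrow> {2, 3} \<in> SC" "b123 \<longleftrightarrow> {1, 2, 3} \<in> SC"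
  have sub: "SC \<subseteq> Pow {1, 2, 3}" using supp_class_subset \<nu> three_set by auto
  have S1: "{} \<in> SC" "{1} \<in> SC" "{2} \<in> SC" "{3} \<in> SC" using supp_class_basic(1) supp_class_basic(2) \<nu> by auto
  have SC: "SC = supp3 b12 b13 b23 b123" unfolding b by (rule supp3_eq[OF sub S1])
  have card: "card SC - 1 = 3 + of_bool b12 + of_bool b13 + of_bool b23 + of_bool b123"
    unfolding SC card_supp3 by simp
  have mem: "{} \<in> SC" "{Suc 0} \<in> SC" "{2} \<in> SC" "{3} \<in> SC"
    "{Suc 0, 2} \<in> SC \<longleftrightarrow> b12" "{Suc 0, 3} \<in> SC \<longleftrightarrow> b13"
    "{2, 3} \<in> SC \<longleftrightarrow> b23" "{Suc 0, 2, 3} \<in> SC \<longleftrightarrow> b123"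
    "{2, Suc 0} \<in> SC \<longleftrightarrow> b12" "{3, Suc 0} \<in> SC \<longleftrightarrow> b13"
    "{3, 2} \<in> SC \<longleftrightarrow> b23" "{3, 2, Suc 0} \<in> SC \<longleftrightarrow> b123"
    using S1 by (simp_all add: b insert_commute)
  note id = standardizable_id
  note choose = standardizable3[OF l \<nu>]
  note std = standard_supp3
  consider
    (c0) "\<not> b12" "\<not> b13" "\<not> b23" "\<not> b123"
    | (c1) "\<not> b12" "\<not> b13" "b23" "\<not> b123"
    | (c2) "\<not> b12" "b13" "b23" "\<not> b123"
    | (c3) "b12" "b13" "b23" "\<not> b123"
    | (c4) "b12" "b13" "b23" "b123"
    | (c5) "b12" "\<not> b13" "\<not> b23" "\<not> b123"
    | (c6) "\<not> b12" "b13" "\<not> b23" "\<not> b123"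
    | (c7) "\<not> b12" "\<not> b13" "\<not> b23" "b123"
    | (c8) "b12" "b13" "\<not> b23" "\<not> b123"
    | (c9) "b12" "\<not> b13" "b23" "\<not> b123"
    | (c10) "b12" "\<not> b13" "\<not> b23" "b123"
    | (c11) "\<not> b12" "b13" "\<not> b23" "b123"
    | (c12) "\<not> b12" "\<not> b13" "b23" "b123"
    | (c13) "\<not> b12" "b13" "b23" "b123"
    | (c14) "b12" "\<not> b13" "b23" "b123"
    | (c15) "b12" "b13" "\<not> b23" "b123"
    by (cases b12; cases b13; cases b23; cases b123) simp_all
  then show ?thesis
  proof cases
    case c0
    then have j: "card SC - 1 = 3" using card by simp
    have "standard_supp \<nu> 3 SC" unfolding SC unfolding \<nu> using c0 std by simp
    then show ?thesis unfolding j by (rule id)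
  next
    case c1
    then have j: "card SC - 1 = 4" using card by simp
    have "standard_supp \<nu> 4 SC" unfolding SC unfolding \<nu> using c1 std by simp
    then show ?thesis unfolding j by (rule id)
  next
    case c2
    then have j: "card SC - 1 = 5" using card by simp
    have "standard_supp \<nu> 5 SC" unfolding SC unfolding \<nu> using c2 std by simp
    then show ?thesis unfolding j by (rule id)
  next
    case c3
    then have j: "card SC - 1 = 6" using card by simp
    have "standard_supp \<nu> 6 SC" unfolding SC unfolding \<nu> using c3 std by simp
    then show ?thesis unfolding j by (rule id)
  next
    case c4
    then have j: "card SC - 1 = 7" using card by simp
    have "standard_supp \<nu> 7 SC" unfolding SC unfolding \<nu> using c4 std by simp
    then show ?thesis unfolding j by (rule id)
  next
    case c5
    then have j: "card SC - 1 = 4" using card by simp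
    show ?thesis unfolding j
      by (rule choose[where t = "vec3 0 0 0"
            and u = "vec3 (vec3 0 0 1) (vec3 1 0 0) (vec3 0 1 0)"
            and w = "vec3 (vec3 0 1 0) (vec3 0 0 1) (vec3 1 0 0)"])
        (use c5 std in \<open>simp_all add: mem\<close>)
  next
    case c6
    then have j: "card SC - 1 = 4" using card by simp
    show ?thesis unfolding j
      by (rule choose[where t = "vec3 0 0 0"
            and u = "vec3 (vec3 0 1 0) (vec3 1 0 0) (vec3 0 0 1)"
            and w = "vec3 (vec3 0 1 0) (vec3 1 0 0) (vec3 0 0 1)"])
        (use c6 std in \<open>simp_all add: mem\<close>)
  next
    case c7
    then have j: "card SC - 1 = 4" using card by simp
    show ?thesis unfolding j
      by (rule choose[where t = "vec3 1 0 0"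
            and u = "vec3 (vec3 (-1) 0 0) (vec3 (-1) 1 0) (vec3 (-1) 0 1)"
            and w = "vec3 (vec3 (-1) 0 0) (vec3 (-1) 1 0) (vec3 (-1) 0 1)"])
        (use c7 std in \<open>simp_all add: mem\<close>)
  next
    case c8
    then have j: "card SC - 1 = 5" using card by simp
    show ?thesis unfolding j
      by (rule choose[where t = "vec3 0 0 0"
            and u = "vec3 (vec3 0 1 0) (vec3 0 0 1) (vec3 1 0 0)"
            and w = "vec3 (vec3 0 0 1) (vec3 1 0 0) (vec3 0 1 0)"])
        (use c8 std in \<open>simp_all add: mem\<close>)
  next
    case c9
    then have j: "card SC - 1 = 5" using card by simp
    show ?thesis unfolding j
      by (rule choose[where t = "vec3 0 0 0"
            and u = "vec3 (vec3 1 0 0) (vec3 0 0 1) (vec3 0 1 0)"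
            and w = "vec3 (vec3 1 0 0) (vec3 0 0 1) (vec3 0 1 0)"])
        (use c9 std in \<open>simp_all add: mem\<close>)
  next
    case c10
    then have j: "card SC - 1 = 5" using card by simp
    show ?thesis unfolding j
      by (rule choose[where t = "vec3 0 0 0"
            and u = "vec3 (vec3 0 0 1) (vec3 1 0 0) (vec3 1 1 0)"
            and w = "vec3 (vec3 0 1 0) (vec3 0 (-1) 1) (vec3 1 0 0)"])
        (use c10 std in \<open>simp_all add: mem\<close>)
  next
    case c11
    then have j: "card SC - 1 = 5" using card by simp
    show ?thesis unfolding j
      by (rule choose[where t = "vec3 0 0 0"
            and u = "vec3 (vec3 0 1 0) (vec3 1 0 0) (vec3 1 0 1)"
            and w = "vec3 (vec3 0 1 0) (vec3 1 0 0) (vec3 0 (-1) 1)"])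
        (use c11 std in \<open>simp_all add: mem\<close>)
  next
    case c12
    then have j: "card SC - 1 = 5" using card by simp
    show ?thesis unfolding j
      by (rule choose[where t = "vec3 0 0 0"
            and u = "vec3 (vec3 1 0 0) (vec3 0 1 0) (vec3 0 1 1)"
            and w = "vec3 (vec3 1 0 0) (vec3 0 1 0) (vec3 0 (-1) 1)"])
        (use c12 std in \<open>simp_all add: mem\<close>)
  next
    case c13
    then have j: "card SC - 1 = 6" using card by simp
    show ?thesis unfolding j
      by (rule choose[where t = "vec3 0 0 0"
            and u = "vec3 (vec3 1 0 0) (vec3 0 1 1) (vec3 0 0 1)"
            and w = "vec3 (vec3 1 0 0) (vec3 0 1 (-1)) (vec3 0 0 1)"])
        (use c13 std in \<open>simp_all add: mem\<close>)
  next
    case c14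
    then have j: "card SC - 1 = 6" using card by simp
    show ?thesis unfolding j
      by (rule choose[where t = "vec3 0 0 0"
            and u = "vec3 (vec3 1 0 0) (vec3 0 1 0) (vec3 0 1 1)"
            and w = "vec3 (vec3 1 0 0) (vec3 0 1 0) (vec3 0 (-1) 1)"])
        (use c14 std in \<open>simp_all add: mem\<close>)
  next
    case c15
    then have j: "card SC - 1 = 6" using card by simp
    show ?thesis unfolding j
      by (rule choose[where t = "vec3 0 0 0"
            and u = "vec3 (vec3 0 1 0) (vec3 1 0 0) (vec3 1 0 1)"
            and w = "vec3 (vec3 0 1 0) (vec3 1 0 0) (vec3 0 (-1) 1)"])
        (use c15 std in \<open>simp_all add: mem\<close>)
  qed
qed

lemma standardizable:
  assumes l: "l = 1" and "\<nu> \<le> 3"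
  shows "standardizable (ind \<nu> \<sigma> S)"
proof -
  have sub: "SC \<subseteq> Pow {1..\<nu>}" using supp_class_subset by auto
  have mem: "{} \<in> SC" "r \<in> {1..\<nu>} \<Longrightarrow> {r} \<in> SC" for r by (rule supp_class_basic(1), rule supp_class_basic(2))
  note id = standardizable_id
  consider "\<nu> = 0" | "\<nu> = 1" | "\<nu> = 2" | "\<nu> = 3" using assms(2) by linarith
  then show ?thesis
  proof cases
    case 1
    have "SC = {{}}"
    proof
      show "SC \<subseteq> {{}}" using sub unfolding 1 by simp
    qed (use mem in simp)
    then show ?thesis using id standard_supp.intros(1) unfolding ind_def by (simp add: 1)
  next
    case 2
    have "SC = {{}, {1}}"
    proof
      show "SC \<subseteq> {{}, {1}}" using sub unfolding 2 by auto
    qed (use mem(1) mem(2)[of 1] 2 in simp)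
    then show ?thesis using id standard_supp.intros(2) unfolding ind_def by (simp add: 2)
  next
    case 3
    have pow: "Pow {1..\<nu>} = {{}, {1}, {2}, {1, 2}}"
    proof -
      have "{1..\<nu>} = {1, 2}" unfolding 3 by auto
      then show ?thesis by (auto simp: Pow_insert insert_commute)
    qed
    have basic: "{{}, {1}, {2}} \<subseteq> SC" using mem(1) mem(2)[of 1] mem(2)[of 2] 3 by simp
    show ?thesis
    proof (cases "{1, 2} \<in> SC")
      case True
      then have SC: "SC = {{}, {1}, {2}, {1, 2}}" using basic sub unfolding pow by blast
      have "card {{}, {1}, {2}, {1, 2 :: nat}} - 1 = 3" by (simp add: subset_three_eq_iff)
      then have ind: "ind \<nu> \<sigma> S = 3" unfolding ind_def SC .
      have "standard_supp \<nu> 3 SC" unfolding SC unfolding 3 by (rule standard_supp.intros(4))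
      then show ?thesis unfolding ind by (rule id)
    next
      case False
      then have SC: "SC = {{}, {1}, {2}}" using basic sub unfolding pow by blast
      have "card {{}, {1}, {2 :: nat}} - 1 = 2" by simp
      then have ind: "ind \<nu> \<sigma> S = 2" unfolding ind_def SC .
      have "standard_supp \<nu> 2 SC" unfolding SC unfolding 3 by (rule standard_supp.intros(3))
      then show ?thesis unfolding ind by (rule id)
    qed
  next
    case 4
    then show ?thesis using standardizable_three[OF l] unfolding ind_def by simp
  qed
qed

end

theorem theorem3p7:
  fixes form :: "'v::euclidean_space \<Rightarrow> 'v \<Rightarrow> real"
    and R Vd S :: "'v set"
    and X :: ade_type
    and \<alpha> \<sigma> :: "nat \<Rightarrow> 'v"
    and l \<nu> m :: nat
    and a :: "nat \<Rightarrow> nat \<Rightarrow> real"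
    and n :: "nat \<Rightarrow> nat \<Rightarrow> nat"
  assumes "simply_laced_ears form R X Vd S \<alpha> \<sigma>"
    and "l = form_rank form"
    and "\<nu> = nullity form"
    and "m = ind \<nu> \<sigma> S"
    and "a = (\<lambda>i j. form (\<alpha> i) (\<alpha> j))"
    and "n = n_exp form Vd S \<sigma>"
  shows
    "(F_generated_by_powers form Vd S \<sigma> \<longrightarrow> heisenberg_group form Vd R \<cong> heis_hat l \<nu> a n) \<and>
     (l > 1 \<longrightarrow>
        F_generated_by_powers form Vd S \<sigma> \<and>
        (\<forall>r s. 1 \<le> r \<and> r < s \<and> s \<le> \<nu> \<longrightarrow> n r s = 1)) \<and>
     (l = 1 \<and> \<nu> \<le> 3 \<longrightarrow>
        (\<exists>Vd' S' \<alpha>' \<sigma>'.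
           simply_laced_ears form R X Vd' S' \<alpha>' \<sigma>' \<and>
           similar_semilattices (form_radical form) S S' \<and>
           standard_supp \<nu> m (supp_class \<nu> \<sigma>' S')) \<and>
        (standard_supp \<nu> m (supp_class \<nu> \<sigma> S) \<longrightarrow>
           F_generated_by_powers form Vd S \<sigma> \<and>
           (\<nu> = 2 \<and> m = 2 \<longrightarrow> n 1 2 = 2) \<and>
           (\<nu> = 2 \<and> m = 3 \<longrightarrow> n 1 2 = 1) \<and>
           (\<nu> = 3 \<and> m = 3 \<longrightarrow> (n 1 2, n 1 3, n 2 3) = (2, 2, 2)) \<and>
           (\<nu> = 3 \<and> m = 4 \<longrightarrow> (n 1 2, n 1 3, n 2 3) = (2, 2, 1)) \<and>
           (\<nu> = 3 \<and> m = 5 \<longrightarrow> (n 1 2, n 1 3, n 2 3) = (2, 1, 1)) \<and>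
           (\<nu> = 3 \<and> (m = 6 \<or> m = 7) \<longrightarrow> (n 1 2, n 1 3, n 2 3) = (1, 1, 1))))"
proof -
  interpret simply_laced form R Vd S X \<alpha> \<sigma>
    by (rule simply_laced.intro) (rule assms(1))
  have l: "l = type_rank X" using assms(2) rank_eq by simp
  have presentation: "heisenberg_group form Vd R \<cong> heis_hat l \<nu> a n" if "F_generated_by_powers form Vd S \<sigma>"
    using heisenberg_presentation[OF that] unfolding l assms(3,5,6) .
  have lattice_case: "F_generated_by_powers form Vd S \<sigma> \<and> (\<forall>r s. 1 \<le> r \<and> r < s \<and> s \<le> \<nu> \<longrightarrow> n r s = 1)" if "l > 1"
    using lattice_F that unfolding l assms(3,6) by (simp add: pairs_def)
  have standard: "\<exists>Vd' S' \<alpha>' \<sigma>'.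
      simply_laced_ears form R X Vd' S' \<alpha>' \<sigma>' \<and>
      similar_semilattices (form_radical form) S S' \<and>
      standard_supp \<nu> m (supp_class \<nu> \<sigma>' S')" if "l = 1" "\<nu> \<le> 3"
    using standardizable that unfolding l assms(3,4) .
  show ?thesis
    using presentation lattice_case standard standard_supp_F[of m] unfolding assms(3,6)[symmetric] by blast
qed

end
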